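(* Let $\mathbb K$ be a restrained definably complete expansion of an ordered field, and let $A, A' \subseteq \mathbb K^n$ be $\mathcal D_\Sigma$ sets. Then: (1) $\dim(\overline{A}) = \dim(A)$, where $\overline A$ is the topological closure of $A$; (2) if $f: A \to \mathbb K^n$ is definable and continuous, then $\dim(f(A)) \le \dim(A)$; (3) $\dim(A\cup A') = \max(\dim(A),\dim(A'))$; (4) if $B\subseteq\mathbb K^{n+m}$ is a $\mathcal D_\Sigma$ set, $C$ is the projection of $B$ onto the first $n$ coordinates, $\dim(C)=p$, and $\dim(B_{\bar a}) = q$ for every $\bar a\in C$, where $B_{\bar a}=\{\bar c\in\mathbb K^m:(\bar a,\bar c)\in B\}$, then $\dim(B) = p+q$.
   Context: $\mathbb K$ is an expansion of an ordered field, with the order topology on $\mathbb K$ and product topology on $\mathbb K^n$; "definable" means definable in $\mathbb K$ with parameters. $\mathbb K$ is definably complete if every definable subset of $\mathbb K$ has a least upper bound in $\mathbb K\cup\{\pm\infty\}$. $\mathbb K$ is restrained if it is definably complete and for every definable discrete $D\subseteq\mathbb K^k$ and every definable $g:D\to\mathbb K$, $g(D)$ is nowhere dense in $\mathbb K$. A definable $X\subseteq\mathbb K^n$ is a $\mathcal D_\Sigma$ set if $X$ is the projection onto the first $n$ coordinates of some definable closed $Y\subseteq\mathbb K^{n+1}$. For $X\subseteq\mathbb K^n$, $\dim(X)$ is the maximum $e$ such that there is a coordinate subspace $L$ of linear dimension $e$ with the orthogonal projection of $X$ onto $L$ having nonempty interior in $L$. *)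

theory Defs
  imports "HOL-Analysis.Analysis" "HOL-Library.Extended" "HOL-Library.Lub_Glb"
begin

text \<open>
  The ordered field is the whole type \<^typ>\<open>'a\<close> of sort
  \<open>{linordered_field, linorder_topology}\<close>, so that its topology is the order topology. An
  expansion adds function symbols \<^typ>\<open>'f\<close> and relation symbols \<^typ>\<open>'r\<close> to the language of
  ordered fields. Interpretations are only ever applied to argument lists of the right length.
\<close>

record ('f, 'r, 'a) expansion =
  fun_arity :: "'f \<Rightarrow> nat"
  rel_arity :: "'r \<Rightarrow> nat"
  fun_interp :: "'f \<Rightarrow> 'a list \<Rightarrow> 'a"
  rel_interp :: "'r \<Rightarrow> 'a list \<Rightarrow> bool"

datatype 'f trm =
    TVar nat
  | TZero
  | TOne
  | TMinus "'f trm"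
  | TPlus "'f trm" "'f trm"
  | TTimes "'f trm" "'f trm"
  | TFun 'f "'f trm list"

datatype ('f, 'r) fml =
    FEq "'f trm" "'f trm"
  | FLess "'f trm" "'f trm"
  | FRel 'r "'f trm list"
  | FNot "('f, 'r) fml"
  | FAnd "('f, 'r) fml" "('f, 'r) fml"
  | FEx nat "('f, 'r) fml"

primrec wf_trm :: "('f, 'r, 'a) expansion \<Rightarrow> 'f trm \<Rightarrow> bool" where
  "wf_trm K (TVar i) \<longleftrightarrow> True"
| "wf_trm K TZero \<longleftrightarrow> True"
| "wf_trm K TOne \<longleftrightarrow> True"
| "wf_trm K (TMinus s) \<longleftrightarrow> wf_trm K s"
| "wf_trm K (TPlus s t) \<longleftrightarrow> wf_trm K s \<and> wf_trm K t"
| "wf_trm K (TTimes s t) \<longleftrightarrow> wf_trm K s \<and> wf_trm K t"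
| "wf_trm K (TFun f ts) \<longleftrightarrow> length ts = fun_arity K f \<and> list_all (wf_trm K) ts"

primrec wf_fml :: "('f, 'r, 'a) expansion \<Rightarrow> ('f, 'r) fml \<Rightarrow> bool" where
  "wf_fml K (FEq s t) \<longleftrightarrow> wf_trm K s \<and> wf_trm K t"
| "wf_fml K (FLess s t) \<longleftrightarrow> wf_trm K s \<and> wf_trm K t"
| "wf_fml K (FRel r ts) \<longleftrightarrow> length ts = rel_arity K r \<and> list_all (wf_trm K) ts"
| "wf_fml K (FNot \<phi>) \<longleftrightarrow> wf_fml K \<phi>"
| "wf_fml K (FAnd \<phi> \<psi>) \<longleftrightarrow> wf_fml K \<phi> \<and> wf_fml K \<psi>"
| "wf_fml K (FEx i \<phi>) \<longleftrightarrow> wf_fml K \<phi>"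

primrec eval_trm ::
  "('f, 'r, 'a::linordered_field) expansion \<Rightarrow> (nat \<Rightarrow> 'a) \<Rightarrow> 'f trm \<Rightarrow> 'a" where
  "eval_trm K e (TVar i) = e i"
| "eval_trm K e TZero = 0"
| "eval_trm K e TOne = 1"
| "eval_trm K e (TMinus s) = - eval_trm K e s"
| "eval_trm K e (TPlus s t) = eval_trm K e s + eval_trm K e t"
| "eval_trm K e (TTimes s t) = eval_trm K e s * eval_trm K e t"
| "eval_trm K e (TFun f ts) = fun_interp K f (map (eval_trm K e) ts)"

primrec sat ::
  "('f, 'r, 'a::linordered_field) expansion \<Rightarrow> (nat \<Rightarrow> 'a) \<Rightarrow> ('f, 'r) fml \<Rightarrow> bool" where
  "sat K e (FEq s t) \<longleftrightarrow> eval_trm K e s = eval_trm K e t"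
| "sat K e (FLess s t) \<longleftrightarrow> eval_trm K e s < eval_trm K e t"
| "sat K e (FRel r ts) \<longleftrightarrow> rel_interp K r (map (eval_trm K e) ts)"
| "sat K e (FNot \<phi>) \<longleftrightarrow> \<not> sat K e \<phi>"
| "sat K e (FAnd \<phi> \<psi>) \<longleftrightarrow> sat K e \<phi> \<and> sat K e \<psi>"
| "sat K e (FEx i \<phi>) \<longleftrightarrow> (\<exists>a. sat K (e(i := a)) \<phi>)"

text \<open>
  A point of the $n$-th power of the field is a function on \<^term>\<open>{..<n}\<close>, extensional outside
  of it; these are the points of the library's product topology.
\<close>

abbreviation pow_space :: "nat \<Rightarrow> (nat \<Rightarrow> 'a) set" where
  "pow_space n \<equiv> (\<Pi>\<^sub>E i\<in>{..<n}. UNIV)"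

abbreviation pow_top :: "nat \<Rightarrow> (nat \<Rightarrow> 'a::topological_space) topology" where
  "pow_top n \<equiv> product_topology (\<lambda>_. euclidean) {..<n}"

definition singleton_point :: "'a \<Rightarrow> nat \<Rightarrow> 'a" where
  "singleton_point a = (\<lambda>i\<in>{..<1}. a)"

definition concat_point :: "nat \<Rightarrow> nat \<Rightarrow> (nat \<Rightarrow> 'a) \<Rightarrow> (nat \<Rightarrow> 'a) \<Rightarrow> nat \<Rightarrow> 'a" where
  "concat_point n m a c = (\<lambda>i\<in>{..<n + m}. if i < n then a i else c (i - n))"

definition proj_first :: "nat \<Rightarrow> (nat \<Rightarrow> 'a) \<Rightarrow> nat \<Rightarrow> 'a" where
  "proj_first n x = restrict x {..<n}"

definition fiber :: "nat \<Rightarrow> nat \<Rightarrow> (nat \<Rightarrow> 'a) set \<Rightarrow> (nat \<Rightarrow> 'a) \<Rightarrow> (nat \<Rightarrow> 'a) set" where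
  "fiber n m B a = {c \<in> pow_space m. concat_point n m a c \<in> B}"

text \<open>
  In a formula defining a subset of the $n$-th power, the variables below \<open>n\<close> are the coordinates
  and the remaining free variables are assigned the parameters \<open>p\<close>.
\<close>

definition definable ::
  "('f, 'r, 'a::linordered_field) expansion \<Rightarrow> nat \<Rightarrow> (nat \<Rightarrow> 'a) set \<Rightarrow> bool" where
  "definable K n X \<longleftrightarrow>
     (\<exists>\<phi> p. wf_fml K \<phi> \<and> X = {x \<in> pow_space n. sat K (override_on p x {..<n}) \<phi>})"

definition definable_map ::
  "('f, 'r, 'a::linordered_field) expansion \<Rightarrow> nat \<Rightarrow> nat \<Rightarrow> (nat \<Rightarrow> 'a) set
     \<Rightarrow> ((nat \<Rightarrow> 'a) \<Rightarrow> (nat \<Rightarrow> 'a)) \<Rightarrow> bool" where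
  "definable_map K n m X f \<longleftrightarrow>
     X \<subseteq> pow_space n \<and> f ` X \<subseteq> pow_space m \<and>
     definable K (n + m) ((\<lambda>x. concat_point n m x (f x)) ` X)"

definition definably_complete :: "('f, 'r, 'a::linordered_field) expansion \<Rightarrow> bool" where
  "definably_complete K \<longleftrightarrow>
     (\<forall>X. definable K 1 (singleton_point ` X) \<longrightarrow> (\<exists>s. isLub UNIV (Fin ` X) s))"

definition nowhere_dense :: "'a::topological_space set \<Rightarrow> bool" where
  "nowhere_dense X \<longleftrightarrow> interior (closure X) = {}"

definition restrained ::
  "('f, 'r, 'a::{linordered_field, linorder_topology}) expansion \<Rightarrow> bool" where
  "restrained K \<longleftrightarrow>
     definably_complete K \<and>
     (\<forall>k D (g :: (nat \<Rightarrow> 'a) \<Rightarrow> 'a).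
        definable K k D \<and> subtopology (pow_top k) D = discrete_topology D \<and>
        definable_map K k 1 D (\<lambda>x. singleton_point (g x))
        \<longrightarrow> nowhere_dense (g ` D))"

definition D_Sigma ::
  "('f, 'r, 'a::{linordered_field, linorder_topology}) expansion \<Rightarrow> nat \<Rightarrow> (nat \<Rightarrow> 'a) set \<Rightarrow> bool"
  where
  "D_Sigma K n X \<longleftrightarrow>
     definable K n X \<and>
     (\<exists>Y. definable K (n + 1) Y \<and> closedin (pow_top (n + 1)) Y \<and> X = proj_first n ` Y)"

text \<open>
  The coordinate subspace spanned by the standard basis vectors with indices in \<open>S\<close>; its linear
  dimension is \<^term>\<open>card S\<close>.
\<close>

definition coord_subspace :: "nat \<Rightarrow> nat set \<Rightarrow> (nat \<Rightarrow> 'a::zero) set" where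
  "coord_subspace n S = {x \<in> pow_space n. \<forall>i\<in>{..<n} - S. x i = 0}"

definition coord_proj :: "nat \<Rightarrow> nat set \<Rightarrow> (nat \<Rightarrow> 'a::zero) \<Rightarrow> nat \<Rightarrow> 'a" where
  "coord_proj n S x = (\<lambda>i\<in>{..<n}. if i \<in> S then x i else 0)"

text \<open>
  For \<open>X \<noteq> {}\<close> the set below contains \<open>0\<close> (take \<open>S = {}\<close>) and is bounded by \<open>n\<close>. For \<open>X = {}\<close> it
  is empty, and the dimension is $-\infty$ by convention. The value \<^term>\<open>Pinf\<close> is never attained.
\<close>

definition dim_set :: "nat \<Rightarrow> (nat \<Rightarrow> 'a::{zero, topological_space}) set \<Rightarrow> nat extended" where
  "dim_set n X =
     (if X = {} then Minf
      else Fin (Max {card S | S. S \<subseteq> {..<n} \<and>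
             subtopology (pow_top n) (coord_subspace n S) interior_of (coord_proj n S ` X) \<noteq> {}}))"

end

theory Submission
  imports Defs
begin

text \<open>
  Predicates on assignments \<open>e :: nat \<Rightarrow> 'a\<close> replace subsets of powers of the field, and the
  dimension is governed by two quantifiers: existence of a value of a variable, and existence of an
  interval of values. On increasing unions of closed definable families these quantifiers satisfy
  commutation rules from which all four claims follow formally.

  The rules rest on a one-dimensional Baire theorem: if no member of an increasing closed family
  contained an interval while its union is dense in one, strict local minima of the entry time
  would give a discrete definable set with a somewhere dense projection, against restrainedness.
  The only rule that is not a Kuratowski-Ulam type statement says that a union, over the points of
  a set without interior, of fibers without interior has no interior: the least point whose fiber
  contains a given value is a lower semicontinuous function of that value, hence by Baire
  continuous on an interval, and there constant or onto an interval.
\<close>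

section \<open>Definable predicates and terms\<close>

text \<open>The field need not be Archimedean or locally compact, so finite subdivisions of an
  interval and compactness are not at hand. The index \<open>t\<close> of an increasing family runs
  through the field itself and does two jobs: it confines witnesses to the interval from
  \<open>-t\<close> to \<open>t\<close>, which keeps projections of closed sets closed, and it
  bounds side lengths from below by \<open>1 / t\<close>, so that one use of Baire fixes a common
  scale over a dense set of fibers. Where a pigeonhole argument would then fix a common position, an
  infimum of admissible bounds does it (\<open>uniform_selection_1\<close>). A projection to the
  coordinates in \<open>S\<close> has interior iff a box of values for \<open>S\<close> can be
  completed by choices of the other coordinates, so comparing dimensions means reordering
  quantifiers. The delicate order is an interval quantifier outside an existential one: the two may
  have to trade variables (\<open>gen_ex_at\<close>), and only their number survives. One such
  rearrangement, \<open>box_on_fiber_split\<close>, serves continuous images, through the graph, and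
  the upper bound in the fiber formula.\<close>

primrec rename_trm :: "(nat \<Rightarrow> nat) \<Rightarrow> 'f trm \<Rightarrow> 'f trm" where
  "rename_trm r (TVar i) = TVar (r i)"
| "rename_trm r TZero = TZero"
| "rename_trm r TOne = TOne"
| "rename_trm r (TMinus s) = TMinus (rename_trm r s)"
| "rename_trm r (TPlus s t) = TPlus (rename_trm r s) (rename_trm r t)"
| "rename_trm r (TTimes s t) = TTimes (rename_trm r s) (rename_trm r t)"
| "rename_trm r (TFun f ts) = TFun f (map (rename_trm r) ts)"

primrec rename_fml :: "(nat \<Rightarrow> nat) \<Rightarrow> ('f, 'r) fml \<Rightarrow> ('f, 'r) fml" where
  "rename_fml r (FEq s t) = FEq (rename_trm r s) (rename_trm r t)"
| "rename_fml r (FLess s t) = FLess (rename_trm r s) (rename_trm r t)"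
| "rename_fml r (FRel R ts) = FRel R (map (rename_trm r) ts)"
| "rename_fml r (FNot \<phi>) = FNot (rename_fml r \<phi>)"
| "rename_fml r (FAnd \<phi> \<psi>) = FAnd (rename_fml r \<phi>) (rename_fml r \<psi>)"
| "rename_fml r (FEx i \<phi>) = FEx (r i) (rename_fml r \<phi>)"

lemma wf_rename_trm: "wf_trm K t \<Longrightarrow> wf_trm K (rename_trm r t)"
  by (induction t) (auto simp: list_all_iff)

lemma wf_rename_fml: "wf_fml K \<phi> \<Longrightarrow> wf_fml K (rename_fml r \<phi>)"
  by (induction \<phi>) (auto simp: list_all_iff wf_rename_trm)

lemma eval_rename_trm: "eval_trm K e (rename_trm r t) = eval_trm K (e \<circ> r) t"
  by (induction t) (auto simp: comp_def cong: map_cong)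

text \<open>Bound variables are renamed as well. Injectivity prevents capture: updating
  \<open>r i\<close> then changes no variable but \<open>i\<close> as seen through
  \<open>r\<close>.\<close>

lemma sat_rename_fml:
  assumes "inj r"
  shows "sat K e (rename_fml r \<phi>) \<longleftrightarrow> sat K (e \<circ> r) \<phi>"
proof (induction \<phi> arbitrary: e)
  case (FEx i \<phi>)
  have "(e(r i := a)) \<circ> r = (e \<circ> r)(i := a)" for a
    using assms by (auto simp: fun_eq_iff inj_eq)
  thus ?case unfolding rename_fml.simps sat.simps FEx.IH by simp
qed (simp_all add: eval_rename_trm comp_def)

section \<open>Closure of definable predicates under logic and substitution\<close>

locale definable_predicates =
  fixes K :: "('f, 'r, 'a::{linordered_field, linorder_topology}) expansion"
begin

text \<open>Variables below \<open>N\<close> are read from the assignment, all others are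
  parameters. In contrast to \<open>definable\<close>, no ambient power is fixed, so predicates with
  different numbers of free variables combine without bookkeeping.\<close>

definition dpred :: "((nat \<Rightarrow> 'a) \<Rightarrow> bool) \<Rightarrow> bool" where
  "dpred P \<longleftrightarrow>
     (\<exists>\<phi> p N. wf_fml K \<phi> \<and> (\<forall>e. P e \<longleftrightarrow> sat K (override_on p e {..<N}) \<phi>))"

text \<open>
  In a graph, variable \<open>0\<close> holds the value and the arguments are shifted up by one, as they are
  under a quantifier.
\<close>

definition dterm :: "((nat \<Rightarrow> 'a) \<Rightarrow> 'a) \<Rightarrow> bool" where
  "dterm T \<longleftrightarrow> dpred (\<lambda>e. e 0 = T (\<lambda>i. e (Suc i)))"

lemma dpred_finite_support:
  assumes "dpred P"
  obtains N where "\<And>e e'. (\<And>i. i < N \<Longrightarrow> e i = e' i) \<Longrightarrow> P e \<longleftrightarrow> P e'"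
proof -
  from assms obtain \<phi> p N where P: "\<And>e. P e \<longleftrightarrow> sat K (override_on p e {..<N}) \<phi>"
    unfolding dpred_def by blast
  have "P e \<longleftrightarrow> P e'" if "\<And>i. i < N \<Longrightarrow> e i = e' i" for e e'
  proof -
    have "override_on p e {..<N} = override_on p e' {..<N}"
      using that by (auto simp: override_on_def)
    thus ?thesis by (simp add: P)
  qed
  thus thesis by (rule that)
qed

lemma dpred_renameI:
  assumes "wf_fml K \<phi>" "inj r" "\<And>e. P e \<longleftrightarrow> sat K (override_on p e {..<N} \<circ> r) \<phi>"
  shows "dpred P"
  unfolding dpred_def
  using assms wf_rename_fml sat_rename_fml by (intro exI[of _ "rename_fml r \<phi>"]) blast

lemma dpred_not: "dpred P \<Longrightarrow> dpred (\<lambda>e. \<not> P e)"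
  unfolding dpred_def by (metis sat.simps(4) wf_fml.simps(4))

text \<open>The two formulas bring their own parameters, which may collide. Beyond \<open>L\<close>,
  the parameters of the first move to the even offsets and those of the second to the odd
  ones.\<close>

lemma dpred_conj:
  assumes "dpred P" "dpred Q"
  shows "dpred (\<lambda>e. P e \<and> Q e)"
proof -
  from assms obtain \<phi> p N \<psi> q M where
    wf: "wf_fml K \<phi>" "wf_fml K \<psi>" and
    P: "\<And>e. P e \<longleftrightarrow> sat K (override_on p e {..<N}) \<phi>" and
    Q: "\<And>e. Q e \<longleftrightarrow> sat K (override_on q e {..<M}) \<psi>"
    unfolding dpred_def by blast
  define L where "L = max N M"
  define r1 where "r1 = (\<lambda>i. if i < N then i else L + 2 * (i - N))"
  define r2 where "r2 = (\<lambda>i. if i < M then i else L + 2 * (i - M) + 1)"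
  define p' where "p' = (\<lambda>j. if even (j - L) then p (N + (j - L) div 2) else q (M + (j - L) div 2))"
  have inj: "inj r1" "inj r2"
    by (auto simp: inj_def r1_def r2_def L_def split: if_splits)
  have 1: "override_on p' e {..<L} \<circ> r1 = override_on p e {..<N}" for e
    by (auto simp: fun_eq_iff override_on_def r1_def p'_def L_def)
  have 2: "override_on p' e {..<L} \<circ> r2 = override_on q e {..<M}" for e
    by (auto simp: fun_eq_iff override_on_def r2_def p'_def L_def)
  have "P e \<and> Q e \<longleftrightarrow> sat K (override_on p' e {..<L}) (FAnd (rename_fml r1 \<phi>) (rename_fml r2 \<psi>))" for e
    by (simp add: sat_rename_fml inj 1 2 P Q)
  moreover have "wf_fml K (FAnd (rename_fml r1 \<phi>) (rename_fml r2 \<psi>))"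
    using wf by (simp add: wf_rename_fml)
  ultimately show ?thesis unfolding dpred_def by blast
qed

text \<open>The variable \<open>v\<close> may be a parameter of the formula. Moving the parameters
  up by \<open>v + 1\<close> frees it; if \<open>v\<close> was not below \<open>N\<close>, the new
  quantifier is vacuous, as it should be.\<close>

lemma dpred_ex_upd:
  assumes "dpred P"
  shows "dpred (\<lambda>e. \<exists>a. P (e(v := a)))"
proof -
  from assms obtain \<phi> p N where wf: "wf_fml K \<phi>" and
    P: "\<And>e. P e \<longleftrightarrow> sat K (override_on p e {..<N}) \<phi>"
    unfolding dpred_def by blast
  define L where "L = N + v + 1"
  define r where "r = (\<lambda>i. if i < N then i else i + (v + 1))"
  define p' where "p' = (\<lambda>j. p (j - (v + 1)))"
  have inj: "inj r" by (auto simp: inj_def r_def split: if_splits)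
  have "override_on p' e {..<L} \<circ> r = override_on p e {..<N}" for e
    by (auto simp: fun_eq_iff override_on_def r_def p'_def L_def)
  hence P': "P e \<longleftrightarrow> sat K (override_on p' e {..<L}) (rename_fml r \<phi>)" for e
    by (simp add: sat_rename_fml inj P)
  have "(override_on p' e {..<L})(v := a) = override_on p' (e(v := a)) {..<L}" for e a
    by (auto simp: fun_eq_iff override_on_def L_def)
  hence "(\<exists>a. P (e(v := a))) \<longleftrightarrow> sat K (override_on p' e {..<L}) (FEx v (rename_fml r \<phi>))" for e
    by (simp add: P')
  moreover have "wf_fml K (FEx v (rename_fml r \<phi>))"
    using wf by (simp add: wf_rename_fml)
  ultimately show ?thesis unfolding dpred_def by blast
qed

lemma dpred_ex_override:
  assumes "dpred P" "finite S"
  shows "dpred (\<lambda>e. \<exists>z. P (override_on e z S))"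
  using assms(2)
proof (induction S rule: finite_induct)
  case empty
  thus ?case using assms by simp
next
  case (insert v S)
  have "(\<exists>z. P (override_on e z (insert v S))) \<longleftrightarrow> (\<exists>a z. P (override_on (e(v := a)) z S))" for e
  proof -
    have "override_on e z (insert v S) = override_on (e(v := z v)) z S" for z
      by (auto simp: override_on_def fun_eq_iff)
    moreover have "override_on (e(v := a)) z S = override_on e (z(v := a)) (insert v S)" for a z
      using insert by (auto simp: override_on_def fun_eq_iff)
    ultimately show ?thesis by metis
  qed
  thus ?case using dpred_ex_upd[OF insert.IH, of v] by presburger
qed

lemma dpred_atom_eq: "dpred (\<lambda>e. e i = e j)"
  unfolding dpred_def
  by (rule exI[of _ "FEq (TVar i) (TVar j)"], rule exI, rule exI[of _ "i + j + 1"])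
     (simp add: override_on_def)

lemma dpred_const: "dpred (\<lambda>e. c)"
  unfolding dpred_def
  by (cases c) (rule exI[of _ "FEq TZero TZero"], simp,
      rule exI[of _ "FNot (FEq TZero TZero)"], simp)

lemma dpred_all_less:
  "(\<And>i. i < N \<Longrightarrow> dpred (P i)) \<Longrightarrow> dpred (\<lambda>e. \<forall>i<(N::nat). P i e)"
  by (induction N) (simp_all add: dpred_const All_less_Suc dpred_conj)

text \<open>Since \<open>\<rho>\<close> may identify variables, syntactic renaming could capture.
  Instead a block of fresh variables starting at \<open>M\<close>, above all relevant values of
  \<open>\<rho>\<close>, is equated with the targets and quantified away.\<close>

lemma dpred_rename:
  assumes "dpred P"
  shows "dpred (\<lambda>e. P (\<lambda>i. e (\<rho> i)))"
proof -
  from assms obtain \<phi> p N where wf: "wf_fml K \<phi>" and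
    P: "\<And>e. P e \<longleftrightarrow> sat K (override_on p e {..<N}) \<phi>"
    unfolding dpred_def by blast
  define M where "M = Suc (Max (insert 0 (\<rho> ` {..<N})))"
  have M: "\<rho> i < M" if "i < N" for i
    unfolding M_def using that by (intro le_imp_less_Suc Max_ge) auto
  have P_cong: "P e \<longleftrightarrow> P e'" if "\<And>i. i < N \<Longrightarrow> e i = e' i" for e e'
  proof -
    have "override_on p e {..<N} = override_on p e' {..<N}"
      using that by (auto simp: override_on_def)
    thus ?thesis by (simp add: P)
  qed
  have "dpred (\<lambda>e. P (\<lambda>i. e (M + i)))"
  proof (rule dpred_renameI[OF wf, of "(+) M" _ "\<lambda>j. p (j - M)" "M + N"])
    show "P (\<lambda>i. e (M + i)) \<longleftrightarrow>
      sat K (override_on (\<lambda>j. p (j - M)) e {..<M + N} \<circ> (+) M) \<phi>" for e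
      unfolding P by (rule arg_cong[where f = "\<lambda>x. sat K x \<phi>"]) (auto simp: fun_eq_iff override_on_def)
  qed auto
  hence "dpred (\<lambda>e. (\<forall>i<N. e (M + i) = e (\<rho> i)) \<and> P (\<lambda>i. e (M + i)))"
    by (intro dpred_conj dpred_all_less dpred_atom_eq)
  hence "dpred (\<lambda>e. \<exists>z. (\<forall>i<N. override_on e z {M..<M + N} (M + i) = override_on e z {M..<M + N} (\<rho> i))
      \<and> P (\<lambda>i. override_on e z {M..<M + N} (M + i)))"
    by (rule dpred_ex_override) simp
  moreover have "(\<exists>z. (\<forall>i<N. override_on e z {M..<M + N} (M + i) = override_on e z {M..<M + N} (\<rho> i))
      \<and> P (\<lambda>i. override_on e z {M..<M + N} (M + i))) \<longleftrightarrow> P (\<lambda>i. e (\<rho> i))" (is "?L \<longleftrightarrow> ?R") for e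
  proof
    assume ?L
    then obtain z where
      *: "\<forall>i<N. override_on e z {M..<M + N} (M + i) = override_on e z {M..<M + N} (\<rho> i)" and
      "P (\<lambda>i. override_on e z {M..<M + N} (M + i))"
      by blast
    moreover have "\<forall>i<N. z (M + i) = e (\<rho> i)"
    proof (intro allI impI)
      fix i assume "i < N"
      thus "z (M + i) = e (\<rho> i)" using M[of i] *[rule_format, of i] by (simp add: override_on_def)
    qed
    moreover from this have "P (\<lambda>i. override_on e z {M..<M + N} (M + i)) \<longleftrightarrow> ?R"
      by (intro P_cong) (simp add: override_on_def)
    ultimately show ?R by simp
  next
    assume ?R
    moreover have "P (\<lambda>i. override_on e (\<lambda>j. e (\<rho> (j - M))) {M..<M + N} (M + i)) \<longleftrightarrow> ?R"
      by (intro P_cong) (simp add: override_on_def)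
    ultimately show ?L
      by (intro exI[of _ "\<lambda>j. e (\<rho> (j - M))"]) (auto simp: override_on_def dest!: M)
  qed
  ultimately show ?thesis by simp
qed

text \<open>The values of the terms are placed in variables below \<open>N\<close>, the arguments of
  the terms are moved up by \<open>N\<close>, and the values are then quantified
  existentially.\<close>

lemma dpred_subst:
  assumes "dpred P" and T: "\<And>i. dterm (\<lambda>e. T e i)"
  shows "dpred (\<lambda>e. P (T e))"
proof -
  obtain N where N: "\<And>e e'. (\<And>i. i < N \<Longrightarrow> e i = e' i) \<Longrightarrow> P e \<longleftrightarrow> P e'"
    using dpred_finite_support[OF assms(1)] by blast
  have "dpred (\<lambda>e. e i = T (\<lambda>j. e (N + j)) i)" for i
    using dpred_rename[OF T[of i, unfolded dterm_def], of "\<lambda>k. case k of 0 \<Rightarrow> i | Suc j \<Rightarrow> N + j"]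
    by simp
  hence "dpred (\<lambda>e. (\<forall>i<N. e i = T (\<lambda>j. e (N + j)) i) \<and> P e)"
    using assms(1) by (intro dpred_conj dpred_all_less)
  hence "dpred (\<lambda>e. \<exists>z. (\<forall>i<N. override_on e z {..<N} i = T (\<lambda>j. override_on e z {..<N} (N + j)) i)
      \<and> P (override_on e z {..<N}))"
    by (rule dpred_ex_override) simp
  \<comment> \<open>This undoes the shift of the arguments. Below \<open>N\<close> the truncated
    difference is 0, but those positions are overridden by \<open>z\<close>.\<close>
  from dpred_rename[OF this, of "\<lambda>i. i - N"]
  have "dpred (\<lambda>e. \<exists>z. (\<forall>i<N. z i = T e i) \<and> P (override_on (\<lambda>i. e (i - N)) z {..<N}))"
    by (simp add: override_on_def)
  moreover have "(\<exists>z. (\<forall>i<N. z i = T e i) \<and> P (override_on (\<lambda>i. e (i - N)) z {..<N})) \<longleftrightarrow> P (T e)" for e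
  proof -
    have "P (override_on (\<lambda>i. e (i - N)) z {..<N}) \<longleftrightarrow> P (T e)" if "\<forall>i<N. z i = T e i" for z
      using that by (intro N) (simp add: override_on_def)
    thus ?thesis by blast
  qed
  ultimately show ?thesis by simp
qed

lemma dterm_var: "dterm (\<lambda>e. e i)"
  unfolding dterm_def by (rule dpred_atom_eq)

lemma dterm_const: "dterm (\<lambda>e. c)"
  unfolding dterm_def dpred_def
  by (rule exI[of _ "FEq (TVar 0) (TVar 1)"], rule exI[of _ "\<lambda>_. c"], rule exI[of _ 1])
     (simp add: override_on_def)

lemma dterm_shift: "dterm T \<Longrightarrow> dterm (\<lambda>e. T (\<lambda>i. e (Suc i)))"
  unfolding dterm_def
  using dpred_rename[of "\<lambda>e. e 0 = T (\<lambda>i. e (Suc i))" "\<lambda>k. case k of 0 \<Rightarrow> 0 | Suc j \<Rightarrow> Suc (Suc j)"]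
  by simp

lemma dpred_subst3:
  assumes "dpred (\<lambda>e. P (e 0) (e 1) (e 2))" "dterm T" "dterm S" "dterm U"
  shows "dpred (\<lambda>e. P (T e) (S e) (U e))"
proof -
  have "dterm (\<lambda>e. (if i = 0 then T else if i = (1::nat) then S else U) e)" for i
    using assms by simp
  from dpred_subst[OF assms(1), of "\<lambda>e i. (if i = 0 then T else if i = (1::nat) then S else U) e", OF this]
  show ?thesis by simp
qed

lemma dterm_subst2:
  assumes "dpred (\<lambda>e. e 0 = f (e 1) (e 2))" "dterm T" "dterm S"
  shows "dterm (\<lambda>e. f (T e) (S e))"
  unfolding dterm_def
  using dpred_subst3[OF assms(1) dterm_var[of 0] dterm_shift[OF assms(2)] dterm_shift[OF assms(3)]] .

lemma dpred_less_var: "dpred (\<lambda>e. e i < e j)"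
  unfolding dpred_def
  by (rule exI[of _ "FLess (TVar i) (TVar j)"], rule exI, rule exI[of _ "i + j + 1"])
     (simp add: override_on_def)

lemma dpred_less: "dterm T \<Longrightarrow> dterm S \<Longrightarrow> dpred (\<lambda>e. T e < S e)"
  using dpred_subst3[of "\<lambda>a b c. a < b", OF dpred_less_var] by blast

lemma dpred_eq: "dterm T \<Longrightarrow> dterm S \<Longrightarrow> dpred (\<lambda>e. T e = S e)"
  using dpred_subst3[of "\<lambda>a b c. a = b", OF dpred_atom_eq] by blast

lemma dpred_le: "dterm T \<Longrightarrow> dterm S \<Longrightarrow> dpred (\<lambda>e. T e \<le> S e)"
  unfolding not_less[symmetric] by (intro dpred_not dpred_less)

lemma dpred_disj: "dpred P \<Longrightarrow> dpred Q \<Longrightarrow> dpred (\<lambda>e. P e \<or> Q e)"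
  using dpred_not[OF dpred_conj[OF dpred_not[of P] dpred_not[of Q]]] by simp

lemma dpred_imp: "dpred P \<Longrightarrow> dpred Q \<Longrightarrow> dpred (\<lambda>e. P e \<longrightarrow> Q e)"
  unfolding imp_conv_disj by (intro dpred_disj dpred_not)

lemma dterm_add: "dterm T \<Longrightarrow> dterm S \<Longrightarrow> dterm (\<lambda>e. T e + S e)"
proof (rule dterm_subst2[of "(+)"])
  show "dpred (\<lambda>e. e 0 = e 1 + e 2)"
    unfolding dpred_def
    by (rule exI[of _ "FEq (TVar 0) (TPlus (TVar 1) (TVar 2))"], rule exI, rule exI[of _ 3])
       (simp add: override_on_def)
qed

lemma dterm_mult: "dterm T \<Longrightarrow> dterm S \<Longrightarrow> dterm (\<lambda>e. T e * S e)"
proof (rule dterm_subst2[of "(*)"])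
  show "dpred (\<lambda>e. e 0 = e 1 * e 2)"
    unfolding dpred_def
    by (rule exI[of _ "FEq (TVar 0) (TTimes (TVar 1) (TVar 2))"], rule exI, rule exI[of _ 3])
       (simp add: override_on_def)
qed

lemma dterm_diff: "dterm T \<Longrightarrow> dterm S \<Longrightarrow> dterm (\<lambda>e. T e - S e)"
  using dterm_add[OF _ dterm_mult[OF dterm_const[of "-1"]], of T S] by simp

lemma dterm_divide: "dterm T \<Longrightarrow> dterm S \<Longrightarrow> dterm (\<lambda>e. T e / S e)"
proof (rule dterm_subst2[of "(/)"])
  \<comment> \<open>Division is total with value 0 at denominator 0, so the graph needs its own
    clause there.\<close>
  have "dpred (\<lambda>e. (e 2 = 0 \<and> e 0 = 0) \<or> (\<not> e 2 = 0 \<and> e 0 * e 2 = e 1))"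
    by (intro dpred_disj dpred_conj dpred_not dpred_eq dterm_var dterm_const dterm_mult)
  moreover have "((z = 0 \<and> x = 0) \<or> (\<not> z = 0 \<and> x * z = y)) \<longleftrightarrow> x = y / z" for x y z :: 'a
    by (cases "z = 0") (auto simp: field_simps)
  ultimately show "dpred (\<lambda>e. e 0 = e 1 / e 2)" by simp
qed

lemma dterm_abs:
  assumes "dterm T"
  shows "dterm (\<lambda>e. \<bar>T e\<bar>)"
proof (rule dterm_subst2[of "\<lambda>x _. \<bar>x\<bar>", OF _ assms assms])
  have "dpred (\<lambda>e. (0 \<le> e 1 \<and> e 0 = e 1) \<or> (e 1 < 0 \<and> e 0 = 0 - e 1))"
    by (intro dpred_disj dpred_conj dpred_le dpred_less dpred_eq dterm_var dterm_const dterm_diff)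
  moreover have "((0 \<le> y \<and> x = y) \<or> (y < 0 \<and> x = 0 - y)) \<longleftrightarrow> x = \<bar>y\<bar>" for x y :: 'a
    by (auto simp: abs_if)
  ultimately show "dpred (\<lambda>e. e 0 = \<bar>e 1\<bar>)" by simp
qed

text \<open>Indices of variables are numbers outside the formula language, so the case distinction
  on them is made in the premises and not inside a formula.\<close>

lemma dterm_upd:
  "(i = j \<Longrightarrow> dterm T) \<Longrightarrow> (i \<noteq> j \<Longrightarrow> dterm (\<lambda>e. F e i)) \<Longrightarrow> dterm (\<lambda>e. ((F e)(j := T e)) i)"
  by (cases "i = j") auto

lemma dterm_override:
  "(i \<in> S \<Longrightarrow> dterm (\<lambda>e. G e i)) \<Longrightarrow> (i \<notin> S \<Longrightarrow> dterm (\<lambda>e. F e i))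
    \<Longrightarrow> dterm (\<lambda>e. override_on (F e) (G e) S i)"
  by (cases "i \<in> S") auto

lemma dterm_if:
  "(c \<Longrightarrow> dterm T) \<Longrightarrow> (\<not> c \<Longrightarrow> dterm S) \<Longrightarrow> dterm (\<lambda>e. if c then T e else S e)"
  by (cases c) auto

text \<open>The bound value sits at index 0 and the context moves up by one. In this form the rule
  can be used backwards through nested quantifiers without naming variables.\<close>

lemma dpred_ex:
  assumes "dpred (\<lambda>e. P (e 0) (\<lambda>i. e (Suc i)))"
  shows "dpred (\<lambda>e. \<exists>a. P a e)"
  using dpred_rename[OF dpred_ex_upd[OF assms, of 0], of "\<lambda>i. i - 1"] by simp

lemma dpred_all:
  assumes "dpred (\<lambda>e. P (e 0) (\<lambda>i. e (Suc i)))"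
  shows "dpred (\<lambda>e. \<forall>a. P a e)"
  using dpred_not[OF dpred_ex[of "\<lambda>a e. \<not> P a e", OF dpred_not[OF assms]]] by simp

text \<open>A whole assignment is quantified, although a formula binds one variable at a time: the
  point is coded in the even variables, the context in the odd ones, and finite support leaves only
  finitely many even variables to bind.\<close>

lemma dpred_ex_point:
  assumes "dpred (\<lambda>e. P (\<lambda>i. e (2 * i)) (\<lambda>i. e (2 * i + 1)))"
  shows "dpred (\<lambda>e. \<exists>x. P x e)"
proof -
  let ?Q = "\<lambda>e. P (\<lambda>i. e (2 * i)) (\<lambda>i. e (2 * i + 1))"
  obtain N where N: "\<And>e e'. (\<And>i. i < N \<Longrightarrow> e i = e' i) \<Longrightarrow> ?Q e \<longleftrightarrow> ?Q e'"
    using dpred_finite_support[OF assms] by blast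
  let ?E = "{i. i < N \<and> even i}"
  have "dpred (\<lambda>e. \<exists>z. ?Q (override_on e z ?E))"
    by (rule dpred_ex_override[OF assms]) simp
  from dpred_rename[OF this, of "\<lambda>j. j div 2"]
  have "dpred (\<lambda>e. \<exists>z. ?Q (override_on (\<lambda>j. e (j div 2)) z ?E))" .
  moreover have "(\<exists>z. ?Q (override_on (\<lambda>j. e (j div 2)) z ?E)) \<longleftrightarrow> (\<exists>x. P x e)" for e
  proof
    assume "\<exists>z. ?Q (override_on (\<lambda>j. e (j div 2)) z ?E)"
    then obtain z where "?Q (override_on (\<lambda>j. e (j div 2)) z ?E)" by blast
    moreover have "(\<lambda>i. override_on (\<lambda>j. e (j div 2)) z ?E (2 * i + 1)) = e"
      by (auto simp: override_on_def)
    ultimately show "\<exists>x. P x e" by auto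
  next
    assume "\<exists>x. P x e"
    then obtain x where x: "P x e" by blast
    let ?z = "\<lambda>j. if even j then x (j div 2) else e (j div 2)"
    have "?Q ?z" using x by simp
    moreover have "?Q ?z \<longleftrightarrow> ?Q (override_on (\<lambda>j. e (j div 2)) ?z ?E)"
      by (rule N) (auto simp: override_on_def)
    ultimately show "\<exists>z. ?Q (override_on (\<lambda>j. e (j div 2)) z ?E)" by blast
  qed
  ultimately show ?thesis by simp
qed

lemma dpred_all_point:
  assumes "dpred (\<lambda>e. P (\<lambda>i. e (2 * i)) (\<lambda>i. e (2 * i + 1)))"
  shows "dpred (\<lambda>e. \<forall>x. P x e)"
  using dpred_not[OF dpred_ex_point[of "\<lambda>a e. \<not> P a e", OF dpred_not[OF assms]]] by simp

lemma dpred_ball_finite: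
  "finite S \<Longrightarrow> (\<And>i. i \<in> S \<Longrightarrow> dpred (P i)) \<Longrightarrow> dpred (\<lambda>e. \<forall>i\<in>S. P i e)"
  by (induction S rule: finite_induct) (simp_all add: dpred_const dpred_conj)

lemmas dintros = dpred_ex dpred_all dpred_conj dpred_disj dpred_imp dpred_not
  dpred_less dpred_le dpred_eq dterm_var dterm_add dterm_mult dterm_diff dterm_divide dterm_abs
  dterm_upd dterm_override dterm_if dterm_const dpred_const

section \<open>Passage between definable sets and definable predicates\<close>

lemma definable_of_dpred:
  assumes "dpred P" "X = {x \<in> pow_space n. P x}"
  shows "definable K n X"
proof -
  from assms obtain \<phi> p N where wf: "wf_fml K \<phi>" and
    P: "\<And>e. P e \<longleftrightarrow> sat K (override_on p e {..<N}) \<phi>"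
    unfolding dpred_def by blast
  define r where "r = (\<lambda>i. if i < N then i else i + n)"
  \<comment> \<open>If \<open>n < N\<close>, the formula also reads variables from \<open>n\<close>
    up to \<open>N\<close>. An extensional point has the value \<open>undefined\<close> there, and
    the parameters have to supply the same value.\<close>
  define p' where "p' = (\<lambda>j. if j < N then undefined else p (j - n))"
  have inj: "inj r" by (auto simp: inj_def r_def split: if_splits)
  have "P x \<longleftrightarrow> sat K (override_on p' x {..<n}) (rename_fml r \<phi>)" if "x \<in> pow_space n" for x
  proof -
    have "override_on p' x {..<n} \<circ> r = override_on p x {..<N}"
      using that by (auto simp: fun_eq_iff override_on_def r_def p'_def PiE_def extensional_def)
    thus ?thesis by (simp add: P sat_rename_fml inj)
  qed
  thus ?thesis
    unfolding definable_def assms(2) using wf wf_rename_fml by blast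
qed

lemma dpred_of_definable:
  assumes "definable K n X"
  shows "dpred (\<lambda>e. restrict e {..<n} \<in> X)"
proof -
  from assms obtain \<phi> p where *: "wf_fml K \<phi>"
    "X = {x \<in> pow_space n. sat K (override_on p x {..<n}) \<phi>}"
    unfolding definable_def by blast
  have "override_on p (restrict e {..<n}) {..<n} = override_on p e {..<n}" for e
    by (auto simp: override_on_def fun_eq_iff)
  hence "restrict e {..<n} \<in> X \<longleftrightarrow> sat K (override_on p e {..<n}) \<phi>" for e
    by (simp add: *(2))
  thus ?thesis unfolding dpred_def using *(1) by blast
qed

end

section \<open>One-dimensional topology\<close>

text \<open>The absolute value takes the place of a metric; neighbourhoods described by it are
  expressible by formulas.\<close>

lemma open_iff_abs:
  fixes S :: "'a::{linordered_field, linorder_topology} set"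
  shows "open S \<longleftrightarrow> (\<forall>x\<in>S. \<exists>\<delta>>0. \<forall>y. \<bar>y - x\<bar> < \<delta> \<longrightarrow> y \<in> S)" (is "_ \<longleftrightarrow> ?R")
proof
  assume S: "open S"
  show ?R
  proof
    fix x assume x: "x \<in> S"
    obtain b where b: "b > x" "{x..<b} \<subseteq> S" using open_right[OF S x, of "x + 1"] by auto
    obtain a where a: "a < x" "{a<..x} \<subseteq> S" using open_left[OF S x, of "x - 1"] by auto
    show "\<exists>\<delta>>0. \<forall>y. \<bar>y - x\<bar> < \<delta> \<longrightarrow> y \<in> S"
    proof (intro exI[of _ "min (b - x) (x - a)"] conjI allI impI)
      fix y assume "\<bar>y - x\<bar> < min (b - x) (x - a)"
      hence "y < b" "a < y" by (auto simp: abs_less_iff)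
      thus "y \<in> S" using a b by (cases "y \<le> x") auto
    qed (use a(1) b(1) in simp)
  qed
next
  assume R: ?R
  have "\<exists>T. open T \<and> x \<in> T \<and> T \<subseteq> S" if x: "x \<in> S" for x
  proof -
    obtain \<delta> where "\<delta> > 0" "\<forall>y. \<bar>y - x\<bar> < \<delta> \<longrightarrow> y \<in> S" using R x by blast
    thus ?thesis
      by (intro exI[of _ "{x - \<delta><..<x + \<delta>}"]) (auto simp: abs_less_iff algebra_simps)
  qed
  thus "open S" by (subst open_subopen) blast
qed

section \<open>Density in an interval and limit points on the line\<close>

definition dense_between :: "('a::linorder \<Rightarrow> bool) \<Rightarrow> 'a \<Rightarrow> 'a \<Rightarrow> bool" where
  "dense_between X c d \<longleftrightarrow> (\<forall>a b. c \<le> a \<and> a < b \<and> b \<le> d \<longrightarrow> (\<exists>x. a < x \<and> x < b \<and> X x))"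

lemma dense_betweenD:
  "dense_between X c d \<Longrightarrow> c \<le> a \<Longrightarrow> a < b \<Longrightarrow> b \<le> d \<Longrightarrow> \<exists>x. a < x \<and> x < b \<and> X x"
  unfolding dense_between_def by blast

lemma dense_between_mono:
  assumes "dense_between X c d" "c \<le> c'" "d' \<le> d" and "\<And>x. c' < x \<Longrightarrow> x < d' \<Longrightarrow> X x \<Longrightarrow> Y x"
  shows "dense_between Y c' d'"
  unfolding dense_between_def
proof (intro allI impI, elim conjE)
  fix a b assume ab: "c' \<le> a" "a < b" "b \<le> d'"
  hence "c \<le> a" "b \<le> d" using assms(2,3) by auto
  then obtain x where "a < x" "x < b" "X x" using dense_betweenD[OF assms(1)] ab(2) by blast
  thus "\<exists>x. a < x \<and> x < b \<and> Y x" using ab assms(4)[of x] by auto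
qed

lemma dense_between_all:
  fixes X :: "'a::dense_linorder \<Rightarrow> bool"
  assumes "\<And>x. c < x \<Longrightarrow> x < d \<Longrightarrow> X x"
  shows "dense_between X c d"
  unfolding dense_between_def
proof (intro allI impI, elim conjE)
  fix a b assume ab: "c \<le> a" "a < b" "b \<le> d"
  then obtain x where "a < x" "x < b" using dense by blast
  thus "\<exists>x. a < x \<and> x < b \<and> X x" using assms[of x] ab by auto
qed

lemma not_dense_betweenE:
  assumes "\<not> dense_between X c d"
  obtains a b where "c \<le> a" "a < b" "b \<le> d" "\<And>x. a < x \<Longrightarrow> x < b \<Longrightarrow> \<not> X x"
  using assms unfolding dense_between_def by blast

text \<open>Membership in the topological closure, written so that it is visibly definable when
  \<open>X\<close> is.\<close>

definition limit_of :: "('a::linordered_field \<Rightarrow> bool) \<Rightarrow> 'a \<Rightarrow> bool" where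
  "limit_of X x \<longleftrightarrow> (\<forall>\<epsilon>>0. \<exists>y. X y \<and> \<bar>y - x\<bar> < \<epsilon>)"

lemma limit_of_idem:
  fixes X :: "'a::linordered_field \<Rightarrow> bool"
  assumes "limit_of (limit_of X) x" shows "limit_of X x"
  unfolding limit_of_def
proof (intro allI impI)
  fix \<epsilon> :: 'a assume "\<epsilon> > 0"
  then obtain y where y: "limit_of X y" "\<bar>y - x\<bar> < \<epsilon> / 2"
    using assms unfolding limit_of_def[of "limit_of X"] by (meson half_gt_zero)
  then obtain z where "X z" "\<bar>z - y\<bar> < \<epsilon> / 2"
    using \<open>\<epsilon> > 0\<close> unfolding limit_of_def by (meson half_gt_zero)
  thus "\<exists>y. X y \<and> \<bar>y - x\<bar> < \<epsilon>"
    using y(2) by (intro exI[of _ z]) (auto simp: abs_if field_simps split: if_splits)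
qed

lemma limit_of_bounds:
  assumes "limit_of X x"
  shows "(\<And>y. X y \<Longrightarrow> b \<le> y) \<Longrightarrow> b \<le> x" and "(\<And>y. X y \<Longrightarrow> y \<le> b) \<Longrightarrow> x \<le> b"
proof -
  show "b \<le> x" if b: "\<And>y. X y \<Longrightarrow> b \<le> y"
  proof (rule ccontr)
    assume "\<not> b \<le> x"
    hence "b - x > 0" by simp
    then obtain y where "X y" "\<bar>y - x\<bar> < b - x" using assms unfolding limit_of_def by blast
    thus False using b[of y] by (simp add: abs_less_iff)
  qed
  show "x \<le> b" if b: "\<And>y. X y \<Longrightarrow> y \<le> b"
  proof (rule ccontr)
    assume "\<not> x \<le> b"
    hence "x - b > 0" by simp
    then obtain y where "X y" "\<bar>y - x\<bar> < x - b" using assms unfolding limit_of_def by blast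
    thus False using b[of y] by (simp add: abs_less_iff)
  qed
qed

section \<open>Suprema, infima and extreme points of closed sets\<close>

locale restrained_expansion = definable_predicates K
  for K :: "('f, 'r, 'a::{linordered_field, linorder_topology}) expansion" +
  assumes restrained: "restrained K"
begin

lemma dpred_subst2:
  assumes "dpred (\<lambda>e. R (e 0) (e 1))" "dterm T" "dterm S"
  shows "dpred (\<lambda>e. R (T e) (S e))"
  using dpred_subst3[of "\<lambda>a b c. R a b", OF assms(1,2,3,3)] .

lemma dpred_subst1:
  assumes "dpred (\<lambda>e. R (e 0))" "dterm T"
  shows "dpred (\<lambda>e. R (T e))"
  using dpred_subst3[of "\<lambda>a b c. R a", OF assms(1,2,2,2)] .

text \<open>Definable completeness yields a least upper bound in the extended line; the element
  \<open>x0\<close> and the bound \<open>b\<close> exclude the two infinite values.\<close>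

lemma definable_sup:
  assumes X: "dpred (\<lambda>e. X (e 0))" and "X x0" and ub: "\<And>x. X x \<Longrightarrow> x \<le> b"
  shows "\<exists>s. (\<forall>x. X x \<longrightarrow> x \<le> s) \<and> (\<forall>c. (\<forall>x. X x \<longrightarrow> x \<le> c) \<longrightarrow> s \<le> c)"
proof -
  have eq: "singleton_point ` Collect X = {x \<in> pow_space 1. X (x 0)}"
  proof (intro equalityI subsetI)
    fix x assume "x \<in> {x \<in> pow_space 1. X (x 0)}"
    moreover from this have "x = singleton_point (x 0)"
      unfolding singleton_point_def by (intro extensionalityI[of _ "{..<1}"]) (auto simp: PiE_def)
    ultimately show "x \<in> singleton_point ` Collect X" by auto
  next
    fix x assume "x \<in> singleton_point ` Collect X"
    then obtain a where "X a" "x = singleton_point a" by blast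
    thus "x \<in> {x \<in> pow_space 1. X (x 0)}" by (simp add: singleton_point_def)
  qed
  have "definable K 1 (singleton_point ` Collect X)"
    by (rule definable_of_dpred[OF X eq])
  then obtain s where s: "isLub UNIV (Fin ` Collect X) s"
    using restrained unfolding restrained_def definably_complete_def by blast
  have ge: "Fin x \<le> s" if "X x" for x
    using s that by (auto simp: isLub_def leastP_def isUb_def setle_def)
  have least: "s \<le> Fin c" if "\<And>x. X x \<Longrightarrow> x \<le> c" for c
    using s that by (auto simp: isLub_def leastP_def isUb_def setle_def setge_def)
  obtain r where r: "s = Fin r"
    using ge[OF \<open>X x0\<close>] least[of b] ub by (cases s) auto
  show ?thesis
    by (rule exI[of _ r]) (use ge least r in auto)
qed

text \<open>Reflection turns infima into suprema. The reflected point is written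
  \<open>0 - x\<close> to match the term rule for differences.\<close>

lemma definable_inf:
  assumes X: "dpred (\<lambda>e. X (e 0))" and "X x0" and lb: "\<And>x. X x \<Longrightarrow> b \<le> x"
  shows "\<exists>s. (\<forall>x. X x \<longrightarrow> s \<le> x) \<and> (\<forall>c. (\<forall>x. X x \<longrightarrow> c \<le> x) \<longrightarrow> c \<le> s)"
proof -
  have D: "dpred (\<lambda>e. X (0 - e 0))" by (intro dpred_subst1[OF X] dintros)
  have x0: "X (0 - (- x0))" using \<open>X x0\<close> by simp
  have ub: "x \<le> - b" if "X (0 - x)" for x using lb[OF that] by simp
  obtain s where s: "\<And>x. X (0 - x) \<Longrightarrow> x \<le> s" "\<forall>c. (\<forall>x. X (0 - x) \<longrightarrow> x \<le> c) \<longrightarrow> s \<le> c"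
    using definable_sup[of "\<lambda>x. X (0 - x)", OF D x0 ub] by blast
  show ?thesis
  proof (intro exI[of _ "- s"] conjI allI impI)
    show "- s \<le> x" if "X x" for x using s(1)[of "- x"] that by (simp add: minus_le_iff)
    show "c \<le> - s" if c: "\<forall>x. X x \<longrightarrow> c \<le> x" for c
    proof -
      have "\<forall>x. X (0 - x) \<longrightarrow> x \<le> - c" using c by force
      hence "s \<le> - c" using s(2) by blast
      thus ?thesis by simp
    qed
  qed
qed

lemma closed_has_max:
  assumes X: "dpred (\<lambda>e. X (e 0))" and "X x0" and ub: "\<And>x. X x \<Longrightarrow> x \<le> b"
    and cl: "\<And>x. limit_of X x \<Longrightarrow> X x"
  obtains s where "X s" "\<And>x. X x \<Longrightarrow> x \<le> s"
proof -
  obtain s where s: "\<And>x. X x \<Longrightarrow> x \<le> s" "\<forall>c. (\<forall>x. X x \<longrightarrow> x \<le> c) \<longrightarrow> s \<le> c"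
    using definable_sup[OF X \<open>X x0\<close> ub] by blast
  have "limit_of X s"
    unfolding limit_of_def
  proof (intro allI impI)
    fix \<epsilon> :: 'a assume "\<epsilon> > 0"
    hence "\<not> s \<le> s - \<epsilon>" by simp
    then obtain x where "X x" "\<not> x \<le> s - \<epsilon>" using s(2) by blast
    thus "\<exists>y. X y \<and> \<bar>y - s\<bar> < \<epsilon>"
      using s(1)[of x] by (intro exI[of _ x]) auto
  qed
  thus thesis using cl s that by blast
qed

lemma closed_has_min:
  assumes X: "dpred (\<lambda>e. X (e 0))" and "X x0" and lb: "\<And>x. X x \<Longrightarrow> b \<le> x"
    and cl: "\<And>x. limit_of X x \<Longrightarrow> X x"
  obtains s where "X s" "\<And>x. X x \<Longrightarrow> s \<le> x"
proof -
  have D: "dpred (\<lambda>e. X (0 - e 0))" by (intro dpred_subst1[OF X] dintros)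
  have lim: "limit_of X (0 - x)" if lim': "limit_of (\<lambda>x. X (0 - x)) x" for x
    unfolding limit_of_def
  proof (intro allI impI)
    fix \<epsilon> :: 'a assume "\<epsilon> > 0"
    then obtain y where "X (0 - y)" "\<bar>y - x\<bar> < \<epsilon>" using lim' unfolding limit_of_def by blast
    thus "\<exists>y. X y \<and> \<bar>y - (0 - x)\<bar> < \<epsilon>" by (intro exI[of _ "0 - y"]) (auto simp: abs_less_iff)
  qed
  have cl': "X (0 - x)" if "limit_of (\<lambda>x. X (0 - x)) x" for x by (rule cl[OF lim[OF that]])
  have x0: "X (0 - (- x0))" using \<open>X x0\<close> by simp
  have ub: "x \<le> - b" if "X (0 - x)" for x using lb[OF that] by simp
  obtain s where s: "X (0 - s)" "\<And>x. X (0 - x) \<Longrightarrow> x \<le> s"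
    using closed_has_max[of "\<lambda>x. X (0 - x)", OF D x0 ub cl'] by blast
  show thesis
  proof (rule that[of "- s"])
    show "- s \<le> x" if "X x" for x using s(2)[of "- x"] that by (simp add: minus_le_iff)
  qed (use s in simp)
qed

section \<open>Restrainedness and the Baire theorem on the line\<close>

lemma not_nowhere_dense:
  assumes "dense_between (\<lambda>y. y \<in> S) c d" "c < (d::'a)"
  shows "\<not> nowhere_dense S"
proof
  assume nd: "nowhere_dense S"
  have "{c<..<d} \<subseteq> closure S"
  proof
    fix y assume y: "y \<in> {c<..<d}"
    show "y \<in> closure S"
    proof (rule ccontr)
      assume "y \<notin> closure S"
      moreover have "open (- closure S)" by auto
      ultimately obtain \<delta> where \<delta>: "\<delta> > 0" "\<And>z. \<bar>z - y\<bar> < \<delta> \<Longrightarrow> z \<in> - closure S"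
        using open_iff_abs[of "- closure S"] by blast
      have "y < min d (y + \<delta>)" using y \<delta> by simp
      then obtain z where "y < z" "z < min d (y + \<delta>)" "z \<in> S"
        using dense_betweenD[OF assms(1), of y "min d (y + \<delta>)"] y by auto
      thus False using \<delta>(2)[of z] closure_subset[of S] by auto
    qed
  qed
  hence "{c<..<d} \<subseteq> interior (closure S)" by (intro interior_maximal) auto
  moreover have "(c + d) / 2 \<in> {c<..<d}" using assms(2) by (simp add: field_simps)
  ultimately show False using nd unfolding nowhere_dense_def by auto
qed

text \<open>Restrainedness is used only through the first coordinate map on a discrete subset of the
  plane. The second coordinate is free to separate points whose first coordinates
  accumulate.\<close>

lemma restrainedD:
  assumes P: "dpred P" and sep: "\<And>x. P x \<Longrightarrow> \<exists>\<epsilon>>0. \<forall>x'. P x' \<and> \<bar>x' 0 - x 0\<bar> < \<epsilon> \<and> \<bar>x' 1 - x 1\<bar> < \<epsilon> \<longrightarrow>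
      x' 0 = x 0 \<and> x' 1 = x 1"
    and "dense_between (\<lambda>y. \<exists>x. x \<in> pow_space 2 \<and> P x \<and> x 0 = y) c d" "c < d"
  shows False
proof -
  define D where "D = {x \<in> pow_space 2. P x}"
  have two: "{..<2} = {0, 1::nat}" by auto
  have D: "definable K 2 D" by (rule definable_of_dpred[OF P D_def])
  have disc: "subtopology (pow_top 2) D = discrete_topology D"
  proof -
    have "openin (subtopology (pow_top 2) D) {x}" if x: "x \<in> D" for x
    proof -
      obtain \<epsilon> where \<epsilon>: "\<epsilon> > 0" "\<And>x'. P x' \<Longrightarrow> \<bar>x' 0 - x 0\<bar> < \<epsilon> \<Longrightarrow> \<bar>x' 1 - x 1\<bar> < \<epsilon> \<Longrightarrow>
          x' 0 = x 0 \<and> x' 1 = x 1"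
        using sep[of x] x unfolding D_def by blast
      let ?W = "\<Pi>\<^sub>E i\<in>{..<2}. {x i - \<epsilon><..<x i + \<epsilon>}"
      have "openin (pow_top 2) ?W" unfolding openin_PiE_gen by auto
      moreover have "{x} = D \<inter> ?W"
      proof (intro equalityI subsetI)
        fix y assume "y \<in> {x}"
        hence "y = x" by simp
        moreover have "x \<in> ?W" using x \<epsilon>(1) by (simp add: D_def PiE_iff)
        ultimately show "y \<in> D \<inter> ?W" using x by simp
      next
        fix y assume y: "y \<in> D \<inter> ?W"
        hence *: "y i \<in> {x i - \<epsilon><..<x i + \<epsilon>}" if "i < 2" for i
          using that by (auto simp: PiE_iff)
        have "\<bar>y 0 - x 0\<bar> < \<epsilon>" "\<bar>y 1 - x 1\<bar> < \<epsilon>"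
          using *[of 0] *[of 1] by (auto simp: abs_less_iff algebra_simps)
        hence "y 0 = x 0 \<and> y 1 = x 1" using y \<epsilon>(2)[of y] by (auto simp: D_def)
        hence "y = x" using x y
          by (intro extensionalityI[of _ "{..<2}"]) (auto simp: D_def PiE_def two less_2_cases_iff)
        thus "y \<in> {x}" by simp
      qed
      ultimately show ?thesis unfolding openin_subtopology by blast
    qed
    moreover have "D \<subseteq> topspace (pow_top 2)" by (auto simp: D_def)
    ultimately show ?thesis by (metis discrete_topology_unique topspace_subtopology_subset)
  qed
  have map: "definable_map K 2 1 D (\<lambda>x. singleton_point (x 0))"
  proof -
    have "(\<lambda>x. concat_point 2 1 x (singleton_point (x 0))) ` D =
        {z \<in> pow_space (2 + 1). P (restrict z {..<2}) \<and> z 2 = z 0}" (is "?L = ?R")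
    proof (intro equalityI subsetI)
      fix z assume "z \<in> ?L"
      then obtain x where x: "x \<in> D" "z = concat_point 2 1 x (singleton_point (x 0))" by blast
      have "restrict z {..<2} = x" using x(1)
        by (intro extensionalityI[of _ "{..<2}"]) (auto simp: x(2) D_def PiE_def concat_point_def)
      thus "z \<in> ?R" using x by (auto simp: D_def concat_point_def singleton_point_def)
    next
      fix z assume z: "z \<in> ?R"
      hence "restrict z {..<2} \<in> D" by (auto simp: D_def)
      moreover have "z = concat_point 2 1 (restrict z {..<2}) (singleton_point (restrict z {..<2} 0))"
        using z by (intro extensionalityI[of _ "{..<2 + 1}"])
          (auto simp: PiE_def concat_point_def singleton_point_def less_Suc_eq numeral_3_eq_3)
      ultimately show "z \<in> ?L" by blast
    qed
    moreover have "dpred (\<lambda>z. P (restrict z {..<2}) \<and> z 2 = z 0)"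
      unfolding restrict_def by (intro dpred_subst[OF P] dintros)
    ultimately show ?thesis
      unfolding definable_map_def
      by (auto simp: D_def singleton_point_def intro: definable_of_dpred)
  qed
  have "nowhere_dense ((\<lambda>x. x 0) ` D)"
    using restrained[unfolded restrained_def, THEN conjunct2, rule_format, of 2 D "\<lambda>x. x 0"]
      D disc map by blast
  moreover have "dense_between (\<lambda>y. y \<in> (\<lambda>x. x 0) ` D) c d"
    by (rule dense_between_mono[OF assms(3)]) (auto simp: D_def)
  ultimately show False using not_nowhere_dense \<open>c < d\<close> by blast
qed

text \<open>This is the existence of a point with minimal entry time in a closed interval, although
  entry times themselves need not be attained. The least element of \<open>X t\<close> in the
  interval moves left as \<open>t\<close> grows; the supremum of these least elements is a limit of
  points of every member that meets the interval, hence belongs to it.\<close>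

lemma nested_min:
  assumes X: "dpred (\<lambda>e. X (e 0) (e 1))"
    and mono: "\<And>s t y. X s y \<Longrightarrow> s \<le> t \<Longrightarrow> X t y"
    and cl: "\<And>t y. limit_of (X t) y \<Longrightarrow> X t y"
    and "a \<le> b"
  shows "\<exists>y. a \<le> y \<and> y \<le> b \<and> (\<forall>y' t. a \<le> y' \<and> y' \<le> b \<and> X t y' \<longrightarrow> X t y)"
proof (cases "\<exists>t y. a \<le> y \<and> y \<le> b \<and> X t y")
  case False
  thus ?thesis using \<open>a \<le> b\<close> by (intro exI[of _ a]) auto
next
  case True
  then obtain t0 y0 where t0: "a \<le> y0" "y0 \<le> b" "X t0 y0" by blast
  define M where "M = (\<lambda>t m. a \<le> m \<and> m \<le> b \<and> X t m \<and> (\<forall>y. a \<le> y \<and> y < m \<longrightarrow> \<not> X t y))"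
  have ex: "\<exists>m. M t m" if y: "a \<le> y" "y \<le> b" "X t y" for t y
  proof -
    have "dpred (\<lambda>e. a \<le> e 0 \<and> e 0 \<le> b \<and> X t (e 0))"
      by (intro dpred_subst2[OF X] dintros)
    moreover have "a \<le> x \<and> x \<le> b \<and> X t x" if lim: "limit_of (\<lambda>x. a \<le> x \<and> x \<le> b \<and> X t x) x" for x
    proof (intro conjI cl)
      show "limit_of (X t) x" using lim unfolding limit_of_def by blast
      show "a \<le> x" "x \<le> b" using limit_of_bounds[OF lim] by blast+
    qed
    ultimately obtain m where "a \<le> m \<and> m \<le> b \<and> X t m" "\<And>x. a \<le> x \<and> x \<le> b \<and> X t x \<Longrightarrow> m \<le> x"
      using closed_has_min[of "\<lambda>x. a \<le> x \<and> x \<le> b \<and> X t x" y a] y by blast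
    thus ?thesis unfolding M_def by (intro exI[of _ m]) force
  qed
  have "dpred (\<lambda>e. \<exists>t. M t (e 0))"
    unfolding M_def by (intro dpred_subst2[OF X] dintros)
  moreover obtain m0 where m0: "M t0 m0" using ex[OF t0] by blast
  moreover have "m \<le> b" if "\<exists>t. M t m" for m using that unfolding M_def by blast
  ultimately have "\<exists>s. (\<forall>m. (\<exists>t. M t m) \<longrightarrow> m \<le> s) \<and> (\<forall>c. (\<forall>m. (\<exists>t. M t m) \<longrightarrow> m \<le> c) \<longrightarrow> s \<le> c)"
    using definable_sup[of "\<lambda>m. \<exists>t. M t m" m0 b] by blast
  then obtain s where s': "\<forall>m. (\<exists>t. M t m) \<longrightarrow> m \<le> s" "\<forall>c. (\<forall>m. (\<exists>t. M t m) \<longrightarrow> m \<le> c) \<longrightarrow> s \<le> c"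
    by blast
  have s: "m \<le> s" if "M t m" for m t using s'(1) that by auto
  have s2: "s \<le> c" if "\<And>m t. M t m \<Longrightarrow> m \<le> c" for c using s'(2) that by auto
  show ?thesis
  proof (intro exI[of _ s] conjI allI impI; (elim conjE)?)
    show "s \<le> b" by (rule s2) (simp add: M_def)
    show "a \<le> s" using m0 s[OF m0] unfolding M_def by auto
    fix y' t assume "a \<le> y'" "y' \<le> b" "X t y'"
    then obtain m where m: "M t m" using ex by blast
    show "X t s"
    proof (rule cl, unfold limit_of_def, intro allI impI)
      fix \<epsilon> :: 'a assume "\<epsilon> > 0"
      hence "\<not> s \<le> s - \<epsilon>" by simp
      then obtain m' t' where m': "M t' m'" "s - \<epsilon> < m'" using s2[of "s - \<epsilon>"] by (meson not_le)
      show "\<exists>y. X t y \<and> \<bar>y - s\<bar> < \<epsilon>"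
      proof (cases "t' \<le> t")
        case True
        thus ?thesis using m' s[OF m'(1)] mono[of t' m' t] unfolding M_def
          by (intro exI[of _ m']) auto
      next
        case False
        hence "X t' m" using m mono[of t m t'] unfolding M_def by auto
        hence "m' \<le> m" using m m'(1) unfolding M_def by (meson not_le)
        thus ?thesis using m m' s[OF m] unfolding M_def
          by (intro exI[of _ m]) auto
      qed
    qed
  qed
qed

text \<open>
  The first time at which a point enters the family behaves like a lower semicontinuous function.
  If no member had interior, its local minima that are strict to the right would be dense; paired
  with the radius of their neighbourhood of minimality they form a discrete set.
\<close>

lemma baire_closed:
  assumes X: "dpred (\<lambda>e. X (e 0) (e 1))"
    and mono: "\<And>s t y. X s y \<Longrightarrow> s \<le> t \<Longrightarrow> X t y"
    and cl: "\<And>t y. limit_of (X t) y \<Longrightarrow> X t y"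
    and "c < d" and dense: "dense_between (\<lambda>y. \<exists>t. X t y) c d"
  shows "\<exists>t a b. c \<le> a \<and> a < b \<and> b \<le> d \<and> (\<forall>y. a < y \<and> y < b \<longrightarrow> X t y)"
proof (rule ccontr)
  assume "\<not> ?thesis"
  hence noint: "\<exists>y. a < y \<and> y < b \<and> \<not> X t y" if "c \<le> a" "a < b" "b \<le> d" for t a b
    using that by blast
  \<comment> \<open>Entry times are compared without naming them: a point enters no later than
    another if it lies in every member containing the other. So \<open>y\<close> is a minimum of the
    entry time within radius \<epsilon>, strict to its right.\<close>
  define good where "good = (\<lambda>y \<epsilon>. \<epsilon> > 0 \<and> c \<le> y - \<epsilon> \<and> y + \<epsilon> \<le> d \<and>
     (\<forall>y'. y - \<epsilon> < y' \<and> y' < y + \<epsilon> \<longrightarrow> (\<forall>t. X t y' \<longrightarrow> X t y)) \<and>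
     (\<forall>y'. y < y' \<and> y' < y + \<epsilon> \<longrightarrow> (\<exists>t. X t y \<and> \<not> X t y')))"
  have good_dpred: "dpred (\<lambda>e. good (T e) (S e))" if "dterm T" "dterm S" for T S
  proof (rule dpred_subst2[OF _ that])
    show "dpred (\<lambda>e. good (e 0) (e 1))"
      unfolding good_def by (intro dpred_subst2[OF X] dintros)
  qed
  \<comment> \<open>Taking the largest admissible radius makes the second coordinate a function of
    the first, so one point of the set lies over each such minimum.\<close>
  define P where "P = (\<lambda>x::nat \<Rightarrow> 'a. good (x 0) (x 1) \<and> (\<forall>\<epsilon>. good (x 0) \<epsilon> \<longrightarrow> \<epsilon> \<le> x 1))"
  have good_sup: "\<exists>s. good y s \<and> (\<forall>\<epsilon>. good y \<epsilon> \<longrightarrow> \<epsilon> \<le> s)" if good: "good y \<epsilon>0" for y \<epsilon>0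
  proof -
    have "dpred (\<lambda>e. good y (e 0))" by (intro good_dpred dintros)
    moreover have "\<epsilon> \<le> y - c" if "good y \<epsilon>" for \<epsilon> using that by (simp add: good_def algebra_simps)
    ultimately obtain s where s: "\<And>\<epsilon>. good y \<epsilon> \<Longrightarrow> \<epsilon> \<le> s" "\<forall>b. (\<forall>\<epsilon>. good y \<epsilon> \<longrightarrow> \<epsilon> \<le> b) \<longrightarrow> s \<le> b"
      using definable_sup[of "good y" \<epsilon>0 "y - c"] good by blast
    have approx: "\<exists>\<epsilon>. good y \<epsilon> \<and> b < \<epsilon>" if "b < s" for b using s(2) that by (meson not_le)
    have "good y s"
      unfolding good_def
    proof (intro conjI allI impI)
      show "s > 0" using s(1)[OF good] good unfolding good_def by simp
      have "s \<le> y - c" by (rule s(2)[rule_format]) (simp add: good_def algebra_simps)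
      thus "c \<le> y - s" by (simp add: algebra_simps)
      have "s \<le> d - y" by (rule s(2)[rule_format]) (simp add: good_def algebra_simps)
      thus "y + s \<le> d" by (simp add: algebra_simps)
      show "X t y" if "y - s < y' \<and> y' < y + s" "X t y'" for y' t
      proof -
        have "\<bar>y' - y\<bar> < s" using that(1) by (auto simp: abs_less_iff algebra_simps)
        then obtain \<epsilon> where e: "good y \<epsilon>" "\<bar>y' - y\<bar> < \<epsilon>" using approx by blast
        from e(2) have "y - \<epsilon> < y' \<and> y' < y + \<epsilon>" by (auto simp: abs_less_iff algebra_simps)
        thus ?thesis using e(1) \<open>X t y'\<close> unfolding good_def by blast
      qed
      show "\<exists>t. X t y \<and> \<not> X t y'" if "y < y' \<and> y' < y + s" for y'
      proof -
        have "y' - y < s" using that by (simp add: algebra_simps)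
        then obtain \<epsilon> where e: "good y \<epsilon>" "y' - y < \<epsilon>" using approx by blast
        hence "y < y' \<and> y' < y + \<epsilon>" using that by (simp add: algebra_simps)
        thus ?thesis using e(1) unfolding good_def by blast
      qed
    qed
    thus ?thesis using s(1) by blast
  qed
  \<comment> \<open>Of two minima within both radii, the left one enters strictly earlier by its own
    strictness, while minimality of the right one forbids any earlier entry nearby.\<close>
  have separated: False if "good y \<epsilon>" "good y' \<epsilon>'" "y < y'" "y' - y < \<epsilon>" "y' - y < \<epsilon>'" for y y' \<epsilon> \<epsilon>'
  proof -
    have "\<exists>t. X t y \<and> \<not> X t y'"
      using that(1,3,4) unfolding good_def by (simp add: algebra_simps)
    moreover have "\<forall>t. X t y \<longrightarrow> X t y'"
    proof -
      have "y' - \<epsilon>' < y \<and> y < y' + \<epsilon>'" using that(2,3,5) by (auto simp: algebra_simps good_def)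
      thus ?thesis using that(2) unfolding good_def by blast
    qed
    ultimately show False by blast
  qed
  show False
  proof (rule restrainedD[of P c d])
    show "dpred P" unfolding P_def by (intro good_dpred dintros)
    show "c < d" by fact
    fix x assume "P x"
    hence x: "good (x 0) (x 1)" "\<And>\<epsilon>. good (x 0) \<epsilon> \<Longrightarrow> \<epsilon> \<le> x 1" unfolding P_def by auto
    have x1: "x 1 > 0" using x(1) unfolding good_def by blast
    show "\<exists>\<epsilon>>0. \<forall>x'. P x' \<and> \<bar>x' 0 - x 0\<bar> < \<epsilon> \<and> \<bar>x' 1 - x 1\<bar> < \<epsilon> \<longrightarrow> x' 0 = x 0 \<and> x' 1 = x 1"
    proof (intro exI[of _ "x 1 / 2"] conjI allI impI)
      show "0 < x 1 / 2" using x1 by simp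
      fix x' assume *: "P x' \<and> \<bar>x' 0 - x 0\<bar> < x 1 / 2 \<and> \<bar>x' 1 - x 1\<bar> < x 1 / 2"
      hence x': "good (x' 0) (x' 1)" "\<And>\<epsilon>. good (x' 0) \<epsilon> \<Longrightarrow> \<epsilon> \<le> x' 1" unfolding P_def by auto
      \<comment> \<open>A radius within \<open>x 1 / 2\<close> of \<open>x 1\<close> still exceeds
        \<open>x 1 / 2\<close>, so each point lies within the radius of the other and
        \<open>separated\<close> applies in either order.\<close>
      have half: "x 1 / 2 < x' 1"
      proof -
        from * have "- (x' 1 - x 1) < x 1 / 2" using abs_less_iff by blast
        hence "x 1 < x 1 / 2 + x' 1" by (simp add: algebra_simps)
        moreover have "x 1 = x 1 / 2 + x 1 / 2" by simp
        ultimately show ?thesis by (metis add_less_cancel_left)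
      qed
      have half': "x 1 / 2 < x 1" using x1 by (simp add: field_simps)
      show eq: "x' 0 = x 0"
      proof (rule linorder_cases[of "x' 0" "x 0"])
        assume "x' 0 < x 0"
        thus ?thesis using separated[OF x'(1) x(1)] * half half' by auto
      next
        assume "x' 0 > x 0"
        thus ?thesis using separated[OF x(1) x'(1)] * half half' by auto
      qed
      show "x' 1 = x 1" using x x' eq by (metis order.antisym)
    qed
  next
    show "dense_between (\<lambda>y. \<exists>x. x \<in> pow_space 2 \<and> P x \<and> x 0 = y) c d"
      unfolding dense_between_def
    proof (intro allI impI, elim conjE)
      fix a b assume ab: "c \<le> a" "a < b" "b \<le> d"
      then obtain y0 t where y0: "a < y0" "y0 < b" "X t y0"
        using dense_betweenD[OF dense] by blast
      \<comment> \<open>Endpoints outside \<open>X t\<close> keep every minimum over the closed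
        interval in its interior, since a minimum enters no later than \<open>y0\<close> and so lies
        in \<open>X t\<close>.\<close>
      obtain a' where a': "a < a'" "a' < y0" "\<not> X t a'" using noint[of a y0] y0 ab by auto
      obtain b' where b': "y0 < b'" "b' < b" "\<not> X t b'" using noint[of y0 b] y0 ab by auto
      have "\<exists>y. a' \<le> y \<and> y \<le> b' \<and> (\<forall>y' t. a' \<le> y' \<and> y' \<le> b' \<and> X t y' \<longrightarrow> X t y)"
      proof (rule nested_min[where X = X, OF X])
        show "X t y" if "X s y" "s \<le> t" for s t y using that mono by blast
        show "X t y" if "limit_of (X t) y" for t y using that cl by blast
        show "a' \<le> b'" using a' b' by simp
      qed
      then obtain y1 where y1: "a' \<le> y1" "y1 \<le> b'"
        "\<And>y' t. a' \<le> y' \<Longrightarrow> y' \<le> b' \<Longrightarrow> X t y' \<Longrightarrow> X t y1"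
        by blast
      have t: "X t y1" using y1(3)[of y0 t] a' b' y0 by auto
      \<comment> \<open>Among the points entering no later than \<open>y1\<close>, the last one up
        to \<open>b'\<close> is a minimum that is strict to its right.\<close>
      let ?M = "\<lambda>y. y \<le> b' \<and> (\<forall>t. X t y1 \<longrightarrow> X t y)"
      have "dpred (\<lambda>e. ?M (e 0))" by (intro dpred_subst2[OF X] dintros)
      moreover have "?M y" if lim: "limit_of ?M y" for y
      proof (intro conjI allI impI cl)
        show "y \<le> b'" using limit_of_bounds(2)[OF lim] by blast
        show "limit_of (X t) y" if "X t y1" for t
          using lim that unfolding limit_of_def by blast
      qed
      moreover have "?M y1" using y1 by blast
      ultimately obtain y2 where y2: "?M y2" "\<And>y. ?M y \<Longrightarrow> y \<le> y2"
        using closed_has_max[of ?M y1 b'] by blast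
      have "y1 \<le> y2" using y2(2) \<open>?M y1\<close> by blast
      moreover have "y1 \<noteq> a'" using t a' by blast
      ultimately have "a' < y2" using y1 by auto
      have "y2 < b'" using y2(1) t b' by (metis order_le_imp_less_or_eq)
      have "good y2 (min (y2 - a') (b' - y2))" (is "good y2 ?\<epsilon>")
        unfolding good_def
      proof (intro conjI allI impI)
        show "0 < ?\<epsilon>" using \<open>a' < y2\<close> \<open>y2 < b'\<close> by simp
        show "c \<le> y2 - ?\<epsilon>" using ab a' by (simp add: min_def)
        show "y2 + ?\<epsilon> \<le> d" using ab b' by (simp add: min_def)
        show "X t y2" if "y2 - ?\<epsilon> < y' \<and> y' < y2 + ?\<epsilon>" "X t y'" for y' t
        proof -
          have "a' \<le> y'" "y' \<le> b'" using that(1) by (auto simp: min_def split: if_splits)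
          thus ?thesis using y1(3) y2(1) that(2) by blast
        qed
        show "\<exists>t. X t y2 \<and> \<not> X t y'" if "y2 < y' \<and> y' < y2 + ?\<epsilon>" for y'
        proof -
          have "y' \<le> b'" using that by (auto simp: min_def split: if_splits)
          moreover have "\<not> ?M y'" using y2(2)[of y'] that by auto
          ultimately show ?thesis using y2(1) by blast
        qed
      qed
      then obtain s where s: "good y2 s" "\<forall>\<epsilon>. good y2 \<epsilon> \<longrightarrow> \<epsilon> \<le> s" using good_sup by blast
      let ?x = "\<lambda>i\<in>{..<2::nat}. if i = 0 then y2 else s"
      have "?x \<in> pow_space 2" "P ?x" "?x 0 = y2" using s by (auto simp: P_def)
      moreover have "a < y2" "y2 < b" using \<open>a' < y2\<close> \<open>y2 < b'\<close> a' b' by auto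
      ultimately show "\<exists>y. a < y \<and> y < b \<and> (\<exists>x. x \<in> pow_space 2 \<and> P x \<and> x 0 = y)" by blast
    qed
  qed
qed

text \<open>Closing up each member keeps the family definable and increasing, and an interval inside
  the closure of \<open>X t\<close> is one in which \<open>X t\<close> is dense.\<close>

lemma baire:
  assumes X: "dpred (\<lambda>e. X (e 0) (e 1))"
    and mono: "\<And>s t y. X s y \<Longrightarrow> s \<le> t \<Longrightarrow> X t y"
    and "c < d" and dense: "dense_between (\<lambda>y. \<exists>t. X t y) c d"
  shows "\<exists>t a b. c \<le> a \<and> a < b \<and> b \<le> d \<and> dense_between (X t) a b"
proof -
  have "dpred (\<lambda>e. limit_of (X (e 0)) (e 1))"
    unfolding limit_of_def by (intro dpred_subst2[OF X] dintros)
  moreover have "limit_of (X t) y" if "limit_of (X s) y" "s \<le> t" for s t y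
    using that mono unfolding limit_of_def by blast
  moreover have "dense_between (\<lambda>y. \<exists>t. limit_of (X t) y) c d"
  proof (rule dense_between_mono[OF dense])
    fix y assume "\<exists>t. X t y"
    then obtain t where "X t y" ..
    hence "limit_of (X t) y" unfolding limit_of_def by (intro allI impI exI[of _ y]) simp
    thus "\<exists>t. limit_of (X t) y" ..
  qed auto
  ultimately obtain t a b where tab: "c \<le> a" "a < b" "b \<le> d" "\<And>y. a < y \<Longrightarrow> y < b \<Longrightarrow> limit_of (X t) y"
    using baire_closed[of "\<lambda>t. limit_of (X t)" c d] limit_of_idem \<open>c < d\<close> by blast
  have "dense_between (X t) a b"
    unfolding dense_between_def
  proof (intro allI impI, elim conjE)
    fix a' b' assume ab': "a \<le> a'" "a' < b'" "b' \<le> b"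
    define m where "m = (a' + b') / 2"
    have m: "a' < m" "m < b'" using ab' by (auto simp: m_def field_simps)
    hence "limit_of (X t) m" "min (m - a') (b' - m) > 0" using tab(4) ab' by auto
    then obtain y where "X t y" "\<bar>y - m\<bar> < min (m - a') (b' - m)" unfolding limit_of_def by blast
    thus "\<exists>x. a' < x \<and> x < b' \<and> X t x" by (intro exI[of _ y]) (auto simp: abs_less_iff)
  qed
  thus ?thesis using tab(1-3) by blast
qed

end

section \<open>Increasing unions of closed families\<close>

text \<open>
  The neighbourhoods are uniform in all variables. Definable predicates depend on finitely many
  variables, so for them this is closedness in the product topology.
\<close>

definition closed_pred :: "((nat \<Rightarrow> 'a::linordered_field) \<Rightarrow> bool) \<Rightarrow> bool" where
  "closed_pred P \<longleftrightarrow> (\<forall>e. \<not> P e \<longrightarrow> (\<exists>\<delta>>0. \<forall>e'. (\<forall>i. \<bar>e' i - e i\<bar> < \<delta>) \<longrightarrow> \<not> P e'))"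

lemma closed_predE:
  assumes "closed_pred P" "\<not> P e"
  obtains \<delta> where "\<delta> > 0" "\<And>e'. (\<And>i. \<bar>e' i - e i\<bar> < \<delta>) \<Longrightarrow> \<not> P e'"
  using assms unfolding closed_pred_def by metis

lemma closed_pred_conj:
  assumes "closed_pred P" "closed_pred Q"
  shows "closed_pred (\<lambda>e. P e \<and> Q e)"
  unfolding closed_pred_def
proof (intro allI impI)
  fix e assume "\<not> (P e \<and> Q e)"
  hence "(\<not> P e) \<or> (\<not> Q e)" by blast
  thus "\<exists>\<delta>>0. \<forall>e'. (\<forall>i. \<bar>e' i - e i\<bar> < \<delta>) \<longrightarrow> \<not> (P e' \<and> Q e')"
    using assms unfolding closed_pred_def by blast
qed

lemma closed_pred_disj:
  fixes P Q :: "(nat \<Rightarrow> 'a::linordered_field) \<Rightarrow> bool"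
  assumes "closed_pred P" "closed_pred Q"
  shows "closed_pred (\<lambda>e. P e \<or> Q e)"
  unfolding closed_pred_def
proof (intro allI impI)
  fix e assume e: "\<not> (P e \<or> Q e)"
  obtain d1 where d1: "d1 > 0" "\<And>e'. (\<And>i. \<bar>e' i - e i\<bar> < d1) \<Longrightarrow> \<not> P e'"
    using closed_predE[OF assms(1)] e by metis
  obtain d2 where d2: "d2 > 0" "\<And>e'. (\<And>i. \<bar>e' i - e i\<bar> < d2) \<Longrightarrow> \<not> Q e'"
    using closed_predE[OF assms(2)] e by metis
  show "\<exists>\<delta>>0. \<forall>e'. (\<forall>i. \<bar>e' i - e i\<bar> < \<delta>) \<longrightarrow> \<not> (P e' \<or> Q e')"
    by (intro exI[of _ "min d1 d2"]) (use d1 d2 in auto)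
qed

lemma closed_pred_const: "closed_pred (\<lambda>e. c)"
  unfolding closed_pred_def by (cases c) (auto intro: exI[of _ 1])

lemma closed_pred_le: "closed_pred (\<lambda>e. c \<le> e i)" "closed_pred (\<lambda>e. e i \<le> c)"
proof -
  show "closed_pred (\<lambda>e. c \<le> e i)"
    unfolding closed_pred_def
  proof (intro allI impI)
    fix e assume "\<not> c \<le> e i"
    thus "\<exists>\<delta>>0. \<forall>e'. (\<forall>i. \<bar>e' i - e i\<bar> < \<delta>) \<longrightarrow> \<not> c \<le> e' i"
      by (intro exI[of _ "c - e i"]) (auto dest!: spec[of _ i] simp: abs_less_iff)
  qed
  show "closed_pred (\<lambda>e. e i \<le> c)"
    unfolding closed_pred_def
  proof (intro allI impI)
    fix e assume "\<not> e i \<le> c"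
    thus "\<exists>\<delta>>0. \<forall>e'. (\<forall>i. \<bar>e' i - e i\<bar> < \<delta>) \<longrightarrow> \<not> e' i \<le> c"
      by (intro exI[of _ "e i - c"]) (auto dest!: spec[of _ i] simp: abs_less_iff)
  qed
qed

lemma closed_pred_ball_finite:
  "finite S \<Longrightarrow> (\<And>i. i \<in> S \<Longrightarrow> closed_pred (P i)) \<Longrightarrow> closed_pred (\<lambda>e. \<forall>i\<in>S. P i e)"
  by (induction S rule: finite_induct) (simp_all add: closed_pred_const closed_pred_conj)

lemma closed_pred_limit:
  fixes P :: "(nat \<Rightarrow> 'a::linordered_field) \<Rightarrow> bool"
  assumes P: "closed_pred P" and lim: "limit_of (\<lambda>x. P (e(i := x))) x"
  shows "P (e(i := x))"
proof (rule ccontr)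
  assume "\<not> P (e(i := x))"
  then obtain \<delta> where \<delta>: "\<delta> > 0" "\<And>e'. (\<And>j. \<bar>e' j - (e(i := x)) j\<bar> < \<delta>) \<Longrightarrow> \<not> P e'"
    using closed_predE[OF P] by metis
  obtain y where y: "P (e(i := y))" "\<bar>y - x\<bar> < \<delta>" using lim \<delta>(1) unfolding limit_of_def by blast
  have "\<not> P (e(i := y))" by (rule \<delta>(2)) (use y \<delta>(1) in auto)
  thus False using y by blast
qed

section \<open>The two quantifiers and the class of increasing closed unions\<close>

definition gen :: "nat \<Rightarrow> ((nat \<Rightarrow> 'a::linorder) \<Rightarrow> bool) \<Rightarrow> (nat \<Rightarrow> 'a) \<Rightarrow> bool" where
  "gen i P e \<longleftrightarrow> (\<exists>a b. a < b \<and> (\<forall>x. a < x \<and> x < b \<longrightarrow> P (e(i := x))))"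

definition ex_at :: "nat \<Rightarrow> ((nat \<Rightarrow> 'a) \<Rightarrow> bool) \<Rightarrow> (nat \<Rightarrow> 'a) \<Rightarrow> bool" where
  "ex_at i P e \<longleftrightarrow> (\<exists>x. P (e(i := x)))"

definition box_on :: "nat set \<Rightarrow> ((nat \<Rightarrow> 'a::linorder) \<Rightarrow> bool) \<Rightarrow> (nat \<Rightarrow> 'a) \<Rightarrow> bool" where
  "box_on S P e \<longleftrightarrow> (\<exists>a b. (\<forall>i\<in>S. a i < b i) \<and>
     (\<forall>z. (\<forall>i\<in>S. a i < z i \<and> z i < b i) \<longrightarrow> P (override_on e z S)))"

context definable_predicates
begin

text \<open>Positivity of the index is demanded so that \<open>1 / t\<close> is a genuine length,
  decreasing in \<open>t\<close>; lengths of this form are used as the scale of intervals and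
  cubes.\<close>

definition ds_family :: "('a \<Rightarrow> (nat \<Rightarrow> 'a) \<Rightarrow> bool) \<Rightarrow> bool" where
  "ds_family Q \<longleftrightarrow> dpred (\<lambda>e. Q (e 0) (\<lambda>i. e (Suc i))) \<and> (\<forall>t. closed_pred (Q t)) \<and>
     (\<forall>s t e. Q s e \<longrightarrow> s \<le> t \<longrightarrow> Q t e) \<and> (\<forall>t e. Q t e \<longrightarrow> 0 < t)"

text \<open>The counterpart of the property \<open>D_Sigma\<close> for predicates: an exhaustion by
  closed members replaces the projection of one closed set.\<close>

definition ds :: "((nat \<Rightarrow> 'a) \<Rightarrow> bool) \<Rightarrow> bool" where
  "ds P \<longleftrightarrow> (\<exists>Q. ds_family Q \<and> (\<forall>e. P e \<longleftrightarrow> (\<exists>t. Q t e)))"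

lemma dpred_subst_Suc:
  assumes "dpred (\<lambda>e. Q (e 0) (\<lambda>i. e (Suc i)))" "dterm T" "\<And>i. dterm (\<lambda>e. U e i)"
  shows "dpred (\<lambda>e. Q (T e) (U e))"
proof -
  have "dterm (\<lambda>e. case k of 0 \<Rightarrow> T e | Suc i \<Rightarrow> U e i)" for k
    using assms by (cases k) simp_all
  from dpred_subst[OF assms(1), of "\<lambda>e k. case k of 0 \<Rightarrow> T e | Suc i \<Rightarrow> U e i", OF this]
  show ?thesis by simp
qed

lemma dpred_family:
  assumes "ds_family Q" "dterm T" "\<And>i. dterm (\<lambda>e. U e i)"
  shows "dpred (\<lambda>e. Q (T e) (U e))"
  by (rule dpred_subst_Suc[of Q, OF conjunct1[OF assms(1)[unfolded ds_family_def]] assms(2,3)])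

lemma ds_familyD:
  assumes "ds_family Q"
  shows "closed_pred (Q t)" "Q s e \<Longrightarrow> s \<le> t \<Longrightarrow> Q t e" "Q t e \<Longrightarrow> 0 < t"
  using assms unfolding ds_family_def by blast+

lemma dpred_ds: "ds P \<Longrightarrow> dpred P"
proof -
  assume "ds P"
  then obtain Q where Q: "ds_family Q" "P = (\<lambda>e. \<exists>t. Q t e)"
    unfolding ds_def fun_eq_iff by blast
  show ?thesis unfolding Q(2) by (intro dpred_family[OF Q(1)] dintros)
qed

lemma ds_closed:
  assumes "dpred P" "closed_pred P"
  shows "ds P"
  unfolding ds_def ds_family_def
proof (intro exI[of _ "\<lambda>t e. 0 < t \<and> P e"] conjI allI impI)
  show "dpred (\<lambda>e. 0 < e 0 \<and> P (\<lambda>i. e (Suc i)))" by (intro dintros dpred_subst[OF assms(1)])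
  show "closed_pred (\<lambda>e. 0 < t \<and> P e)" for t :: 'a
    by (intro closed_pred_conj closed_pred_const assms)
  show "P e \<longleftrightarrow> (\<exists>t::'a. 0 < t \<and> P e)" for e using zero_less_one[where 'a = 'a] by blast
qed auto

lemma ds_conj:
  assumes "ds P" "ds P'"
  shows "ds (\<lambda>e. P e \<and> P' e)"
proof -
  obtain Q Q' where Q: "ds_family Q" "\<And>e. P e \<longleftrightarrow> (\<exists>t. Q t e)" "ds_family Q'" "\<And>e. P' e \<longleftrightarrow> (\<exists>t. Q' t e)"
    using assms unfolding ds_def by blast
  have "ds_family (\<lambda>t e. Q t e \<and> Q' t e)"
    unfolding ds_family_def
    by (intro conjI allI closed_pred_conj dpred_conj dpred_family[OF Q(1)] dpred_family[OF Q(3)] dterm_var)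
       (use ds_familyD[OF Q(1)] ds_familyD[OF Q(3)] in blast)+
  moreover have "(\<exists>t. Q t e \<and> Q' t e) \<longleftrightarrow> P e \<and> P' e" for e
    using ds_familyD(2)[OF Q(1)] ds_familyD(2)[OF Q(3)] unfolding Q by (meson linear)
  ultimately show ?thesis unfolding ds_def by blast
qed

lemma ds_disj:
  assumes "ds P" "ds P'"
  shows "ds (\<lambda>e. P e \<or> P' e)"
proof -
  obtain Q Q' where Q: "ds_family Q" "\<And>e. P e \<longleftrightarrow> (\<exists>t. Q t e)" "ds_family Q'" "\<And>e. P' e \<longleftrightarrow> (\<exists>t. Q' t e)"
    using assms unfolding ds_def by blast
  have "ds_family (\<lambda>t e. Q t e \<or> Q' t e)"
    unfolding ds_family_def
    by (intro conjI allI closed_pred_disj dpred_disj dpred_family[OF Q(1)] dpred_family[OF Q(3)] dterm_var)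
       (use ds_familyD[OF Q(1)] ds_familyD[OF Q(3)] in blast)+
  moreover have "(\<exists>t. Q t e \<or> Q' t e) \<longleftrightarrow> P e \<or> P' e" for e
    unfolding Q by blast
  ultimately show ?thesis unfolding ds_def by blast
qed

end

section \<open>Stability of the class under both quantifiers\<close>

context restrained_expansion
begin

text \<open>The tube lemma for a closed bounded interval. Compactness is replaced by definable
  completeness: the supremum of those \<open>c\<close> for which one radius \<delta> works on the
  whole interval from \<alpha> to \<open>c\<close> can be pushed on until it reaches
  \<beta>.\<close>

lemma closed_ex_between:
  assumes P: "dpred P" and cl: "closed_pred P"
  shows "closed_pred (\<lambda>e. \<exists>a. \<alpha> \<le> a \<and> a \<le> \<beta> \<and> P (e(i := a)))"
  unfolding closed_pred_def
proof (intro allI impI)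
  fix e assume e: "\<not> (\<exists>a. \<alpha> \<le> a \<and> a \<le> \<beta> \<and> P (e(i := a)))"
  obtain N where N: "\<And>e e'. (\<And>i. i < N \<Longrightarrow> e i = e' i) \<Longrightarrow> P e \<longleftrightarrow> P e'"
    using dpred_finite_support[OF P] by blast
  \<comment> \<open>Perturbations are measured only in the finitely many coordinates on which
    \<open>P\<close> depends, which keeps this condition definable.\<close>
  define bad where "bad = (\<lambda>\<delta> a. \<exists>e'. (\<forall>j\<in>{..<N}. \<bar>e' j - e j\<bar> < \<delta>) \<and> P (e'(i := a)))"
  have bad_mono: "bad \<delta> a \<Longrightarrow> \<delta> \<le> \<delta>' \<Longrightarrow> bad \<delta>' a" for \<delta> \<delta>' a
    unfolding bad_def by (meson less_le_trans)
  have locally_good: "\<exists>\<eta>>0. \<forall>a'. \<bar>a' - a\<bar> < \<eta> \<longrightarrow> \<not> bad \<eta> a'" if a: "\<alpha> \<le> a" "a \<le> \<beta>" for a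
  proof -
    have "\<not> P (e(i := a))" using a e by blast
    then obtain \<eta> where \<eta>: "\<eta> > 0" "\<And>e'. (\<And>j. \<bar>e' j - (e(i := a)) j\<bar> < \<eta>) \<Longrightarrow> \<not> P e'"
      using closed_predE[OF cl] by metis
    have "\<not> bad \<eta> a'" if a': "\<bar>a' - a\<bar> < \<eta>" for a'
    proof
      assume "bad \<eta> a'"
      then obtain e' where e': "\<forall>j\<in>{..<N}. \<bar>e' j - e j\<bar> < \<eta>" "P (e'(i := a'))" unfolding bad_def by blast
      \<comment> \<open>Closedness gives a neighbourhood uniform in all coordinates, whereas
        \<open>e'\<close> is controlled only below \<open>N\<close>; the coordinates above are reset
        to those of \<open>e\<close>.\<close>
      let ?e = "\<lambda>j. if j < N then e' j else e j"
      have "\<not> P (?e(i := a'))" by (rule \<eta>(2)) (use a' e' \<eta>(1) in auto)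
      moreover have "P (?e(i := a')) \<longleftrightarrow> P (e'(i := a'))" by (rule N) auto
      ultimately show False using e'(2) by blast
    qed
    thus ?thesis using \<eta>(1) by blast
  qed
  show "\<exists>\<delta>>0. \<forall>e'. (\<forall>i. \<bar>e' i - e i\<bar> < \<delta>) \<longrightarrow> \<not> (\<exists>a. \<alpha> \<le> a \<and> a \<le> \<beta> \<and> P (e'(i := a)))"
  proof (cases "\<alpha> \<le> \<beta>")
    case False
    thus ?thesis by (intro exI[of _ 1]) auto
  next
    case True
    define X where "X = (\<lambda>c. \<alpha> \<le> c \<and> c \<le> \<beta> \<and> (\<exists>\<delta>. \<delta> > 0 \<and> (\<forall>a. \<alpha> \<le> a \<and> a \<le> c \<longrightarrow> \<not> bad \<delta> a)))"
    have "dpred (\<lambda>e. X (e 0))"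
      unfolding X_def bad_def
      by (intro dpred_subst[OF P] dpred_ex_point dpred_ball_finite finite_lessThan dintros)
    moreover have "X \<alpha>"
      unfolding X_def using True locally_good[of \<alpha>]
      by (metis abs_zero antisym cancel_comm_monoid_add_class.diff_cancel order.refl)
    ultimately obtain s where s: "\<forall>c. X c \<longrightarrow> c \<le> s" "\<forall>b. (\<forall>c. X c \<longrightarrow> c \<le> b) \<longrightarrow> s \<le> b"
      using definable_sup[of X \<alpha> \<beta>] unfolding X_def by blast
    have s_range: "\<alpha> \<le> s" "s \<le> \<beta>" using s \<open>X \<alpha>\<close> unfolding X_def by auto
    then obtain \<eta> where \<eta>: "\<eta> > 0" "\<And>a. \<bar>a - s\<bar> < \<eta> \<Longrightarrow> \<not> bad \<eta> a" using locally_good by blast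
    have "\<not> s \<le> s - \<eta>" using \<eta>(1) by simp
    then obtain c where c: "X c" "s - \<eta> < c" using s(2) by (meson not_le)
    then obtain \<delta> where \<delta>: "\<delta> > 0" "\<And>a. \<alpha> \<le> a \<Longrightarrow> a \<le> c \<Longrightarrow> \<not> bad \<delta> a" unfolding X_def by blast
    have good: "\<not> bad (min \<delta> \<eta>) a" if "\<alpha> \<le> a" "a < s + \<eta>" for a
    proof (cases "a \<le> c")
      case True
      thus ?thesis using \<delta>(2) that bad_mono[of "min \<delta> \<eta>" a \<delta>] by auto
    next
      case False
      hence "\<bar>a - s\<bar> < \<eta>" using that c(2) by (simp add: abs_less_iff algebra_simps)
      thus ?thesis using \<eta>(2) bad_mono[of "min \<delta> \<eta>" a \<eta>] by auto
    qed
    have "s = \<beta>"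
    proof (rule ccontr)
      assume "s \<noteq> \<beta>"
      hence "s < min \<beta> (s + \<eta> / 2)" using s_range \<eta>(1) by auto
      moreover have "X (min \<beta> (s + \<eta> / 2))"
        unfolding X_def
      proof (intro conjI exI[of _ "min \<delta> \<eta>"] allI impI)
        fix a assume a: "\<alpha> \<le> a \<and> a \<le> min \<beta> (s + \<eta> / 2)"
        moreover have "s + \<eta> / 2 < s + \<eta>" using \<eta>(1) by simp
        ultimately have "a < s + \<eta>" by auto
        thus "\<not> bad (min \<delta> \<eta>) a" using a good by blast
      qed (use \<delta> \<eta> s_range in auto)
      ultimately show False using s(1) by (meson not_le)
    qed
    hence ok: "\<not> bad (min \<delta> \<eta>) a" if "\<alpha> \<le> a" "a \<le> \<beta>" for a using good that \<eta>(1) by auto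
    show ?thesis
    proof (intro exI[of _ "min \<delta> \<eta>"] conjI allI impI notI)
      show "0 < min \<delta> \<eta>" using \<delta> \<eta> by simp
      fix e' assume "\<forall>i. \<bar>e' i - e i\<bar> < min \<delta> \<eta>" "\<exists>a. \<alpha> \<le> a \<and> a \<le> \<beta> \<and> P (e'(i := a))"
      then obtain a where a: "\<alpha> \<le> a" "a \<le> \<beta>" "bad (min \<delta> \<eta>) a" unfolding bad_def by blast
      thus False using ok by blast
    qed
  qed
qed

text \<open>Bounding the witness by the index keeps each member closed, by the tube lemma, and the
  family increasing; in the union over \<open>t\<close> the bound disappears.\<close>

lemma ds_family_ex_at:
  assumes Q: "ds_family Q"
  shows "ds_family (\<lambda>t e. \<exists>a. 0 - t \<le> a \<and> a \<le> t \<and> Q t (e(i := a)))" (is "ds_family ?Q")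
    and "ex_at i (\<lambda>e. \<exists>t. Q t e) e \<longleftrightarrow> (\<exists>t a. 0 - t \<le> a \<and> a \<le> t \<and> Q t (e(i := a)))"
proof -
  note QD = ds_familyD[OF Q]
  show "ds_family ?Q"
    unfolding ds_family_def
  proof (intro conjI allI impI)
    show "dpred (\<lambda>e. ?Q (e 0) (\<lambda>i. e (Suc i)))" by (intro dpred_family[OF Q] dintros)
    show "closed_pred (?Q t)" for t
      by (intro closed_ex_between QD dpred_family[OF Q] dintros)
    show "?Q t e" if st: "?Q s e" "s \<le> t" for s t e
    proof -
      obtain a where a: "0 - s \<le> a" "a \<le> s" "Q s (e(i := a))" using st by blast
      have "0 - t \<le> a" using a(1) st(2) by simp
      moreover have "a \<le> t" using a(2) st(2) by simp
      ultimately show ?thesis using QD(2)[OF a(3) st(2)] by blast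
    qed
    show "0 < t" if "?Q t e" for t e using that QD(3) by blast
  qed
  show "ex_at i (\<lambda>e. \<exists>t. Q t e) e \<longleftrightarrow> (\<exists>t. ?Q t e)"
  proof
    assume "ex_at i (\<lambda>e. \<exists>t. Q t e) e"
    then obtain a t where a: "Q t (e(i := a))" unfolding ex_at_def by blast
    have "0 - max t \<bar>a\<bar> \<le> a" "a \<le> max t \<bar>a\<bar>" by (auto simp: max_def abs_if)
    thus "\<exists>t. ?Q t e" using QD(2)[OF a, of "max t \<bar>a\<bar>"] by auto
  next
    assume "\<exists>t. ?Q t e"
    thus "ex_at i (\<lambda>e. \<exists>t. Q t e) e" unfolding ex_at_def by blast
  qed
qed

lemma ds_ex_at:
  assumes "ds P"
  shows "ds (ex_at i P)"
proof -
  obtain Q where Q: "ds_family Q" "P = (\<lambda>e. \<exists>t. Q t e)"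
    using assms unfolding ds_def fun_eq_iff by blast
  show ?thesis unfolding ds_def Q(2) using ds_family_ex_at[OF Q(1)] by blast
qed

text \<open>The Baire theorem along one variable, the others being fixed by \<open>e\<close>: a
  closed union that is dense in an interval has a single member containing a subinterval.\<close>

lemma family_dense:
  assumes Q: "ds_family Q" and "c < d" and "dense_between (\<lambda>x. \<exists>t. Q t (e(i := x))) c d"
  shows "\<exists>t a b. c \<le> a \<and> a < b \<and> b \<le> d \<and> (\<forall>x. a < x \<and> x < b \<longrightarrow> Q t (e(i := x)))"
proof (rule baire_closed[of "\<lambda>t x. Q t (e(i := x))"])
  show "dpred (\<lambda>e'. Q (e' 0) (e(i := e' 1)))" by (intro dpred_family[OF Q] dintros)
  show "Q t (e(i := x))" if "Q s (e(i := x))" "s \<le> t" for s t x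
    using that ds_familyD[OF Q] by blast
  show "Q t (e(i := x))" if "limit_of (\<lambda>x. Q t (e(i := x))) x" for t x
    by (rule closed_pred_limit[OF ds_familyD(1)[OF Q] that])
qed fact+

lemma ds_dense_interval:
  assumes "ds P" "c < d" "dense_between (\<lambda>x. P (e(i := x))) c d"
  shows "\<exists>a b. c \<le> a \<and> a < b \<and> b \<le> d \<and> (\<forall>x. a < x \<and> x < b \<longrightarrow> P (e(i := x)))"
proof -
  obtain Q where Q: "ds_family Q" "\<And>e. P e \<longleftrightarrow> (\<exists>t. Q t e)" using assms(1) unfolding ds_def by blast
  from family_dense[OF Q(1) assms(2) assms(3)[unfolded Q(2)]] show ?thesis
    unfolding Q(2) by blast
qed

lemma ds_dense_gen:
  assumes "ds P" "c < d" "dense_between (\<lambda>x. P (e(i := x))) c d"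
  shows "gen i P e"
  using ds_dense_interval[OF assms] unfolding gen_def by blast

text \<open>Either \<open>P\<close> is dense in the given interval and by Baire contains a
  subinterval, or it misses a subinterval, which then belongs entirely to \<open>P'\<close>.\<close>

lemma gen_disj:
  assumes "ds P" "gen i (\<lambda>e. P e \<or> P' e) e"
  shows "gen i P e \<or> gen i P' e"
proof -
  obtain a b where ab: "a < b" "\<And>x. a < x \<Longrightarrow> x < b \<Longrightarrow> P (e(i := x)) \<or> P' (e(i := x))"
    using assms(2) unfolding gen_def by blast
  show ?thesis
  proof (cases "dense_between (\<lambda>x. P (e(i := x))) a b")
    case True
    thus ?thesis using ds_dense_gen[OF assms(1) ab(1)] by blast
  next
    case False
    then obtain c d where cd: "a \<le> c" "c < d" "d \<le> b" "\<And>x. c < x \<Longrightarrow> x < d \<Longrightarrow> \<not> P (e(i := x))"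
      by (rule not_dense_betweenE) blast
    hence "P' (e(i := x))" if "c < x" "x < d" for x
      using that ab(2)[of x] by auto
    thus ?thesis using cd(2) unfolding gen_def by blast
  qed
qed

text \<open>By Baire an interval inside the union may be shrunk into one member. Intervals are then
  measured by the index: left end of absolute value at most \<open>t\<close>, length
  \<open>1 / t\<close>. The left end is quantified over a closed bounded range, so members stay
  closed.\<close>

lemma ds_gen:
  assumes "ds P"
  shows "ds (gen i P)"
proof -
  obtain Q where Q: "ds_family Q" "\<And>e. P e \<longleftrightarrow> (\<exists>t. Q t e)" using assms unfolding ds_def by blast
  note QD = ds_familyD[OF Q(1)]
  define R where "R = (\<lambda>t e. \<forall>x. e i \<le> x \<and> x \<le> e i + 1 / t \<longrightarrow> Q t (e(i := x)))"
  have "dpred (\<lambda>e. R (e 0) (\<lambda>i. e (Suc i)))"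
    unfolding R_def by (intro dpred_family[OF Q(1)] dintros)
  note R_dpred = dpred_subst_Suc[of R, OF this]
  have R_closed: "closed_pred (R t)" for t
    unfolding closed_pred_def
  proof (intro allI impI)
    fix e assume "\<not> R t e"
    then obtain x where x: "e i \<le> x" "x \<le> e i + 1 / t" "\<not> Q t (e(i := x))" unfolding R_def by blast
    obtain \<delta> where \<delta>: "\<delta> > 0" "\<And>e'. (\<And>j. \<bar>e' j - (e(i := x)) j\<bar> < \<delta>) \<Longrightarrow> \<not> Q t e'"
      using closed_predE[OF QD(1) x(3)] by metis
    show "\<exists>\<delta>>0. \<forall>e'. (\<forall>i. \<bar>e' i - e i\<bar> < \<delta>) \<longrightarrow> \<not> R t e'"
    proof (intro exI[of _ \<delta>] conjI allI impI)
      fix e' assume e': "\<forall>i. \<bar>e' i - e i\<bar> < \<delta>"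
      \<comment> \<open>The point violating \<open>Q t\<close> is translated along with the left
        end, so that it stays inside the moved interval.\<close>
      let ?x = "x + (e' i - e i)"
      have "\<not> Q t (e'(i := ?x))" by (rule \<delta>(2)) (use e' in auto)
      moreover have "e' i \<le> ?x" "?x \<le> e' i + 1 / t" using x by (auto simp: algebra_simps)
      ultimately show "\<not> R t e'" unfolding R_def by blast
    qed fact
  qed
  let ?Q = "\<lambda>t e. 0 < t \<and> (\<exists>c. 0 - t \<le> c \<and> c \<le> t \<and> R t (e(i := c)))"
  have "ds_family ?Q"
    unfolding ds_family_def
  proof (intro conjI allI impI)
    show "dpred (\<lambda>e. ?Q (e 0) (\<lambda>i. e (Suc i)))" by (intro R_dpred dintros)
    show "closed_pred (?Q t)" for t
      by (intro closed_pred_conj closed_pred_const closed_ex_between R_closed R_dpred dintros)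
    show "0 < t" if "?Q s e" "s \<le> t" for s t e using that by auto
    show "\<exists>c. 0 - t \<le> c \<and> c \<le> t \<and> R t (e(i := c))" if st: "?Q s e" "s \<le> t" for s t e
    proof -
      obtain c where c: "0 < s" "0 - s \<le> c" "c \<le> s" "R s (e(i := c))" using st by blast
      have "1 / t \<le> 1 / s" using c(1) st(2) by (simp add: frac_le)
      hence "R t (e(i := c))"
        using c(4) QD(2)[OF _ st(2)] unfolding R_def by (auto intro: order_trans add_left_mono)
      moreover have "0 - t \<le> c" "c \<le> t" using c st(2) by auto
      ultimately show ?thesis by blast
    qed
  qed auto
  moreover have "gen i P e \<longleftrightarrow> (\<exists>t. ?Q t e)" for e
  proof
    assume "gen i P e"
    then obtain c d where cd: "c < d" "\<And>x. c < x \<Longrightarrow> x < d \<Longrightarrow> \<exists>t. Q t (e(i := x))"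
      unfolding gen_def Q(2) by blast
    have "dense_between (\<lambda>x. \<exists>t. Q t (e(i := x))) c d" by (rule dense_between_all[OF cd(2)])
    then obtain t a b where tab: "a < b" "\<And>x. a < x \<Longrightarrow> x < b \<Longrightarrow> Q t (e(i := x))"
      using family_dense[OF Q(1) cd(1)] by blast
    \<comment> \<open>Starting one third into the interval and using length at most one third of it
      leaves room on both sides.\<close>
    define m where "m = (2 * a + b) / 3"
    have m: "a < m" "m < b" and m_eq: "m + (b - a) / 3 = (a + 2 * b) / 3" "(a + 2 * b) / 3 < b"
      using tab(1) by (auto simp: m_def field_simps)
    define T where "T = max (max t \<bar>m\<bar>) (3 / (b - a))"
    have "3 / (b - a) > 0" using tab(1) by simp
    hence T: "T > 0" "\<bar>m\<bar> \<le> T" "t \<le> T" unfolding T_def by (auto simp: less_max_iff_disj le_max_iff_disj)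
    have "1 / T \<le> 1 / (3 / (b - a))" by (rule frac_le) (use tab(1) in \<open>auto simp: T_def\<close>)
    hence "m + 1 / T \<le> m + (b - a) / 3" by simp
    hence mT: "m + 1 / T < b" unfolding m_eq(1) using m_eq(2) by (rule le_less_trans)
    have "Q T (e(i := x))" if "m \<le> x" "x \<le> m + 1 / T" for x
    proof (rule QD(2)[OF tab(2) T(3)])
      show "a < x" using m(1) that(1) by simp
      show "x < b" using mT that(2) by simp
    qed
    hence "R T (e(i := m))" unfolding R_def by simp
    moreover have "0 - T \<le> m" "m \<le> T" using T(2) by (auto simp: abs_le_iff)
    ultimately show "\<exists>t. ?Q t e" using T(1) by blast
  next
    assume "\<exists>t. ?Q t e"
    then obtain t c where t: "0 < t" "R t (e(i := c))" by blast
    hence "c < c + 1 / t" "\<And>x. c < x \<Longrightarrow> x < c + 1 / t \<Longrightarrow> P (e(i := x))"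
      unfolding Q(2) R_def by (simp, metis fun_upd_same fun_upd_upd less_imp_le)
    thus "gen i P e" unfolding gen_def by blast
  qed
  ultimately show ?thesis unfolding ds_def by blast
qed

end

section \<open>Boxes\<close>

definition dense_box ::
  "nat set \<Rightarrow> ((nat \<Rightarrow> 'a::linorder) \<Rightarrow> bool) \<Rightarrow> (nat \<Rightarrow> 'a) \<Rightarrow> (nat \<Rightarrow> 'a) \<Rightarrow> (nat \<Rightarrow> 'a) \<Rightarrow> bool" where
  "dense_box S P e a b \<longleftrightarrow> (\<forall>a' b'. (\<forall>i\<in>S. a i \<le> a' i \<and> a' i < b' i \<and> b' i \<le> b i) \<longrightarrow>
     (\<exists>z. (\<forall>i\<in>S. a' i < z i \<and> z i < b' i) \<and> P (override_on e z S)))"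

lemma override_on_absorb:
  "i \<notin> S \<Longrightarrow> override_on ((override_on e u S)(i := y)) z S = override_on (e(i := y)) z S"
  by (auto simp: override_on_def fun_eq_iff)

lemma finite_upper_bound:
  fixes f :: "nat \<Rightarrow> 'a::linordered_field"
  assumes "finite S"
  obtains t where "t > c" "\<And>i. i \<in> S \<Longrightarrow> f i \<le> t"
proof (rule that[of "Max (insert (c + 1) (f ` S))"])
  have "c + 1 \<le> Max (insert (c + 1) (f ` S))" using assms by (intro Max_ge) auto
  thus "c < Max (insert (c + 1) (f ` S))" by (rule less_le_trans[rotated]) simp
  show "f i \<le> Max (insert (c + 1) (f ` S))" if "i \<in> S" for i using assms that by (intro Max_ge) auto
qed

lemma box_on_mono:
  assumes "box_on S P e" "\<And>e. P e \<Longrightarrow> P' e"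
  shows "box_on S P' e"
  using assms unfolding box_on_def by blast

lemma box_on_insert_gen:
  assumes "box_on (insert i S) P e" "i \<notin> S"
  shows "gen i (box_on S P) e"
proof -
  obtain a b where ab: "\<forall>j\<in>insert i S. a j < b j"
    "\<And>z. \<forall>j\<in>insert i S. a j < z j \<and> z j < b j \<Longrightarrow> P (override_on e z (insert i S))"
    using assms(1) unfolding box_on_def by blast
  have "box_on S P (e(i := x))" if x: "a i < x" "x < b i" for x
    unfolding box_on_def
  proof (rule exI[of _ a], rule exI[of _ b], intro conjI allI impI)
    fix z assume z: "\<forall>j\<in>S. a j < z j \<and> z j < b j"
    have "P (override_on e (z(i := x)) (insert i S))"
      by (rule ab(2)) (use z x in auto)
    moreover have "override_on e (z(i := x)) (insert i S) = override_on (e(i := x)) z S"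
      using assms(2) by (auto simp: override_on_def fun_eq_iff)
    ultimately show "P (override_on (e(i := x)) z S)" by simp
  qed (use ab in auto)
  thus ?thesis using ab(1) unfolding gen_def by blast
qed

section \<open>Uniform boxes over a dense set of fibers\<close>

context restrained_expansion
begin

text \<open>Let \<open>w\<close> be the infimum of those \<open>s\<close> for which witnesses up to
  \<open>s\<close> exist densely. Just above \<open>w\<close> they are dense; at
  \<open>w - \<delta>\<close> they are not, hence some subinterval has no witnesses that low, and
  there densely many lie within \<delta> of \<open>w\<close>. A pigeonhole argument over pieces of
  length \<delta> could need infinitely many pieces.\<close>

lemma uniform_selection_1:
  assumes R: "dpred (\<lambda>e. R (e 0) (e 1))" and "\<delta> > 0" "c < d"
    and dn: "dense_between (\<lambda>y. \<exists>u. \<alpha> \<le> u \<and> u \<le> \<beta> \<and> R u y) c d"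
  shows "\<exists>w c' d'. c \<le> c' \<and> c' < d' \<and> d' \<le> d \<and>
    dense_between (\<lambda>y. \<exists>u. \<bar>u - w\<bar> \<le> \<delta> \<and> \<alpha> \<le> u \<and> u \<le> \<beta> \<and> R u y) c' d'"
proof -
  define X where "X = (\<lambda>s. dense_between (\<lambda>y. \<exists>u. \<alpha> \<le> u \<and> u \<le> \<beta> \<and> u \<le> s \<and> R u y) c d)"
  have "dpred (\<lambda>e. X (e 0))"
    unfolding X_def dense_between_def by (intro dpred_subst2[OF R] dintros)
  moreover have "X \<beta>"
    unfolding X_def by (rule dense_between_mono[OF dn]) auto
  moreover have "\<alpha> \<le> s" if "X s" for s
    using dense_betweenD[OF that[unfolded X_def], of c d] \<open>c < d\<close> by (auto dest: order_trans)
  ultimately have "\<exists>w. (\<forall>s. X s \<longrightarrow> w \<le> s) \<and> (\<forall>b. (\<forall>s. X s \<longrightarrow> b \<le> s) \<longrightarrow> b \<le> w)"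
    by (rule definable_inf)
  then obtain w where w: "\<forall>s. X s \<longrightarrow> w \<le> s" "\<forall>b. (\<forall>s. X s \<longrightarrow> b \<le> s) \<longrightarrow> b \<le> w" by blast
  have "\<not> X (w - \<delta>)" using w(1) \<open>\<delta> > 0\<close> by (metis add_le_same_cancel1 diff_add_cancel le_diff_eq not_le)
  then obtain c' d' where c'd': "c \<le> c'" "c' < d'" "d' \<le> d"
    "\<And>y. c' < y \<Longrightarrow> y < d' \<Longrightarrow> \<not> (\<exists>u. \<alpha> \<le> u \<and> u \<le> \<beta> \<and> u \<le> w - \<delta> \<and> R u y)"
    unfolding X_def by (rule not_dense_betweenE) blast
  have "\<not> w + \<delta> \<le> w" using \<open>\<delta> > 0\<close> by simp
  then obtain s where s: "X s" "s < w + \<delta>" using w(2) by (meson not_le)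
  have "dense_between (\<lambda>y. \<exists>u. \<bar>u - w\<bar> \<le> \<delta> \<and> \<alpha> \<le> u \<and> u \<le> \<beta> \<and> R u y) c' d'"
  proof (rule dense_between_mono[OF s(1)[unfolded X_def]])
    fix y assume y: "c' < y" "y < d'" "\<exists>u. \<alpha> \<le> u \<and> u \<le> \<beta> \<and> u \<le> s \<and> R u y"
    then obtain u where u: "\<alpha> \<le> u" "u \<le> \<beta>" "u \<le> s" "R u y" by blast
    hence "w - \<delta> < u" using c'd'(4)[OF y(1,2)] by (meson not_le)
    hence "\<bar>u - w\<bar> \<le> \<delta>" using u(3) s(2) by (auto simp: abs_le_iff algebra_simps)
    thus "\<exists>u. \<bar>u - w\<bar> \<le> \<delta> \<and> \<alpha> \<le> u \<and> u \<le> \<beta> \<and> R u y" using u by blast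
  qed (use c'd' in auto)
  thus ?thesis using c'd' by blast
qed

text \<open>The coordinates of the witness are localised one by one, each time on a smaller
  interval.\<close>

lemma uniform_selection:
  assumes "finite S" "i \<notin> S" "dpred R" "\<delta> > 0" "c < d"
    and "dense_between (\<lambda>y. \<exists>z. (\<forall>j\<in>S. \<alpha> j \<le> z j \<and> z j \<le> \<beta> j) \<and> R ((override_on e z S)(i := y))) c d"
  shows "\<exists>w c' d'. c \<le> c' \<and> c' < d' \<and> d' \<le> d \<and>
    dense_between (\<lambda>y. \<exists>z. (\<forall>j\<in>S. \<bar>z j - w j\<bar> \<le> \<delta> \<and> \<alpha> j \<le> z j \<and> z j \<le> \<beta> j) \<and>
      R ((override_on e z S)(i := y))) c' d'"
  using assms
proof (induction S arbitrary: R c d rule: finite_induct)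
  case empty
  thus ?case by (intro exI[of _ undefined] exI[of _ c] exI[of _ d]) auto
next
  case (insert k S)
  note R = \<open>dpred R\<close>
  have ik: "i \<noteq> k" "i \<notin> S" using insert.prems(1) by auto
  define R1 where "R1 = (\<lambda>u y. \<exists>z. (\<forall>j\<in>S. \<alpha> j \<le> z j \<and> z j \<le> \<beta> j) \<and> R ((override_on e z S)(k := u, i := y)))"
  have "dpred (\<lambda>e. R1 (e 0) (e 1))"
    unfolding R1_def by (intro dpred_subst[OF R] dpred_ex_point dpred_ball_finite insert.hyps dintros)
  moreover have "dense_between (\<lambda>y. \<exists>u. \<alpha> k \<le> u \<and> u \<le> \<beta> k \<and> R1 u y) c d"
  proof (rule dense_between_mono[OF insert.prems(5)])
    fix y assume "\<exists>z. (\<forall>j\<in>insert k S. \<alpha> j \<le> z j \<and> z j \<le> \<beta> j) \<and> R ((override_on e z (insert k S))(i := y))"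
    then obtain z where z: "\<forall>j\<in>insert k S. \<alpha> j \<le> z j \<and> z j \<le> \<beta> j"
      "R ((override_on e z S)(k := z k, i := y))" unfolding override_on_insert by blast
    thus "\<exists>u. \<alpha> k \<le> u \<and> u \<le> \<beta> k \<and> R1 u y" unfolding R1_def by (intro exI[of _ "z k"]) blast
  qed auto
  ultimately obtain w0 c1 d1 where 1: "c \<le> c1" "c1 < d1" "d1 \<le> d"
    "dense_between (\<lambda>y. \<exists>u. \<bar>u - w0\<bar> \<le> \<delta> \<and> \<alpha> k \<le> u \<and> u \<le> \<beta> k \<and> R1 u y) c1 d1"
    using uniform_selection_1[of R1 \<delta> c d "\<alpha> k" "\<beta> k"] insert.prems by blast
  \<comment> \<open>The coordinate already localised near \<open>w0\<close> is hidden in the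
    predicate, so that localising the others keeps it there.\<close>
  define R' where "R' = (\<lambda>e. \<exists>u. \<bar>u - w0\<bar> \<le> \<delta> \<and> \<alpha> k \<le> u \<and> u \<le> \<beta> k \<and> R (e(k := u)))"
  have R': "dpred R'" unfolding R'_def by (intro dpred_subst[OF R] dintros)
  have "dense_between (\<lambda>y. \<exists>z. (\<forall>j\<in>S. \<alpha> j \<le> z j \<and> z j \<le> \<beta> j) \<and> R' ((override_on e z S)(i := y))) c1 d1"
    by (rule dense_between_mono[OF 1(4)])
       (use ik in \<open>auto simp: R1_def R'_def fun_upd_twist[of i k]\<close>)
  from insert.IH[OF ik(2) R' \<open>\<delta> > 0\<close> 1(2) this] obtain w c2 d2 where
    2: "c1 \<le> c2" "c2 < d2" "d2 \<le> d1" and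
    dn: "dense_between (\<lambda>y. \<exists>z. (\<forall>j\<in>S. \<bar>z j - w j\<bar> \<le> \<delta> \<and> \<alpha> j \<le> z j \<and> z j \<le> \<beta> j) \<and>
      R' ((override_on e z S)(i := y))) c2 d2"
    by blast
  show ?case
  proof (rule exI[of _ "w(k := w0)"], rule exI[of _ c2], rule exI[of _ d2], intro conjI)
    show "dense_between (\<lambda>y. \<exists>z. (\<forall>j\<in>insert k S. \<bar>z j - (w(k := w0)) j\<bar> \<le> \<delta> \<and> \<alpha> j \<le> z j \<and> z j \<le> \<beta> j) \<and>
      R ((override_on e z (insert k S))(i := y))) c2 d2"
    proof (rule dense_between_mono[OF dn])
      fix y assume "\<exists>z. (\<forall>j\<in>S. \<bar>z j - w j\<bar> \<le> \<delta> \<and> \<alpha> j \<le> z j \<and> z j \<le> \<beta> j) \<and> R' ((override_on e z S)(i := y))"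
      then obtain z u where z: "\<forall>j\<in>S. \<bar>z j - w j\<bar> \<le> \<delta> \<and> \<alpha> j \<le> z j \<and> z j \<le> \<beta> j"
        and u: "\<bar>u - w0\<bar> \<le> \<delta>" "\<alpha> k \<le> u" "u \<le> \<beta> k" "R ((override_on e z S)(i := y, k := u))"
        unfolding R'_def by blast
      have "(override_on e (z(k := u)) (insert k S))(i := y) = (override_on e z S)(i := y, k := u)"
        using ik insert.hyps by (auto simp: override_on_def fun_eq_iff)
      moreover have "\<forall>j\<in>insert k S. \<bar>(z(k := u)) j - (w(k := w0)) j\<bar> \<le> \<delta> \<and>
        \<alpha> j \<le> (z(k := u)) j \<and> (z(k := u)) j \<le> \<beta> j"
        using z u insert.hyps by auto
      ultimately show "\<exists>z. (\<forall>j\<in>insert k S. \<bar>z j - (w(k := w0)) j\<bar> \<le> \<delta> \<and> \<alpha> j \<le> z j \<and> z j \<le> \<beta> j) \<and>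
          R ((override_on e z (insert k S))(i := y))"
        using u(4) by metis
    qed auto
  qed (use 1 2 in auto)
qed

text \<open>The step from boxes in all fibers over an interval to one box of higher dimension. Baire
  gives one scale for a dense set of fibers, uniform selection one position, and closedness of the
  member fills in the missing fibers.\<close>

lemma gen_box_on_family:
  assumes Q: "ds_family Q" and S: "finite S" "i \<notin> S"
    and g: "gen i (\<lambda>e. \<exists>t. box_on S (Q t) e) e"
  shows "\<exists>t. box_on (insert i S) (Q t) e"
proof -
  note QD = ds_familyD[OF Q]
  let ?p = "\<lambda>u y. (override_on e u S)(i := y)"
  obtain c d where cd: "c < d" "\<And>y. c < y \<Longrightarrow> y < d \<Longrightarrow> \<exists>t. box_on S (Q t) (e(i := y))"
    using g unfolding gen_def by blast
  define R where "R = (\<lambda>t e. \<forall>z. (\<forall>j\<in>S. e j \<le> z j \<and> z j \<le> e j + 1 / t) \<longrightarrow> Q t (override_on e z S))"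
  \<comment> \<open>The fiber over \<open>y\<close> contains a cube of side \<open>1 / t\<close>
    whose lower corner \<open>u\<close> lies between \<open>-t\<close> and \<open>t\<close>; this is
    increasing in \<open>t\<close>.\<close>
  define W where "W = (\<lambda>t y. 0 < t \<and> (\<exists>u. (\<forall>j\<in>S. 0 - t \<le> u j \<and> u j \<le> t) \<and> R t (?p u y)))"
  have Wd: "dpred (\<lambda>e. W (e 0) (e 1))"
    unfolding W_def R_def
    by (intro dpred_family[OF Q] dpred_ex_point dpred_all_point dpred_ball_finite S dintros)
  have Wm: "W t y" if st: "W s y" "s \<le> t" for s t y
  proof -
    obtain u where u: "0 < s" "\<forall>j\<in>S. 0 - s \<le> u j \<and> u j \<le> s" "R s (?p u y)"
      using st unfolding W_def by blast
    have le: "1 / t \<le> 1 / s" using u(1) st(2) by (simp add: frac_le)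
    have "R t (?p u y)"
      unfolding R_def
    proof (intro allI impI QD(2)[OF _ st(2)])
      fix z assume "\<forall>j\<in>S. ?p u y j \<le> z j \<and> z j \<le> ?p u y j + 1 / t"
      hence "\<forall>j\<in>S. ?p u y j \<le> z j \<and> z j \<le> ?p u y j + 1 / s"
        using le by (meson add_left_mono order_trans)
      thus "Q s (override_on (?p u y) z S)" using u(3) unfolding R_def by blast
    qed
    moreover have "\<forall>j\<in>S. 0 - t \<le> u j \<and> u j \<le> t" using u(2) st(2) by force
    moreover have "0 < t" using u(1) st(2) by simp
    ultimately show ?thesis unfolding W_def by blast
  qed
  have Wdn: "dense_between (\<lambda>y. \<exists>t. W t y) c d"
  proof (rule dense_between_all)
    fix y assume "c < y" "y < d"
    then obtain t where "box_on S (Q t) (e(i := y))" using cd(2) by blast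
    then obtain a b where ab: "\<forall>j\<in>S. a j < b j"
      "\<And>z. \<forall>j\<in>S. a j < z j \<and> z j < b j \<Longrightarrow> Q t (override_on (e(i := y)) z S)" unfolding box_on_def by blast
    \<comment> \<open>The cube starts one third into the box, and \<open>T\<close> is large enough
      that its side is at most one third of every edge.\<close>
    define u where "u = (\<lambda>j. (2 * a j + b j) / 3)"
    obtain T where T: "T > max t 0" "\<And>j. j \<in> S \<Longrightarrow> max \<bar>u j\<bar> (3 / (b j - a j)) \<le> T"
      using finite_upper_bound[OF S(1), of "max t 0" "\<lambda>j. max \<bar>u j\<bar> (3 / (b j - a j))"] by blast
    have "R T (?p u y)"
      unfolding R_def
    proof (intro allI impI)
      fix z assume z: "\<forall>j\<in>S. ?p u y j \<le> z j \<and> z j \<le> ?p u y j + 1 / T"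
      have "\<forall>j\<in>S. a j < z j \<and> z j < b j"
      proof
        fix j assume j: "j \<in> S"
        have uj: "a j < u j" "u j + (b j - a j) / 3 < b j" using ab(1) j by (auto simp: u_def field_simps)
        have "u j \<le> z j" "z j \<le> u j + 1 / T" using z j S(2) by (auto simp: override_on_def split: if_splits)
        moreover have "1 / T \<le> 1 / (3 / (b j - a j))"
          by (rule frac_le) (use ab(1) j T(2)[OF j] in auto)
        hence "u j + 1 / T \<le> u j + (b j - a j) / 3" by simp
        hence "u j + 1 / T < b j" using uj(2) by (rule le_less_trans)
        ultimately show "a j < z j \<and> z j < b j" using uj(1) by (metis le_less_trans less_le_trans)
      qed
      hence "Q t (override_on (e(i := y)) z S)" by (rule ab(2))
      thus "Q T (override_on (?p u y) z S)"
        using QD(2)[of t _ T] T(1) S(2) by (simp add: override_on_absorb)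
    qed
    moreover have "\<forall>j\<in>S. 0 - T \<le> u j \<and> u j \<le> T"
    proof
      fix j assume "j \<in> S"
      hence "\<bar>u j\<bar> \<le> T" using T(2) by simp
      thus "0 - T \<le> u j \<and> u j \<le> T" by (simp add: abs_le_iff)
    qed
    ultimately have "W T y" unfolding W_def using T(1) by auto
    thus "\<exists>t. W t y" by blast
  qed
  have "\<exists>t a b. c \<le> a \<and> a < b \<and> b \<le> d \<and> dense_between (W t) a b"
    by (rule baire[OF Wd _ cd(1) Wdn]) (rule Wm)
  then obtain t c1 d1 where 1: "c \<le> c1" "c1 < d1" "d1 \<le> d" "dense_between (W t) c1 d1" by blast
  have t: "t > 0" using dense_betweenD[OF 1(4) order_refl 1(2) order_refl] unfolding W_def by blast
  \<comment> \<open>Cubes of side \<open>4 * \<delta>\<close> with corners within \<delta> of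
    \<open>w\<close> all contain the box from \<open>w + \<delta>\<close> to
    \<open>w + 3 * \<delta>\<close>, which no longer depends on \<open>y\<close>.\<close>
  define \<delta> where "\<delta> = 1 / (4 * t)"
  have \<delta>: "\<delta> > 0" "1 / t = 4 * \<delta>" using t by (auto simp: \<delta>_def)
  have Rt: "dpred (R t)"
    unfolding R_def by (intro dpred_family[OF Q] dpred_all_point dpred_ball_finite S dintros)
  have "dense_between (\<lambda>y. \<exists>z. (\<forall>j\<in>S. 0 - t \<le> z j \<and> z j \<le> t) \<and> R t (?p z y)) c1 d1"
    by (rule dense_between_mono[OF 1(4)]) (auto simp: W_def)
  from uniform_selection[OF S Rt \<delta>(1) 1(2) this] obtain w c2 d2 where
    2: "c1 \<le> c2" "c2 < d2" "d2 \<le> d1" and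
    dn: "dense_between (\<lambda>y. \<exists>z. (\<forall>j\<in>S. \<bar>z j - w j\<bar> \<le> \<delta> \<and> 0 - t \<le> z j \<and> z j \<le> t) \<and>
      R t (?p z y)) c2 d2" by blast
  have dnQ: "dense_between (\<lambda>y. \<forall>z. (\<forall>j\<in>S. w j + \<delta> < z j \<and> z j < w j + 3 * \<delta>) \<longrightarrow>
      Q t (override_on (e(i := y)) z S)) c2 d2"
  proof (rule dense_between_mono[OF dn order_refl order_refl], intro allI impI)
    fix y z assume "\<exists>z. (\<forall>j\<in>S. \<bar>z j - w j\<bar> \<le> \<delta> \<and> 0 - t \<le> z j \<and> z j \<le> t) \<and> R t (?p z y)"
      and z: "\<forall>j\<in>S. w j + \<delta> < z j \<and> z j < w j + 3 * \<delta>"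
    then obtain u where u: "\<forall>j\<in>S. \<bar>u j - w j\<bar> \<le> \<delta>" "R t (?p u y)" by blast
    have "\<forall>j\<in>S. ?p u y j \<le> z j \<and> z j \<le> ?p u y j + 1 / t"
    proof
      fix j assume j: "j \<in> S"
      have "u j - w j \<le> \<delta>" "w j - u j \<le> \<delta>" using u(1) j by (auto simp: abs_le_iff)
      moreover have "w j + \<delta> < z j" "z j < w j + 3 * \<delta>" using z j by auto
      ultimately have "u j \<le> z j" "z j \<le> u j + 4 * \<delta>" by (auto simp: algebra_simps)
      thus "?p u y j \<le> z j \<and> z j \<le> ?p u y j + 1 / t"
        using j S(2) \<delta>(2) by (auto simp: override_on_def)
    qed
    hence "Q t (override_on (?p u y) z S)" using u(2) unfolding R_def by blast
    thus "Q t (override_on (e(i := y)) z S)" using S(2) by (simp add: override_on_absorb)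
  qed
  have "box_on (insert i S) (Q t) e"
    unfolding box_on_def
  proof (rule exI[of _ "\<lambda>j. if j = i then c2 else w j + \<delta>"],
      rule exI[of _ "\<lambda>j. if j = i then d2 else w j + 3 * \<delta>"], intro conjI allI impI)
    show "\<forall>j\<in>insert i S. (if j = i then c2 else w j + \<delta>) < (if j = i then d2 else w j + 3 * \<delta>)"
      using 2 \<delta>(1) by auto
    fix z assume z: "\<forall>j\<in>insert i S. (if j = i then c2 else w j + \<delta>) < z j \<and>
        z j < (if j = i then d2 else w j + 3 * \<delta>)"
    have z': "\<forall>j\<in>S. w j + \<delta> < z j \<and> z j < w j + 3 * \<delta>" and zi: "c2 < z i" "z i < d2"
      using z S(2) by (auto split: if_splits)
    have "Q t ((override_on e z S)(i := z i))"
    \<comment> \<open>A fixed point of the common box belongs to \<open>Q t\<close> for densely many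
      \<open>y\<close>, hence for every \<open>y\<close> of the interval.\<close>
    proof (rule closed_pred_limit[OF QD(1)], unfold limit_of_def, intro allI impI)
      fix \<epsilon> :: 'a assume "\<epsilon> > 0"
      hence "z i < min d2 (z i + \<epsilon>)" using zi by simp
      then obtain y where y: "z i < y" "y < min d2 (z i + \<epsilon>)" "Q t (override_on (e(i := y)) z S)"
        using dense_betweenD[OF dnQ, of "z i" "min d2 (z i + \<epsilon>)"] zi z' by auto
      moreover have "override_on (e(i := y)) z S = (override_on e z S)(i := y)"
        using S(2) by (auto simp: override_on_def fun_eq_iff)
      ultimately show "\<exists>y. Q t (?p z y) \<and> \<bar>y - z i\<bar> < \<epsilon>"
        by (intro exI[of _ y]) auto
    qed
    thus "Q t (override_on e z (insert i S))" by (simp add: override_on_insert)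
  qed
  thus ?thesis by blast
qed

lemma box_on_family:
  assumes Q: "ds_family Q" and "finite S" "box_on S (\<lambda>e. \<exists>t. Q t e) e"
  shows "\<exists>t. box_on S (Q t) e"
  using assms(2,3)
proof (induction S arbitrary: e rule: finite_induct)
  case empty
  thus ?case unfolding box_on_def by simp
next
  case (insert i S)
  have "gen i (box_on S (\<lambda>e. \<exists>t. Q t e)) e" by (rule box_on_insert_gen[OF insert.prems insert.hyps(2)])
  hence "gen i (\<lambda>e. \<exists>t. box_on S (Q t) e) e" unfolding gen_def using insert.IH by blast
  thus ?case by (rule gen_box_on_family[OF Q insert.hyps(1,2)])
qed

text \<open>A Kuratowski-Ulam rule: boxes are iterated interval quantifiers. It moves all questions
  about interiors in several variables to one variable at a time.\<close>

lemma box_on_insert: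
  assumes "ds P" "finite S" "i \<notin> S"
  shows "box_on (insert i S) P = gen i (box_on S P)"
proof
  fix e
  obtain Q where Q: "ds_family Q" "P = (\<lambda>e. \<exists>t. Q t e)"
    using assms(1) unfolding ds_def fun_eq_iff by blast
  show "box_on (insert i S) P e = gen i (box_on S P) e"
  proof
    assume "gen i (box_on S P) e"
    hence "gen i (\<lambda>e. \<exists>t. box_on S (Q t) e) e"
      using box_on_family[OF Q(1) assms(2)] unfolding gen_def Q(2) by blast
    from gen_box_on_family[OF Q(1) assms(2,3) this] show "box_on (insert i S) P e"
      unfolding Q(2) box_on_def by blast
  qed (rule box_on_insert_gen[OF _ assms(3)])
qed

lemma box_on_empty: "box_on {} P = P"
  by (auto simp: box_on_def fun_eq_iff)

lemma ds_box_on: "finite S \<Longrightarrow> ds P \<Longrightarrow> ds (box_on S P)"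
  by (induction S rule: finite_induct) (simp_all add: box_on_empty box_on_insert ds_gen)

end

section \<open>Existential quantification over sets of variables\<close>

definition ex_on :: "nat set \<Rightarrow> ((nat \<Rightarrow> 'a) \<Rightarrow> bool) \<Rightarrow> (nat \<Rightarrow> 'a) \<Rightarrow> bool" where
  "ex_on S P e \<longleftrightarrow> (\<exists>z. P (override_on e z S))"

lemma ex_on_empty: "ex_on {} P = P"
  by (auto simp: ex_on_def fun_eq_iff)

lemma ex_on_mono: "ex_on S P e \<Longrightarrow> (\<And>e. P e \<Longrightarrow> P' e) \<Longrightarrow> ex_on S P' e"
  unfolding ex_on_def by blast

lemma ex_on_union: "ex_on (S \<union> T) P = ex_on S (ex_on T P)"
proof
  fix e :: "nat \<Rightarrow> 'a"
  have "override_on e z (S \<union> T) = override_on (override_on e z S) z T" for z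
    by (auto simp: override_on_def)
  moreover have "override_on (override_on e z S) z' T = override_on e (override_on z z' T) (S \<union> T)" for z z'
    by (auto simp: override_on_def)
  ultimately show "ex_on (S \<union> T) P e = ex_on S (ex_on T P) e" unfolding ex_on_def by metis
qed

lemma ex_on_single: "ex_on {i} P = ex_at i P"
proof
  fix e :: "nat \<Rightarrow> 'a"
  have "override_on e z {i} = e(i := z i)" for z by (auto simp: override_on_def)
  moreover have "e(i := a) = override_on e (\<lambda>_. a) {i}" for a by (auto simp: override_on_def)
  ultimately show "ex_on {i} P e = ex_at i P e" unfolding ex_on_def ex_at_def by metis
qed

lemma ex_on_insert: "ex_on (insert i S) P = ex_at i (ex_on S P)"
  using ex_on_union[of "{i}" S P] by (simp add: ex_on_single)

lemma ex_on_insert': "ex_on (insert i S) P = ex_on S (ex_at i P)"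
  using ex_on_union[of S "{i}" P] by (simp add: ex_on_single)

text \<open>The elementary direction: a choice made once for the whole box also serves each of its
  points. The converse order is what requires \<open>gen_ex_at\<close>.\<close>

lemma ex_on_box:
  assumes "ex_on J (box_on S P) e" "J \<inter> S = {}"
  shows "box_on S (ex_on J P) e"
proof -
  obtain x a b where ab: "\<forall>i\<in>S. a i < b i"
    "\<And>z. \<forall>i\<in>S. a i < z i \<and> z i < b i \<Longrightarrow> P (override_on (override_on e x J) z S)"
    using assms(1) unfolding ex_on_def box_on_def by blast
  moreover have "override_on (override_on e x J) z S = override_on (override_on e z S) x J" for z
    using assms(2) by (auto simp: override_on_def fun_eq_iff)
  ultimately show ?thesis unfolding box_on_def ex_on_def by metis
qed

lemma box_on_single: "box_on {i} P = gen i P"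
proof
  fix e :: "nat \<Rightarrow> 'a"
  have *: "override_on e z {i} = e(i := z i)" for z by (auto simp: override_on_def)
  show "box_on {i} P e = gen i P e"
  proof
    assume "box_on {i} P e"
    thus "gen i P e" using box_on_insert_gen[of i "{}" P e] unfolding gen_def box_on_def by simp
  next
    assume "gen i P e"
    then obtain a b where "a < b" "\<And>x. a < x \<Longrightarrow> x < b \<Longrightarrow> P (e(i := x))" unfolding gen_def by blast
    thus "box_on {i} P e" unfolding box_on_def *
      by - (rule exI[of _ "\<lambda>_. a"], rule exI[of _ "\<lambda>_. b"], simp)
  qed
qed

lemma ex_at_gen: "ex_at i (gen j P) e \<Longrightarrow> i \<noteq> j \<Longrightarrow> gen j (ex_at i P) e"
  using ex_on_box[of "{i}" "{j}" P e] by (simp add: box_on_single ex_on_single)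

lemma box_on_nonempty:
  fixes P :: "(nat \<Rightarrow> 'a::linordered_field) \<Rightarrow> bool"
  assumes "box_on S P e"
  obtains z where "P (override_on e z S)"
proof -
  obtain a b where ab: "\<forall>i\<in>S. a i < b i" "\<And>z. \<forall>i\<in>S. a i < z i \<and> z i < b i \<Longrightarrow> P (override_on e z S)"
    using assms unfolding box_on_def by blast
  show thesis by (rule that, rule ab(2)[of "\<lambda>i. (a i + b i) / 2"]) (use ab(1) in auto)
qed

context restrained_expansion
begin

lemma ds_ex_on: "finite S \<Longrightarrow> ds P \<Longrightarrow> ds (ex_on S P)"
  by (induction S rule: finite_induct) (simp_all add: ex_on_empty ex_on_insert ds_ex_at)

text \<open>If the fibers with interior are not dense along \<open>i\<close>, then over some
  interval no fiber has interior, and by induction each misses a cube. Baire and uniform selection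
  make one box missed for densely many \<open>y\<close>; yet the projection of the part of
  \<open>P\<close> inside that box is dense, so it contains a whole interval of
  \<open>y\<close>.\<close>

lemma dense_box_imp_box_on:
  assumes P: "ds P" and "finite S" "\<forall>i\<in>S. a i < b i" "dense_box S P e a b"
  shows "box_on S P e"
  using assms(2-)
proof (induction S arbitrary: e rule: finite_induct)
  case empty
  thus ?case by (simp add: dense_box_def box_on_def)
next
  case (insert i S)
  note S = insert.hyps
  let ?p = "\<lambda>u y. (override_on e u S)(i := y)"
  have ab: "a i < b i" "\<forall>j\<in>S. a j < b j" using insert.prems by auto
  show ?case
  proof (cases "dense_between (\<lambda>y. box_on S P (e(i := y))) (a i) (b i)")
    case True
    hence "gen i (box_on S P) e" using ds_dense_gen[OF ds_box_on[OF S(1) P] ab(1)] by blast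
    thus ?thesis by (simp add: box_on_insert[OF P S])
  next
    case False
    then obtain c d where cd: "a i \<le> c" "c < d" "d \<le> b i"
      "\<And>y. c < y \<Longrightarrow> y < d \<Longrightarrow> \<not> box_on S P (e(i := y))" by (rule not_dense_betweenE) blast
    \<comment> \<open>An open cube of side \<open>1 / t\<close> disjoint from \<open>P\<close>, with
      lower corner read from the assignment; its upper faces are required to stay inside the given
      box.\<close>
    define R where "R = (\<lambda>t e. (\<forall>j\<in>S. e j + 1 / t \<le> b j) \<and>
      (\<forall>z. (\<forall>j\<in>S. e j < z j \<and> z j < e j + 1 / t) \<longrightarrow> \<not> P (override_on e z S)))"
    define W where "W = (\<lambda>t y. 0 < t \<and>
      (\<exists>u. (\<forall>j\<in>S. a j \<le> u j \<and> u j \<le> b j) \<and> R t (?p u y)))"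
    have Wd: "dpred (\<lambda>e. W (e 0) (e 1))"
      unfolding W_def R_def
      by (intro dpred_subst[OF dpred_ds[OF P]] dpred_ex_point dpred_all_point dpred_ball_finite S dintros)
    have Wm: "W t y" if st: "W s y" "s \<le> t" for s t y
    proof -
      obtain u where u: "0 < s" "\<forall>j\<in>S. a j \<le> u j \<and> u j \<le> b j" "R s (?p u y)"
        using st unfolding W_def by blast
      have le: "1 / t \<le> 1 / s" using u(1) st(2) by (simp add: frac_le)
      hence le': "x + 1 / t \<le> x + 1 / s" for x by simp
      have "R t (?p u y)"
        using u(3) unfolding R_def by (meson le' order_trans less_le_trans)
      thus ?thesis using u(1,2) st(2) unfolding W_def by auto
    qed
    have Wdn: "dense_between (\<lambda>y. \<exists>t. W t y) c d"
    proof (rule dense_between_all)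
      fix y assume "c < y" "y < d"
      hence "\<not> box_on S P (e(i := y))" by (rule cd(4))
      hence "\<not> dense_box S P (e(i := y)) a b" using insert.IH ab(2) by blast
      then obtain a' b' where a'b': "\<forall>j\<in>S. a j \<le> a' j \<and> a' j < b' j \<and> b' j \<le> b j"
        "\<And>z. \<forall>j\<in>S. a' j < z j \<and> z j < b' j \<Longrightarrow> \<not> P (override_on (e(i := y)) z S)"
        unfolding dense_box_def by blast
      obtain t where t: "t > 0" "\<And>j. j \<in> S \<Longrightarrow> 1 / (b' j - a' j) \<le> t"
        using finite_upper_bound[OF S(1), of 0 "\<lambda>j. 1 / (b' j - a' j)"] by blast
      have le: "a' j + 1 / t \<le> b' j" if j: "j \<in> S" for j
      proof -
        have "1 / t \<le> 1 / (1 / (b' j - a' j))" by (rule frac_le) (use a'b'(1) j t(2)[OF j] in auto)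
        thus ?thesis by (simp add: algebra_simps)
      qed
      have eq: "?p a' y j = a' j" if "j \<in> S" for j
        using that S(2) by (auto simp: override_on_def)
      have "R t (?p a' y)"
        unfolding R_def
      proof (intro conjI ballI allI impI)
        fix j assume j: "j \<in> S"
        show "?p a' y j + 1 / t \<le> b j"
          using le[OF j] eq[OF j] a'b'(1) j by (metis order_trans)
      next
        fix z assume z: "\<forall>j\<in>S. ?p a' y j < z j \<and>
          z j < ?p a' y j + 1 / t"
        have "\<forall>j\<in>S. a' j < z j \<and> z j < b' j" using z le eq by (metis less_le_trans)
        hence "\<not> P (override_on (e(i := y)) z S)" by (rule a'b'(2))
        thus "\<not> P (override_on (?p a' y) z S)" using S(2) by (simp add: override_on_absorb)
      qed
      moreover have "\<forall>j\<in>S. a j \<le> a' j \<and> a' j \<le> b j" using a'b'(1) by force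
      ultimately show "\<exists>t. W t y" unfolding W_def using t(1) by blast
    qed
    have "\<exists>t c1 d1. c \<le> c1 \<and> c1 < d1 \<and> d1 \<le> d \<and> dense_between (W t) c1 d1"
      by (rule baire[OF Wd _ cd(2) Wdn]) (rule Wm)
    then obtain t c1 d1 where 1: "c \<le> c1" "c1 < d1" "d1 \<le> d" "dense_between (W t) c1 d1" by blast
    have t: "t > 0" using dense_betweenD[OF 1(4) order_refl 1(2) order_refl] unfolding W_def by blast
    define \<delta> where "\<delta> = 1 / (4 * t)"
    have \<delta>: "\<delta> > 0" "1 / t = 4 * \<delta>" using t by (auto simp: \<delta>_def)
    have Rt: "dpred (R t)"
      unfolding R_def
      by (intro dpred_subst[OF dpred_ds[OF P]] dpred_all_point dpred_ball_finite S dintros)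
    have "dense_between (\<lambda>y. \<exists>z. (\<forall>j\<in>S. a j \<le> z j \<and> z j \<le> b j) \<and> R t (?p z y)) c1 d1"
      by (rule dense_between_mono[OF 1(4)]) (auto simp: W_def)
    from uniform_selection[OF S Rt \<delta>(1) 1(2) this] obtain w c2 d2 where
      2: "c1 \<le> c2" "c2 < d2" "d2 \<le> d1" and
      dn: "dense_between (\<lambda>y. \<exists>z. (\<forall>j\<in>S. \<bar>z j - w j\<bar> \<le> \<delta> \<and> a j \<le> z j \<and> z j \<le> b j) \<and>
        R t (?p z y)) c2 d2" by blast
    let ?near = "\<lambda>y. \<exists>z. (\<forall>j\<in>S. \<bar>z j - w j\<bar> \<le> \<delta> \<and> a j \<le> z j \<and> z j \<le> b j) \<and> R t (?p z y)"
    have sel: "(\<forall>j\<in>S. a j \<le> w j + \<delta> \<and> w j + 3 * \<delta> \<le> b j) \<and>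
       (\<forall>z. (\<forall>j\<in>S. w j + \<delta> < z j \<and> z j < w j + 3 * \<delta>) \<longrightarrow> \<not> P (override_on (e(i := y)) z S))"
      if ex: "?near y" for y
    proof -
      obtain u where u: "\<forall>j\<in>S. \<bar>u j - w j\<bar> \<le> \<delta> \<and> a j \<le> u j" "R t (?p u y)"
        using ex by blast
      have eq: "?p u y j = u j" if "j \<in> S" for j
        using that S(2) by (auto simp: override_on_def)
      have uw: "u j \<le> w j + \<delta>" "w j \<le> u j + \<delta>" if "j \<in> S" for j
      proof -
        have "\<bar>u j - w j\<bar> \<le> \<delta>" using u(1) that by blast
        thus "u j \<le> w j + \<delta>" "w j \<le> u j + \<delta>" by (auto simp: abs_le_iff algebra_simps)
      qed
      have wu: "w j + 3 * \<delta> \<le> u j + 4 * \<delta>" if "j \<in> S" for j using uw(2)[OF that] by simp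
      show ?thesis
      proof (intro conjI ballI allI impI)
        fix j assume j: "j \<in> S"
        show "a j \<le> w j + \<delta>" using u(1) uw(1)[OF j] j by (meson order_trans)
        have "u j + 4 * \<delta> \<le> b j" using u(2) eq[OF j] j \<delta>(2) unfolding R_def by metis
        thus "w j + 3 * \<delta> \<le> b j" using wu[OF j] by (rule order_trans[rotated])
      next
        fix z assume z: "\<forall>j\<in>S. w j + \<delta> < z j \<and> z j < w j + 3 * \<delta>"
        have "\<forall>j\<in>S. ?p u y j < z j \<and> z j < ?p u y j + 1 / t"
        proof
          fix j assume j: "j \<in> S"
          have "u j < z j" using uw(1)[OF j] z j by (meson le_less_trans)
          moreover have "z j < u j + 4 * \<delta>" using wu[OF j] z j by (meson less_le_trans)
          ultimately show "?p u y j < z j \<and> z j < ?p u y j + 1 / t"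
            using eq[OF j] \<delta>(2) by simp
        qed
        hence "\<not> P (override_on (?p u y) z S)" using u(2) unfolding R_def by blast
        thus "\<not> P (override_on (e(i := y)) z S)" using S(2) by (simp add: override_on_absorb)
      qed
    qed
    obtain y0 where "?near y0"
      using dense_betweenD[OF dn order_refl 2(2) order_refl] by blast
    hence wab: "\<forall>j\<in>S. a j \<le> w j + \<delta> \<and> w j + 3 * \<delta> \<le> b j" using sel by blast
    \<comment> \<open>A closed box strictly inside the missed open box from
      \<open>w + \<delta>\<close> to \<open>w + 3 * \<delta>\<close>.\<close>
    define lo hi where "lo = (\<lambda>j. w j + 3 / 2 * \<delta>)" and "hi = (\<lambda>j. w j + 5 / 2 * \<delta>)"
    have lohi: "w j + \<delta> < lo j" "lo j < hi j" "hi j < w j + 3 * \<delta>" for j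
      using \<delta>(1) by (auto simp: lo_def hi_def)
    have ablohi: "a j \<le> lo j" "hi j \<le> b j" if "j \<in> S" for j
      using wab that lohi(1,3)[of j] by (meson less_imp_le order_trans)+
    \<comment> \<open>Intersecting with the closed box stays within the class \<open>ds\<close>, so
      density of the projection can be upgraded to an interval.\<close>
    let ?P = "ex_on S (\<lambda>e. P e \<and> (\<forall>j\<in>S. lo j \<le> e j \<and> e j \<le> hi j))"
    have "ds (\<lambda>e. \<forall>j\<in>S. lo j \<le> e j \<and> e j \<le> hi j)"
      by (intro ds_closed dpred_ball_finite closed_pred_ball_finite closed_pred_conj closed_pred_le
          S dintros)
    hence dsP: "ds ?P" by (intro ds_ex_on ds_conj P S)
    have "dense_between (\<lambda>y. ?P (e(i := y))) c2 d2"
      unfolding dense_between_def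
    proof (intro allI impI, elim conjE)
      fix c' d' assume c'd': "c2 \<le> c'" "c' < d'" "d' \<le> d2"
      have "\<forall>j\<in>insert i S. a j \<le> (lo(i := c')) j \<and> (lo(i := c')) j < (hi(i := d')) j \<and> (hi(i := d')) j \<le> b j"
        using c'd' 1(1,3) 2(1,3) cd(1,3) lohi(2) ablohi by auto
      then obtain z where z: "\<forall>j\<in>insert i S. (lo(i := c')) j < z j \<and> z j < (hi(i := d')) j"
        "P (override_on e z (insert i S))"
        using insert.prems(2) unfolding dense_box_def by blast
      have "override_on e z (insert i S) = override_on (e(i := z i)) z S"
        by (simp add: override_on_insert')
      moreover have "\<forall>j\<in>S. lo j \<le> override_on (e(i := z i)) z S j \<and> override_on (e(i := z i)) z S j \<le> hi j"
        using z(1) S(2) by (auto simp: override_on_def less_imp_le split: if_splits)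
      ultimately have "?P (e(i := z i))" using z(2) unfolding ex_on_def by metis
      thus "\<exists>x. c' < x \<and> x < d' \<and> ?P (e(i := x))" using z(1) by auto
    qed
    from ds_dense_interval[OF dsP 2(2) this] obtain c3 d3 where 3: "c2 \<le> c3" "c3 < d3" "d3 \<le> d2"
      "\<And>y. c3 < y \<Longrightarrow> y < d3 \<Longrightarrow> ?P (e(i := y))" by blast
    obtain y where y: "c3 < y" "y < d3" "?near y"
      using dense_betweenD[OF dn 3(1,2,3)] by blast
    obtain z where z: "P (override_on (e(i := y)) z S)"
      "\<forall>j\<in>S. lo j \<le> override_on (e(i := y)) z S j \<and> override_on (e(i := y)) z S j \<le> hi j"
      using 3(4)[OF y(1,2)] unfolding ex_on_def by blast
    have "\<forall>j\<in>S. w j + \<delta> < z j \<and> z j < w j + 3 * \<delta>"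
      using z(2) lohi by (auto intro: less_le_trans le_less_trans)
    thus ?thesis using sel[OF y(3)] z(1) by blast
  qed
qed

section \<open>Exchanging quantifiers\<close>

lemma dterm_fun:
  assumes "dpred (\<lambda>e. e 0 = f (e 1))" "dterm T"
  shows "dterm (\<lambda>e. f (T e))"
  using dterm_subst2[of "\<lambda>x _. f x", OF assms(1,2,2)] .

section \<open>Intermediate values and generic continuity of definable functions\<close>

lemma definable_IVT:
  assumes f: "dpred (\<lambda>e. e 0 = f (e 1))"
    and cont: "\<And>y \<epsilon>. y1 \<le> y \<Longrightarrow> y \<le> y2 \<Longrightarrow> \<epsilon> > 0 \<Longrightarrow>
      \<exists>\<delta>>0. \<forall>y'. y1 \<le> y' \<and> y' \<le> y2 \<and> \<bar>y' - y\<bar> < \<delta> \<longrightarrow> \<bar>f y' - f y\<bar> < \<epsilon>"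
    and "y1 < y2" "f y1 < z" "z < f y2"
  shows "\<exists>y. y1 \<le> y \<and> y \<le> y2 \<and> f y = z"
proof -
  define X where "X = (\<lambda>y. y1 \<le> y \<and> y \<le> y2 \<and> f y \<le> z)"
  have "dpred (\<lambda>e. X (e 0))" unfolding X_def by (intro dterm_fun[OF f] dintros)
  moreover have "X y1" using assms unfolding X_def by auto
  moreover have "y \<le> y2" if "X y" for y using that unfolding X_def by blast
  ultimately have "\<exists>s. (\<forall>x. X x \<longrightarrow> x \<le> s) \<and> (\<forall>c. (\<forall>x. X x \<longrightarrow> x \<le> c) \<longrightarrow> s \<le> c)"
    by (rule definable_sup)
  then obtain s where s: "\<And>x. X x \<Longrightarrow> x \<le> s" "\<forall>c. (\<forall>x. X x \<longrightarrow> x \<le> c) \<longrightarrow> s \<le> c" by blast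
  have range: "y1 \<le> s" "s \<le> y2" using s \<open>X y1\<close> unfolding X_def by auto
  have "f s = z"
  proof (rule linorder_cases)
    assume "f s < z"
    hence "z - f s > 0" by simp
    then obtain \<delta> where \<delta>: "\<delta> > 0" "\<forall>y'. y1 \<le> y' \<and> y' \<le> y2 \<and> \<bar>y' - s\<bar> < \<delta> \<longrightarrow> \<bar>f y' - f s\<bar> < z - f s"
      using cont[OF range] by blast
    have "s < y2" using range \<open>f s < z\<close> \<open>z < f y2\<close> by (metis less_asym order_le_imp_less_or_eq)
    hence "s < min y2 (s + \<delta>)" using \<delta>(1) by simp
    then obtain y where y: "s < y" "y < min y2 (s + \<delta>)" using dense by blast
    hence "\<bar>f y - f s\<bar> < z - f s" using \<delta>(2) range by auto
    hence "X y" using y range unfolding X_def by auto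
    thus ?thesis using s(1) y(1) by (meson not_le)
  next
    assume "z < f s"
    hence "f s - z > 0" by simp
    then obtain \<delta> where \<delta>: "\<delta> > 0" "\<forall>y'. y1 \<le> y' \<and> y' \<le> y2 \<and> \<bar>y' - s\<bar> < \<delta> \<longrightarrow> \<bar>f y' - f s\<bar> < f s - z"
      using cont[OF range] by blast
    have "\<not> s \<le> s - \<delta>" using \<delta>(1) by simp
    then obtain y where y: "X y" "s - \<delta> < y" using s(2) by (meson not_le)
    hence "\<bar>f y - f s\<bar> < f s - z" using \<delta>(2) s(1)[OF y(1)] unfolding X_def by auto
    thus ?thesis using y(1) unfolding X_def by (auto simp: abs_less_iff)
  qed
  thus ?thesis using range by blast
qed

text \<open>Dense discontinuities would, by Baire, have a common lower bound \<open>1 / t\<close>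
  for their oscillation. On a suitable interval the values are densely close to some
  \<open>w\<close>; semicontinuity bounds them above throughout and below near one point, so the
  oscillation is smaller.\<close>

lemma lsc_continuous_on_interval:
  assumes f: "dpred (\<lambda>e. e 0 = f (e 1))" and "a < b"
    and bnd: "\<And>y. a < y \<Longrightarrow> y < b \<Longrightarrow> \<alpha> \<le> f y \<and> f y \<le> \<beta>"
    and lsc: "\<And>y s. a < y \<Longrightarrow> y < b \<Longrightarrow> s < f y \<Longrightarrow> \<exists>\<delta>>0. \<forall>y'. a < y' \<and> y' < b \<and> \<bar>y' - y\<bar> < \<delta> \<longrightarrow> s < f y'"
  shows "\<exists>c d. a \<le> c \<and> c < d \<and> d \<le> b \<and> (\<forall>y \<epsilon>. c < y \<and> y < d \<and> \<epsilon> > 0 \<longrightarrow>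
    (\<exists>\<delta>>0. \<forall>y'. a < y' \<and> y' < b \<and> \<bar>y' - y\<bar> < \<delta> \<longrightarrow> \<bar>f y' - f y\<bar> < \<epsilon>))"
proof -
  \<comment> \<open>The oscillation of \<open>f\<close> at \<open>y\<close> is at least
    \<open>1 / t\<close>.\<close>
  define D where "D = (\<lambda>t y. 0 < t \<and> (\<forall>\<delta>. \<delta> > 0 \<longrightarrow> (\<exists>y' y''. a < y' \<and> y' < b \<and> \<bar>y' - y\<bar> < \<delta> \<and>
    a < y'' \<and> y'' < b \<and> \<bar>y'' - y\<bar> < \<delta> \<and> f y' + 1 / t \<le> f y'')))"
  have Dd: "dpred (\<lambda>e. D (e 0) (e 1))"
    unfolding D_def by (intro dterm_fun[OF f] dintros)
  have Dm: "D t y" if st: "D s y" "s \<le> t" for s t y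
  proof -
    have "0 < s" using st unfolding D_def by blast
    hence "1 / t \<le> 1 / s" using st(2) by (simp add: frac_le)
    hence "x + 1 / t \<le> x + 1 / s" for x by simp
    thus ?thesis using st \<open>0 < s\<close> unfolding D_def by (meson order_trans less_le_trans)
  qed
  have "\<not> dense_between (\<lambda>y. \<exists>t. D t y) a b"
  proof
    assume dn: "dense_between (\<lambda>y. \<exists>t. D t y) a b"
    have "\<exists>t c d. a \<le> c \<and> c < d \<and> d \<le> b \<and> dense_between (D t) c d"
      by (rule baire[OF Dd _ \<open>a < b\<close> dn]) (rule Dm)
    then obtain t c d where 1: "a \<le> c" "c < d" "d \<le> b" "dense_between (D t) c d" by blast
    have t: "t > 0" using dense_betweenD[OF 1(4) order_refl 1(2) order_refl] unfolding D_def by blast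
    define \<delta> where "\<delta> = 1 / (4 * t)"
    have \<delta>: "\<delta> > 0" "1 / t = 4 * \<delta>" using t by (auto simp: \<delta>_def)
    have "dense_between (\<lambda>y. \<exists>u. \<alpha> \<le> u \<and> u \<le> \<beta> \<and> u = f y) c d"
      by (rule dense_between_all) (use bnd 1 in auto)
    from uniform_selection_1[of "\<lambda>u y. u = f y", OF f \<delta>(1) 1(2) this]
    obtain w c' d' where 2: "c \<le> c'" "c' < d'" "d' \<le> d" and
      dn': "dense_between (\<lambda>y. \<exists>u. \<bar>u - w\<bar> \<le> \<delta> \<and> \<alpha> \<le> u \<and> u \<le> \<beta> \<and> u = f y) c' d'" by blast
    have range: "a < y" "y < b" if "c' < y" "y < d'" for y using that 1 2 by auto
    \<comment> \<open>A larger value would persist on a neighbourhood, which contains points with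
      values within \<delta> of \<open>w\<close>.\<close>
    have upper: "f y \<le> w + \<delta>" if y: "c' < y" "y < d'" for y
    proof (rule ccontr)
      assume "\<not> f y \<le> w + \<delta>"
      then obtain \<eta> where \<eta>: "\<eta> > 0" "\<forall>y'. a < y' \<and> y' < b \<and> \<bar>y' - y\<bar> < \<eta> \<longrightarrow> w + \<delta> < f y'"
        using lsc[OF range[OF y]] by (meson not_le)
      have "y < min d' (y + \<eta>)" using y \<eta>(1) by simp
      then obtain y' where y': "y < y'" "y' < min d' (y + \<eta>)" "\<bar>f y' - w\<bar> \<le> \<delta>"
        using dense_betweenD[OF dn', of y "min d' (y + \<eta>)"] y by auto
      have "w + \<delta> < f y'" using \<eta>(2) y' range[of y'] y by auto
      thus False using y'(3) by (simp add: abs_le_iff algebra_simps)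
    qed
    obtain y0 where y0: "c' < y0" "y0 < d'" "\<bar>f y0 - w\<bar> \<le> \<delta>"
      using dense_betweenD[OF dn' order_refl 2(2) order_refl] by blast
    have "w - f y0 \<le> \<delta>" using y0(3) by (simp add: abs_le_iff)
    \<comment> \<open>The strict slack is what semicontinuity needs. All values nearby then lie
      above \<open>w - 2 * \<delta>\<close> and at most at \<open>w + \<delta>\<close>, a range
      below \<open>4 * \<delta> = 1 / t\<close>.\<close>
    hence "w - 2 * \<delta> < f y0" using \<delta>(1) by (simp add: algebra_simps)
    then obtain \<eta> where \<eta>: "\<eta> > 0" "\<forall>y'. a < y' \<and> y' < b \<and> \<bar>y' - y0\<bar> < \<eta> \<longrightarrow> w - 2 * \<delta> < f y'"
      using lsc range y0 by blast
    have "y0 < min d' (y0 + \<eta>)" using y0 \<eta>(1) by simp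
    then obtain y where y: "y0 < y" "y < min d' (y0 + \<eta>)" "D t y"
      using dense_betweenD[OF 1(4), of y0 "min d' (y0 + \<eta>)"] y0 2 by (auto simp: min.coboundedI1)
    have "min (y - y0) (min d' (y0 + \<eta>) - y) > 0" using y by simp
    then obtain y' y'' where y': "\<bar>y' - y\<bar> < min (y - y0) (min d' (y0 + \<eta>) - y)"
      "\<bar>y'' - y\<bar> < min (y - y0) (min d' (y0 + \<eta>) - y)" "f y' + 1 / t \<le> f y''"
      using y(3) unfolding D_def by blast
    have in_nbhd: "c' < x \<and> x < d' \<and> \<bar>x - y0\<bar> < \<eta>" if "\<bar>x - y\<bar> < min (y - y0) (min d' (y0 + \<eta>) - y)" for x
      using that y0 by (auto simp: abs_less_iff)
    have "f y'' \<le> w + \<delta>" using in_nbhd[OF y'(2)] upper by blast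
    moreover have "w - 2 * \<delta> < f y'" using in_nbhd[OF y'(1)] \<eta>(2) range by blast
    ultimately have "f y'' < f y' + 4 * \<delta>" using \<delta>(1) by (simp add: algebra_simps)
    thus False using y'(3) \<delta>(2) by simp
  qed
  then obtain c d where cd: "a \<le> c" "c < d" "d \<le> b" "\<And>y. c < y \<Longrightarrow> y < d \<Longrightarrow> \<not> (\<exists>t. D t y)"
    by (rule not_dense_betweenE) blast
  have "\<exists>\<delta>>0. \<forall>y'. a < y' \<and> y' < b \<and> \<bar>y' - y\<bar> < \<delta> \<longrightarrow> \<bar>f y' - f y\<bar> < \<epsilon>"
    if y: "c < y" "y < d" "\<epsilon> > 0" for y \<epsilon>
  proof -
    have yab: "a < y" "y < b" using y cd by auto
    have "\<not> D (1 / \<epsilon>) y" using cd(4) y by blast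
    then obtain \<delta> where \<delta>: "\<delta> > 0" "\<And>y' y''. a < y' \<Longrightarrow> y' < b \<Longrightarrow> \<bar>y' - y\<bar> < \<delta> \<Longrightarrow>
        a < y'' \<Longrightarrow> y'' < b \<Longrightarrow> \<bar>y'' - y\<bar> < \<delta> \<Longrightarrow> \<not> f y' + \<epsilon> \<le> f y''"
      using y(3) unfolding D_def by auto
    have "\<bar>f y' - f y\<bar> < \<epsilon>" if y': "a < y'" "y' < b" "\<bar>y' - y\<bar> < \<delta>" for y'
      using \<delta>(2)[OF y' yab] \<delta>(2)[OF yab _ y'] \<delta>(1) by (simp add: abs_less_iff not_le algebra_simps)
    thus ?thesis using \<delta>(1) by blast
  qed
  thus ?thesis using cd(1-3) by blast
qed

text \<open>
  The least admissible value of the quantified variable is a lower semicontinuous function of the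
  other one, hence continuous on an interval, where it is either constant or onto an interval.
\<close>

lemma gen_ex_at:
  assumes P: "ds P" and jv: "j \<noteq> v" and g: "gen v (ex_at j P) e"
  shows "ex_at j (gen v P) e \<or> gen j (ex_at v P) e"
proof -
  obtain Q where Q: "ds_family Q" "P = (\<lambda>e. \<exists>t. Q t e)"
    using P unfolding ds_def fun_eq_iff by blast
  note QD = ds_familyD[OF Q(1)]
  obtain a0 b0 where ab0: "a0 < b0" "\<And>y. a0 < y \<Longrightarrow> y < b0 \<Longrightarrow> ex_at j P (e(v := y))"
    using g unfolding gen_def by blast
  have "dense_between (\<lambda>y. \<exists>t x. 0 - t \<le> x \<and> x \<le> t \<and> Q t (e(v := y, j := x))) a0 b0"
    using ab0(2) unfolding Q(2) ds_family_ex_at(2)[OF Q(1)] by (rule dense_between_all)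
  \<comment> \<open>Fixing one index \<open>t\<close> on a subinterval makes the admissible values
    of variable \<open>j\<close> closed and bounded, so a least one exists.\<close>
  from family_dense[OF ds_family_ex_at(1)[OF Q(1)] ab0(1) this] obtain t a b where ab: "a < b"
    "\<And>y. a < y \<Longrightarrow> y < b \<Longrightarrow> \<exists>x. 0 - t \<le> x \<and> x \<le> t \<and> Q t (e(v := y, j := x))" by blast
  define B where "B = (\<lambda>x y. 0 - t \<le> x \<and> x \<le> t \<and> Q t (e(v := y, j := x)))"
  have Bd: "dpred (\<lambda>e. B (e 0) (e 1))" unfolding B_def by (intro dpred_family[OF Q(1)] dintros)
  have Bclosed: "closed_pred (\<lambda>e'. \<exists>x. 0 - t \<le> x \<and> x \<le> s \<and> Q t (e'(j := x)))" for s
    by (intro closed_ex_between QD dpred_family[OF Q(1)] dintros)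
  define F where "F = (\<lambda>x y. B x y \<and> (\<forall>x'. B x' y \<longrightarrow> x \<le> x'))"
  have F_ex: "\<exists>x. F x y" if y: "a < y" "y < b" for y
  proof -
    obtain x0 where x0: "B x0 y" using ab(2)[OF y] unfolding B_def by blast
    have "dpred (\<lambda>e. B (e 0) y)" by (intro dpred_subst2[OF Bd] dintros)
    moreover note x0
    moreover have "0 - t \<le> x" if "B x y" for x using that unfolding B_def by blast
    moreover have "B x y" if lim: "limit_of (\<lambda>x. B x y) x" for x
      unfolding B_def
    proof (intro conjI closed_pred_limit[OF QD(1)])
      show "limit_of (\<lambda>x. Q t (e(v := y, j := x))) x" using lim unfolding limit_of_def B_def by blast
      show "0 - t \<le> x" "x \<le> t" using limit_of_bounds[OF lim] unfolding B_def by blast+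
    qed
    ultimately show ?thesis
      by (rule closed_has_min[of "\<lambda>x. B x y"]) (auto simp: F_def)
  qed
  \<comment> \<open>The default 0 outside the interval makes \<open>f\<close> a total function whose
    graph is definable.\<close>
  define f where "f = (\<lambda>y. if a < y \<and> y < b then THE x. F x y else 0)"
  have F_unique: "F x y \<Longrightarrow> F x' y \<Longrightarrow> x = x'" for x x' y unfolding F_def by (meson order.antisym)
  have fF: "F x y \<longleftrightarrow> x = f y" if y: "a < y" "y < b" for x y
  proof -
    obtain x0 where x0: "F x0 y" using F_ex[OF y] by blast
    hence "f y = x0" using y F_unique unfolding f_def by (auto intro: the_equality)
    thus ?thesis using x0 F_unique by blast
  qed
  have fB: "B (f y) y" "\<And>x. B x y \<Longrightarrow> f y \<le> x" if "a < y" "y < b" for y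
    using fF[OF that, of "f y"] unfolding F_def by auto
  have fd: "dpred (\<lambda>e. e 0 = f (e 1))"
  proof -
    have "dpred (\<lambda>e. (a < e 1 \<and> e 1 < b \<and> F (e 0) (e 1)) \<or> (\<not> (a < e 1 \<and> e 1 < b) \<and> e 0 = 0))"
      unfolding F_def by (intro dpred_subst2[OF Bd] dintros)
    moreover have "((a < y \<and> y < b \<and> F x y) \<or> (\<not> (a < y \<and> y < b) \<and> x = 0)) \<longleftrightarrow> x = f y" for x y
      using fF[of y x] by (auto simp: f_def)
    ultimately show ?thesis by simp
  qed
  have bnd: "0 - t \<le> f y \<and> f y \<le> t" if "a < y" "y < b" for y
    using fB(1)[OF that] unfolding B_def by blast
  have lsc: "\<exists>\<delta>>0. \<forall>y'. a < y' \<and> y' < b \<and> \<bar>y' - y\<bar> < \<delta> \<longrightarrow> s < f y'"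
    if y: "a < y" "y < b" "s < f y" for y s
  proof -
    \<comment> \<open>The points \<open>y\<close> with an admissible value at most \<open>s\<close>
      form a closed set by the tube lemma; this is the semicontinuity of \<open>f\<close>.\<close>
    have "\<not> (\<exists>x. 0 - t \<le> x \<and> x \<le> s \<and> Q t ((e(v := y))(j := x)))"
    proof
      assume "\<exists>x. 0 - t \<le> x \<and> x \<le> s \<and> Q t (e(v := y, j := x))"
      then obtain x where x: "0 - t \<le> x" "x \<le> s" "Q t (e(v := y, j := x))" by blast
      have "x \<le> t" using x(2) y(3) bnd[OF y(1,2)] by auto
      hence "f y \<le> x" using fB(2)[OF y(1,2)] x unfolding B_def by blast
      thus False using x(2) y(3) by simp
    qed
    then obtain \<delta> where \<delta>: "\<delta> > 0" "\<And>e'. (\<And>i. \<bar>e' i - (e(v := y)) i\<bar> < \<delta>) \<Longrightarrow>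
        \<not> (\<exists>x. 0 - t \<le> x \<and> x \<le> s \<and> Q t (e'(j := x)))"
      using closed_predE[OF Bclosed[of s]] by metis
    have "s < f y'" if y': "a < y'" "y' < b" "\<bar>y' - y\<bar> < \<delta>" for y'
    proof (rule ccontr)
      assume "\<not> s < f y'"
      hence "\<exists>x. 0 - t \<le> x \<and> x \<le> s \<and> Q t ((e(v := y'))(j := x))"
        using fB(1)[OF y'(1,2)] unfolding B_def by (intro exI[of _ "f y'"]) auto
      moreover have "\<not> (\<exists>x. 0 - t \<le> x \<and> x \<le> s \<and> Q t ((e(v := y'))(j := x)))"
        by (rule \<delta>(2)) (use y'(3) \<delta>(1) in auto)
      ultimately show False by blast
    qed
    thus ?thesis using \<delta>(1) by blast
  qed
  have "\<exists>c d. a \<le> c \<and> c < d \<and> d \<le> b \<and> (\<forall>y \<epsilon>. c < y \<and> y < d \<and> \<epsilon> > 0 \<longrightarrow>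
    (\<exists>\<delta>>0. \<forall>y'. a < y' \<and> y' < b \<and> \<bar>y' - y\<bar> < \<delta> \<longrightarrow> \<bar>f y' - f y\<bar> < \<epsilon>))"
    by (rule lsc_continuous_on_interval[OF fd ab(1) bnd lsc])
  then obtain c d where cd: "a \<le> c" "c < d" "d \<le> b" and
    cont: "\<And>y \<epsilon>. c < y \<Longrightarrow> y < d \<Longrightarrow> \<epsilon> > 0 \<Longrightarrow>
      \<exists>\<delta>>0. \<forall>y'. a < y' \<and> y' < b \<and> \<bar>y' - y\<bar> < \<delta> \<longrightarrow> \<bar>f y' - f y\<bar> < \<epsilon>" by blast
  have range: "a < y" "y < b" if "c < y" "y < d" for y using that cd by auto
  have fP: "P (e(j := f y, v := y))" if "c < y" "y < d" for y
    using fB(1)[OF range[OF that]] fun_upd_twist[OF jv] unfolding B_def Q(2) by metis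
  show ?thesis
  proof (cases "\<exists>y1 y2. c < y1 \<and> y1 < y2 \<and> y2 < d \<and> f y1 \<noteq> f y2")
    case False
    define m where "m = (c + d) / 2"
    have m: "c < m" "m < d" using cd(2) by (auto simp: m_def field_simps)
    have "f y = f m" if "c < y" "y < d" for y
      using False that m by (metis linorder_cases)
    hence "gen v P (e(j := f m))" using fP cd(2) unfolding gen_def by metis
    thus ?thesis unfolding ex_at_def by blast
  next
    case True
    then obtain y1 y2 where y12: "c < y1" "y1 < y2" "y2 < d" "f y1 \<noteq> f y2" by blast
    have cont': "\<exists>\<delta>>0. \<forall>y'. y1 \<le> y' \<and> y' \<le> y2 \<and> \<bar>y' - y\<bar> < \<delta> \<longrightarrow> \<bar>f y' - f y\<bar> < \<epsilon>"
      if y: "y1 \<le> y" "y \<le> y2" "\<epsilon> > 0" for y \<epsilon>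
    proof -
      obtain \<delta> where "\<delta> > 0" "\<forall>y'. a < y' \<and> y' < b \<and> \<bar>y' - y\<bar> < \<delta> \<longrightarrow> \<bar>f y' - f y\<bar> < \<epsilon>"
        using cont[of y \<epsilon>] y y12 by auto
      thus ?thesis using y12 cd by (intro exI[of _ \<delta>]) auto
    qed
    have onto: "\<exists>y. y1 \<le> y \<and> y \<le> y2 \<and> f y = z" if z: "min (f y1) (f y2) < z" "z < max (f y1) (f y2)" for z
    proof (cases "f y1 < f y2")
      case True
      thus ?thesis using z by (intro definable_IVT[OF fd cont' y12(2)]) auto
    next
      case False
      \<comment> \<open>When the left value is the larger one, the intermediate value property is
        applied to the reflected function.\<close>
      have "dpred (\<lambda>e. e 0 = 0 - f (e 1))" by (intro dterm_fun[OF fd] dintros)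
      hence "\<exists>y. y1 \<le> y \<and> y \<le> y2 \<and> 0 - f y = 0 - z"
      proof (rule definable_IVT[where f = "\<lambda>y. 0 - f y"])
        show "\<exists>\<delta>>0. \<forall>y'. y1 \<le> y' \<and> y' \<le> y2 \<and> \<bar>y' - y\<bar> < \<delta> \<longrightarrow> \<bar>0 - f y' - (0 - f y)\<bar> < \<epsilon>"
          if "y1 \<le> y" "y \<le> y2" "\<epsilon> > 0" for y \<epsilon>
          using cont'[OF that] by (simp add: abs_minus_commute)
      qed (use y12 False z in auto)
      thus ?thesis by auto
    qed
    have "ex_at v P (e(j := z))" if z: "min (f y1) (f y2) < z" "z < max (f y1) (f y2)" for z
    proof -
      obtain y where "y1 \<le> y" "y \<le> y2" "f y = z" using onto[OF z] by blast
      hence "P (e(j := z, v := y))" using fP[of y] y12 by auto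
      thus ?thesis unfolding ex_at_def by blast
    qed
    moreover have "min (f y1) (f y2) < max (f y1) (f y2)" using y12(4) by auto
    ultimately show ?thesis unfolding gen_def by blast
  qed
qed

section \<open>Rearranging boxes and existential quantifiers\<close>

lemma box_on_union:
  assumes "ds P" "finite T" "finite S" "S \<inter> T = {}"
  shows "box_on S (box_on T P) = box_on (S \<union> T) P"
  using assms(3,4)
proof (induction S rule: finite_induct)
  case (insert i S)
  thus ?case using assms(1,2) by (simp add: box_on_insert ds_box_on)
qed (simp add: box_on_empty)

lemma gen_mono: "gen i P e \<Longrightarrow> (\<And>e. P e \<Longrightarrow> P' e) \<Longrightarrow> gen i P' e"
  unfolding gen_def by blast

lemma box_on_disj:
  assumes "finite S" "ds P" "ds P'" "box_on S (\<lambda>e. P e \<or> P' e) e"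
  shows "box_on S P e \<or> box_on S P' e"
  using assms(1,4)
proof (induction S arbitrary: e rule: finite_induct)
  case (insert i S)
  have "gen i (box_on S (\<lambda>e. P e \<or> P' e)) e" by (rule box_on_insert_gen[OF insert.prems insert.hyps(2)])
  hence "gen i (\<lambda>e. box_on S P e \<or> box_on S P' e) e" by (rule gen_mono) (rule insert.IH)
  hence "gen i (box_on S P) e \<or> gen i (box_on S P') e"
    by (rule gen_disj[OF ds_box_on[OF insert.hyps(1) assms(2)]])
  thus ?case using insert.hyps assms(2,3) by (simp add: box_on_insert)
qed (simp add: box_on_empty)

lemma ds_bex: "finite J \<Longrightarrow> (\<And>j. j \<in> J \<Longrightarrow> ds (P j)) \<Longrightarrow> ds (\<lambda>e. \<exists>j\<in>J. P j e)"
  by (induction J rule: finite_induct)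
     (simp_all add: ds_disj ds_closed dpred_const closed_pred_const)

text \<open>A finite union has interior only through one of its members. The empty union is excluded
  because a box contains a point.\<close>

lemma box_on_bex:
  assumes "finite J" "\<And>j. j \<in> J \<Longrightarrow> ds (P j)" "finite S" "box_on S (\<lambda>e. \<exists>j\<in>J. P j e) e"
  shows "\<exists>j\<in>J. box_on S (P j) e"
  using assms(1,2,4)
proof (induction J rule: finite_induct)
  case empty
  thus ?case by (auto elim: box_on_nonempty)
next
  case (insert k J)
  have "box_on S (\<lambda>e. P k e \<or> (\<exists>j\<in>J. P j e)) e" using insert.prems by simp
  hence "box_on S (P k) e \<or> box_on S (\<lambda>e. \<exists>j\<in>J. P j e) e"
    using insert.prems insert.hyps by (intro box_on_disj assms(3) ds_bex) auto
  thus ?case using insert by auto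
qed

text \<open>The interval quantifier on \<open>v\<close> passes the existential ones singly by
  \<open>gen_ex_at\<close>. Either it gets through all of them, or some \<open>j\<close> takes over
  the interval and \<open>v\<close> becomes existential; quantifiers passed before that are brought
  back inside by \<open>ex_at_gen\<close>.\<close>

lemma gen_ex_on:
  assumes "ds P" "finite J" "v \<notin> J" "gen v (ex_on J P) e"
  shows "ex_on J (gen v P) e \<or> (\<exists>j\<in>J. gen j (ex_on (J - {j}) (ex_at v P)) e)"
  using assms(2-)
proof (induction J arbitrary: e rule: finite_induct)
  case empty
  thus ?case by (simp add: ex_on_empty)
next
  case (insert j J)
  have jv: "j \<noteq> v" "v \<notin> J" using insert.prems by auto
  from insert.prems(2) have "gen v (ex_at j (ex_on J P)) e" by (simp add: ex_on_insert)
  hence "ex_at j (gen v (ex_on J P)) e \<or> gen j (ex_at v (ex_on J P)) e"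
    by (rule gen_ex_at[OF ds_ex_on[OF insert.hyps(1) assms(1)] jv(1)])
  thus ?case
  proof
    assume "gen j (ex_at v (ex_on J P)) e"
    moreover have "ex_at v (ex_on J P) = ex_on J (ex_at v P)"
      by (metis ex_on_insert ex_on_insert')
    ultimately show ?thesis using insert.hyps by auto
  next
    assume "ex_at j (gen v (ex_on J P)) e"
    then obtain x where "gen v (ex_on J P) (e(j := x))" unfolding ex_at_def by blast
    from insert.IH[OF jv(2) this] show ?thesis
    proof
      assume "ex_on J (gen v P) (e(j := x))"
      thus ?thesis unfolding ex_on_insert ex_at_def by blast
    next
      assume "\<exists>k\<in>J. gen k (ex_on (J - {k}) (ex_at v P)) (e(j := x))"
      then obtain k where k: "k \<in> J" "ex_at j (gen k (ex_on (J - {k}) (ex_at v P))) e"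
        unfolding ex_at_def[of j] by blast
      have "j \<noteq> k" using k insert.hyps by auto
      hence "gen k (ex_at j (ex_on (J - {k}) (ex_at v P))) e" using ex_at_gen k by blast
      moreover have "insert j J - {k} = insert j (J - {k})" using \<open>j \<noteq> k\<close> by auto
      ultimately have "gen k (ex_on (insert j J - {k}) (ex_at v P)) e" by (simp add: ex_on_insert)
      thus ?thesis using k by blast
    qed
  qed
qed

text \<open>A box in mixed variables becomes a box in variables of \<open>N\<close> whose fibers
  contain boxes in variables of \<open>M\<close>. The index sets may change, since variables trade
  quantifiers; the total cardinality is kept. The variables of \<open>M\<close> are treated one at a
  time.\<close>

lemma box_on_fiber_split:
  assumes "finite M" "finite N" "N \<inter> M = {}" "S \<subseteq> N" "T \<subseteq> M" "ds P"
    and "box_on (S \<union> T) (ex_on ((N \<union> M) - (S \<union> T)) P) e"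
  shows "\<exists>S' T'. S' \<subseteq> N \<and> T' \<subseteq> M \<and> card S' + card T' = card S + card T \<and>
    box_on S' (ex_on (N - S') (box_on T' (ex_on (M - T') P))) e"
  using assms
proof (induction M arbitrary: S T P rule: finite_induct)
  case empty
  hence "T = {}" "N - S = (N \<union> {}) - (S \<union> T)" by auto
  thus ?case using empty
    by - (rule exI[of _ S], rule exI[of _ "{}"], simp add: box_on_empty ex_on_empty)
next
  case (insert v M)
  have vN: "v \<notin> N" "v \<notin> M" "N \<inter> M = {}" using insert by auto
  note finN = \<open>finite N\<close> and S = \<open>S \<subseteq> N\<close> and P = \<open>ds P\<close>
  have finS: "finite S" using finN S finite_subset by blast
  \<comment> \<open>All situations with \<open>v\<close> existential: it is absorbed into the
    predicate. This applies when \<open>v\<close> is outside \<open>T\<close>, and after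
    \<open>v\<close> has traded its interval with some \<open>j\<close> in \<open>N\<close> or in
    \<open>M\<close>.\<close>
  have ex_v: ?case if S1: "S1 \<subseteq> N" "T1 \<subseteq> M" "card S1 + card T1 = card S + card T"
      "box_on (S1 \<union> T1) (ex_on ((N \<union> M) - (S1 \<union> T1)) (ex_at v P)) e" for S1 T1
  proof -
    obtain S' T' where *: "S' \<subseteq> N" "T' \<subseteq> M" "card S' + card T' = card S + card T"
      "box_on S' (ex_on (N - S') (box_on T' (ex_on (M - T') (ex_at v P)))) e"
      using insert.IH[OF finN vN(3) S1(1,2) ds_ex_at[OF P] S1(4)] S1(3) by metis
    have "insert v M - T' = insert v (M - T')" using *(2) vN by auto
    hence "ex_on (insert v M - T') P = ex_on (M - T') (ex_at v P)" by (simp add: ex_on_insert')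
    thus ?thesis using * by - (rule exI[of _ S'], rule exI[of _ T'], auto)
  qed
  show ?case
  proof (cases "v \<in> T")
    case False
    hence TM: "T \<subseteq> M" using insert.prems by auto
    have "(N \<union> insert v M) - (S \<union> T) = insert v ((N \<union> M) - (S \<union> T))" using False S vN by auto
    hence "box_on (S \<union> T) (ex_on ((N \<union> M) - (S \<union> T)) (ex_at v P)) e"
      using insert.prems(6) by (simp add: ex_on_insert')
    thus ?thesis by (intro ex_v[OF S TM]) auto
  next
    case True
    define T0 where "T0 = T - {v}"
    have T0: "T0 \<subseteq> M" "T = insert v T0" "v \<notin> T0" using True insert.prems by (auto simp: T0_def)
    have finT0: "finite T0" using T0(1) insert.hyps finite_subset by blast
    define J where "J = (N \<union> M) - (S \<union> T0)"
    have J: "(N \<union> insert v M) - (S \<union> T) = J" "v \<notin> J" "finite J"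
      using vN T0 insert.hyps finN unfolding J_def by auto
    have "S \<union> T = (S \<union> T0) \<union> {v}" "v \<notin> S \<union> T0" using T0 S vN by auto
    hence "box_on (S \<union> T0) (gen v (ex_on J P)) e"
      using insert.prems(6) J(1) finS finT0 box_on_union[OF ds_ex_on[OF J(3) P], of "{v}" "S \<union> T0"]
      by (simp add: box_on_single)
    hence "box_on (S \<union> T0) (\<lambda>e. ex_on J (gen v P) e \<or> (\<exists>j\<in>J. gen j (ex_on (J - {j}) (ex_at v P)) e)) e"
      by (rule box_on_mono) (rule gen_ex_on[OF P J(3,2)])
    hence "box_on (S \<union> T0) (ex_on J (gen v P)) e \<or>
        box_on (S \<union> T0) (\<lambda>e. \<exists>j\<in>J. gen j (ex_on (J - {j}) (ex_at v P)) e) e"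
      using finS finT0 J P by (intro box_on_disj ds_bex ds_gen ds_ex_on ds_ex_at) auto
    thus ?thesis
    proof
      \<comment> \<open>The interval of \<open>v\<close> has reached the innermost place, so
        induction applies to \<open>gen v P\<close>; afterwards \<open>v\<close> rejoins the inner
        box.\<close>
      assume "box_on (S \<union> T0) (ex_on J (gen v P)) e"
      then obtain S' T' where *: "S' \<subseteq> N" "T' \<subseteq> M" "card S' + card T' = card S + card T0"
        "box_on S' (ex_on (N - S') (box_on T' (ex_on (M - T') (gen v P)))) e"
        using insert.IH[OF finN vN(3) S T0(1) ds_gen[OF P]] unfolding J_def by metis
      have fin: "finite T'" "finite S'" using * insert.hyps finN finite_subset by blast+
      have vT': "v \<notin> T'" using * vN by auto
      have "box_on T' (ex_on (M - T') (gen v P)) e' \<Longrightarrow> box_on (insert v T') (ex_on (insert v M - insert v T') P) e'" for e'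
      proof -
        assume "box_on T' (ex_on (M - T') (gen v P)) e'"
        hence "box_on T' (gen v (ex_on (M - T') P)) e'"
          by (rule box_on_mono) (use ex_on_box[of "M - T'" "{v}" P] vN in \<open>auto simp: box_on_single\<close>)
        hence "box_on (T' \<union> {v}) (ex_on (M - T') P) e'"
          using box_on_union[of "ex_on (M - T') P" "{v}" T'] fin vT' P insert.hyps
          by (simp add: box_on_single ds_ex_on)
        moreover have "insert v M - insert v T' = M - T'" using vN by auto
        ultimately show ?thesis by simp
      qed
      hence "box_on S' (ex_on (N - S') (box_on (insert v T') (ex_on (insert v M - insert v T') P))) e"
        by (intro box_on_mono[OF *(4)]) (auto simp: ex_on_def)
      moreover have "card S' + card (insert v T') = card S + card T"
        using * fin vT' T0 finT0 by simp
      ultimately show ?thesis using *(1,2)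
        by - (rule exI[of _ S'], rule exI[of _ "insert v T'"], auto)
    next
      assume "box_on (S \<union> T0) (\<lambda>e. \<exists>j\<in>J. gen j (ex_on (J - {j}) (ex_at v P)) e) e"
      hence "\<exists>j\<in>J. box_on (S \<union> T0) (gen j (ex_on (J - {j}) (ex_at v P))) e"
        using finS finT0 J P by (intro box_on_bex ds_gen ds_ex_on ds_ex_at) auto
      then obtain j where j: "j \<in> J" "box_on (S \<union> T0) (gen j (ex_on (J - {j}) (ex_at v P))) e" by blast
      have jn: "j \<notin> S \<union> T0" using j unfolding J_def by auto
      \<comment> \<open>The variable \<open>j\<close> has replaced \<open>v\<close> in the box, so
        the number of box variables is unchanged.\<close>
      have bj: "box_on (S \<union> T0 \<union> {j}) (ex_on (J - {j}) (ex_at v P)) e"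
        using box_on_union[of "ex_on (J - {j}) (ex_at v P)" "{j}" "S \<union> T0"] j(2) jn finS finT0 P J(3)
        by (simp add: box_on_single ds_ex_on ds_ex_at)
      show ?thesis
      proof (cases "j \<in> N")
        case True
        have eq: "insert j S \<union> T0 = S \<union> T0 \<union> {j}" "(N \<union> M) - (S \<union> T0 \<union> {j}) = J - {j}"
          unfolding J_def by auto
        show ?thesis
          by (rule ex_v[of "insert j S" T0]) (use True S T0 jn finS finT0 bj eq in auto)
      next
        case False
        have eq: "S \<union> insert j T0 = S \<union> T0 \<union> {j}" "(N \<union> M) - (S \<union> T0 \<union> {j}) = J - {j}"
          unfolding J_def by auto
        have "j \<in> M" using j False unfolding J_def by auto
        thus ?thesis
          by (intro ex_v[of S "insert j T0"]) (use False S T0 jn finS finT0 bj eq in auto)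
      qed
    qed
  qed
qed

end

section \<open>Dimension\<close>

lemma openin_pow_top_iff:
  fixes U :: "(nat \<Rightarrow> 'a::{linordered_field, linorder_topology}) set"
  assumes "U \<subseteq> pow_space n"
  shows "openin (pow_top n) U \<longleftrightarrow>
    (\<forall>x\<in>U. \<exists>\<delta>>0. \<forall>y\<in>pow_space n. (\<forall>i<n. \<bar>y i - x i\<bar> < \<delta>) \<longrightarrow> y \<in> U)"
proof
  assume open_U: "openin (pow_top n) U"
  show "\<forall>x\<in>U. \<exists>\<delta>>0. \<forall>y\<in>pow_space n. (\<forall>i<n. \<bar>y i - x i\<bar> < \<delta>) \<longrightarrow> y \<in> U"
  proof
    fix x assume "x \<in> U"
    then obtain V where V: "\<forall>i\<in>{..<n}. openin euclidean (V i)" "x \<in> Pi\<^sub>E {..<n} V" "Pi\<^sub>E {..<n} V \<subseteq> U"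
      using open_U unfolding openin_product_topology_alt by meson
    have "\<exists>\<delta>>0. \<forall>y. \<bar>y - x i\<bar> < \<delta> \<longrightarrow> y \<in> V i" if "i < n" for i
      using V(1,2) that open_iff_abs[of "V i"] by (auto simp: PiE_iff)
    then obtain \<delta> where \<delta>: "\<And>i. i < n \<Longrightarrow> \<delta> i > 0 \<and> (\<forall>y. \<bar>y - x i\<bar> < \<delta> i \<longrightarrow> y \<in> V i)" by metis
    define d where "d = Min (insert 1 (\<delta> ` {..<n}))"
    have "d > 0" unfolding d_def using \<delta> by (subst Min_gr_iff) auto
    moreover have "y \<in> U" if y: "y \<in> pow_space n" "\<forall>i<n. \<bar>y i - x i\<bar> < d" for y
    proof -
      have "d \<le> \<delta> i" if "i < n" for i unfolding d_def using that by (intro Min_le) auto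
      hence "y i \<in> V i" if "i < n" for i using that y(2) \<delta>[OF that] by (meson less_le_trans)
      hence "y \<in> Pi\<^sub>E {..<n} V" using y(1) by (simp add: PiE_iff)
      thus ?thesis using V(3) by blast
    qed
    ultimately show "\<exists>\<delta>>0. \<forall>y\<in>pow_space n. (\<forall>i<n. \<bar>y i - x i\<bar> < \<delta>) \<longrightarrow> y \<in> U" by blast
  qed
next
  assume nbhd: "\<forall>x\<in>U. \<exists>\<delta>>0. \<forall>y\<in>pow_space n. (\<forall>i<n. \<bar>y i - x i\<bar> < \<delta>) \<longrightarrow> y \<in> U"
  show "openin (pow_top n) U"
    unfolding openin_product_topology_alt
  proof
    fix x assume x: "x \<in> U"
    then obtain \<delta> where \<delta>: "\<delta> > 0" "\<And>y. y \<in> pow_space n \<Longrightarrow> (\<forall>i<n. \<bar>y i - x i\<bar> < \<delta>) \<Longrightarrow> y \<in> U"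
      using bspec[OF nbhd x] by blast
    let ?V = "\<lambda>i. {x i - \<delta><..<x i + \<delta>}"
    have "x \<in> Pi\<^sub>E {..<n} ?V" using x assms \<delta>(1) by (auto simp: PiE_iff)
    moreover have "Pi\<^sub>E {..<n} ?V \<subseteq> U"
    proof
      fix y assume y: "y \<in> Pi\<^sub>E {..<n} ?V"
      show "y \<in> U"
      proof (rule \<delta>(2))
        show "\<forall>i<n. \<bar>y i - x i\<bar> < \<delta>" using y by (auto simp: PiE_iff abs_less_iff algebra_simps)
      qed (use y in \<open>auto simp: PiE_iff\<close>)
    qed
    ultimately show "\<exists>V. finite {i \<in> {..<n}. V i \<noteq> topspace euclidean} \<and>
        (\<forall>i\<in>{..<n}. openin euclidean (V i)) \<and> x \<in> Pi\<^sub>E {..<n} V \<and> Pi\<^sub>E {..<n} V \<subseteq> U"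
      by (intro exI[of _ ?V]) auto
  qed
qed

lemma closed_pred_closedin:
  fixes Y :: "(nat \<Rightarrow> 'a::{linordered_field, linorder_topology}) set"
  assumes "closedin (pow_top n) Y"
  shows "closed_pred (\<lambda>e. restrict e {..<n} \<in> Y)"
  unfolding closed_pred_def
proof (intro allI impI)
  fix e :: "nat \<Rightarrow> 'a" assume e: "restrict e {..<n} \<notin> Y"
  have "openin (pow_top n) (pow_space n - Y)" using assms by (simp add: closedin_def)
  hence "\<forall>x\<in>pow_space n - Y. \<exists>\<delta>>0. \<forall>y\<in>pow_space n. (\<forall>i<n. \<bar>y i - x i\<bar> < \<delta>) \<longrightarrow> y \<in> pow_space n - Y"
    by (subst (asm) openin_pow_top_iff) auto
  moreover have "restrict e {..<n} \<in> pow_space n - Y" using e by auto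
  ultimately have "\<exists>\<delta>>0. \<forall>y\<in>pow_space n. (\<forall>i<n. \<bar>y i - restrict e {..<n} i\<bar> < \<delta>) \<longrightarrow> y \<in> pow_space n - Y"
    by (rule bspec)
  then obtain \<delta> where \<delta>: "\<delta> > 0"
    "\<And>y. y \<in> pow_space n \<Longrightarrow> \<forall>i<n. \<bar>y i - restrict e {..<n} i\<bar> < \<delta> \<Longrightarrow> y \<in> pow_space n - Y"
    by blast
  have "restrict e' {..<n} \<notin> Y" if "\<forall>i. \<bar>e' i - e i\<bar> < \<delta>" for e'
    using \<delta>(2)[of "restrict e' {..<n}"] that by auto
  thus "\<exists>\<delta>>0. \<forall>e'. (\<forall>i. \<bar>e' i - e i\<bar> < \<delta>) \<longrightarrow> restrict e' {..<n} \<notin> Y" using \<delta>(1) by blast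
qed

section \<open>Dimension expressed by boxes\<close>

abbreviation member_pred :: "nat \<Rightarrow> (nat \<Rightarrow> 'a) set \<Rightarrow> (nat \<Rightarrow> 'a) \<Rightarrow> bool" where
  "member_pred n A \<equiv> \<lambda>e. restrict e {..<n} \<in> A"

text \<open>The right-hand side does not mention \<open>e\<close>: every coordinate of the point is
  quantified. This is why an arbitrary base assignment such as \<open>undefined\<close> can be used
  for dimensions.\<close>

lemma box_on_member_iff:
  fixes A :: "(nat \<Rightarrow> 'a::linorder) set"
  assumes "A \<subseteq> pow_space n" "S \<subseteq> {..<n}"
  shows "box_on S (ex_on ({..<n} - S) (member_pred n A)) e \<longleftrightarrow>
    (\<exists>a b. (\<forall>i\<in>S. a i < b i) \<and> (\<forall>z. (\<forall>i\<in>S. a i < z i \<and> z i < b i) \<longrightarrow> (\<exists>x\<in>A. \<forall>i\<in>S. x i = z i)))"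
proof -
  have "ex_on ({..<n} - S) (member_pred n A) (override_on e z S) \<longleftrightarrow> (\<exists>x\<in>A. \<forall>i\<in>S. x i = z i)" for z
  proof
    assume "ex_on ({..<n} - S) (member_pred n A) (override_on e z S)"
    then obtain x where "restrict (override_on (override_on e z S) x ({..<n} - S)) {..<n} \<in> A"
      unfolding ex_on_def by blast
    moreover have "restrict (override_on (override_on e z S) x ({..<n} - S)) {..<n} i = z i" if "i \<in> S" for i
      using that assms(2) by (auto simp: override_on_def)
    ultimately show "\<exists>x\<in>A. \<forall>i\<in>S. x i = z i" by blast
  next
    assume "\<exists>x\<in>A. \<forall>i\<in>S. x i = z i"
    then obtain x where x: "x \<in> A" "\<forall>i\<in>S. x i = z i" by blast
    have "restrict (override_on (override_on e z S) x ({..<n} - S)) {..<n} = x"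
      using x assms by (intro extensionalityI[of _ "{..<n}"]) (auto simp: override_on_def PiE_def)
    thus "ex_on ({..<n} - S) (member_pred n A) (override_on e z S)" using x(1) unfolding ex_on_def by metis
  qed
  thus ?thesis unfolding box_on_def by simp
qed

text \<open>In the coordinate subspace all coordinates outside \<open>S\<close> are 0, so a relative
  neighbourhood is a box in the coordinates of \<open>S\<close> alone.\<close>

lemma interior_coord_proj_iff:
  fixes A :: "(nat \<Rightarrow> 'a::{linordered_field, linorder_topology}) set"
  assumes "A \<subseteq> pow_space n" "S \<subseteq> {..<n}"
  shows "subtopology (pow_top n) (coord_subspace n S) interior_of (coord_proj n S ` A) \<noteq> {} \<longleftrightarrow>
    box_on S (ex_on ({..<n} - S) (member_pred n A)) e"
  unfolding box_on_member_iff[OF assms]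
proof
  assume "subtopology (pow_top n) (coord_subspace n S) interior_of (coord_proj n S ` A) \<noteq> {}"
  then obtain T where T: "openin (subtopology (pow_top n) (coord_subspace n S)) T"
    "T \<subseteq> coord_proj n S ` A" "T \<noteq> {}" unfolding interior_of_eq_empty by blast
  then obtain W x where W: "openin (pow_top n) W" "W \<inter> coord_subspace n S \<subseteq> coord_proj n S ` A"
    and x: "x \<in> W" "x \<in> coord_subspace n S"
    unfolding openin_subtopology by blast
  have "W \<subseteq> pow_space n" using openin_subset[OF W(1)] by simp
  then obtain \<delta> where \<delta>: "\<delta> > 0" "\<And>y. y \<in> pow_space n \<Longrightarrow> \<forall>i<n. \<bar>y i - x i\<bar> < \<delta> \<Longrightarrow> y \<in> W"
    using openin_pow_top_iff[of W n, THEN iffD1, OF _ W(1), rule_format, OF _ x(1)] by blast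
  have "\<exists>p\<in>A. \<forall>i\<in>S. p i = z i" if z: "\<forall>i\<in>S. x i - \<delta> < z i \<and> z i < x i + \<delta>" for z
  proof -
    let ?y = "\<lambda>i\<in>{..<n}. if i \<in> S then z i else 0"
    have "?y \<in> W"
    proof (rule \<delta>(2))
      show "\<forall>i<n. \<bar>?y i - x i\<bar> < \<delta>"
      proof (intro allI impI)
        fix i assume "i < n"
        thus "\<bar>?y i - x i\<bar> < \<delta>"
          using z x(2) \<delta>(1) by (cases "i \<in> S") (auto simp: coord_subspace_def abs_less_iff algebra_simps)
      qed
    qed simp
    moreover have "?y \<in> coord_subspace n S" by (auto simp: coord_subspace_def)
    ultimately obtain p where p: "p \<in> A" "?y = coord_proj n S p" using W(2) by blast
    have "p i = z i" if "i \<in> S" for i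
      using fun_cong[OF p(2), of i] that assms(2) by (auto simp: coord_proj_def split: if_splits)
    thus ?thesis using p(1) by blast
  qed
  thus "\<exists>a b. (\<forall>i\<in>S. a i < b i) \<and> (\<forall>z. (\<forall>i\<in>S. a i < z i \<and> z i < b i) \<longrightarrow> (\<exists>x\<in>A. \<forall>i\<in>S. x i = z i))"
    using \<delta>(1) by - (rule exI[of _ "\<lambda>i. x i - \<delta>"], rule exI[of _ "\<lambda>i. x i + \<delta>"], auto)
next
  assume "\<exists>a b. (\<forall>i\<in>S. a i < b i) \<and> (\<forall>z. (\<forall>i\<in>S. a i < z i \<and> z i < b i) \<longrightarrow> (\<exists>x\<in>A. \<forall>i\<in>S. x i = z i))"
  then obtain a b where ab: "\<forall>i\<in>S. a i < b i"
    "\<And>z. \<forall>i\<in>S. a i < z i \<and> z i < b i \<Longrightarrow> \<exists>x\<in>A. \<forall>i\<in>S. x i = z i" by blast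
  let ?W = "Pi\<^sub>E {..<n} (\<lambda>i. if i \<in> S then {a i<..<b i} else UNIV)"
  have "openin (pow_top n) ?W" by (subst openin_PiE) auto
  hence "openin (subtopology (pow_top n) (coord_subspace n S)) (?W \<inter> coord_subspace n S)"
    unfolding openin_subtopology by blast
  moreover have "?W \<inter> coord_subspace n S \<subseteq> coord_proj n S ` A"
  proof
    fix y assume y: "y \<in> ?W \<inter> coord_subspace n S"
    have "a i < y i \<and> y i < b i" if "i \<in> S" for i
    proof -
      have "y i \<in> (if i \<in> S then {a i<..<b i} else UNIV)" using y that assms(2) PiE_mem[of y "{..<n}" "\<lambda>i. if i \<in> S then {a i<..<b i} else UNIV" i] by blast
      thus ?thesis using that by simp
    qed
    then obtain x where x: "x \<in> A" "\<forall>i\<in>S. x i = y i" using ab(2) by blast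
    have "y = coord_proj n S x"
      by (rule extensionalityI[of _ "{..<n}"])
         (use x y in \<open>auto simp: coord_proj_def coord_subspace_def PiE_iff extensional_def\<close>)
    thus "y \<in> coord_proj n S ` A" using x(1) by blast
  qed
  moreover have "(\<lambda>i\<in>{..<n}. if i \<in> S then (a i + b i) / 2 else 0) \<in> ?W \<inter> coord_subspace n S"
    using ab(1) by (auto simp: coord_subspace_def PiE_iff)
  ultimately show "subtopology (pow_top n) (coord_subspace n S) interior_of (coord_proj n S ` A) \<noteq> {}"
    unfolding interior_of_eq_empty by blast
qed

context
  fixes n :: nat and A :: "(nat \<Rightarrow> 'a::{linordered_field, linorder_topology}) set"
  assumes A: "A \<subseteq> pow_space n"
begin

private lemma dim_candidates:
  "finite {card S | S. S \<subseteq> {..<n} \<and>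
     subtopology (pow_top n) (coord_subspace n S) interior_of (coord_proj n S ` A) \<noteq> {}}"
  by (rule finite_subset[of _ "card ` Pow {..<n}"]) auto

lemma dim_set_ge:
  assumes "S \<subseteq> {..<n}" "box_on S (ex_on ({..<n} - S) (member_pred n A)) e"
  shows "Fin (card S) \<le> dim_set n A"
proof -
  have "A \<noteq> {}" using box_on_nonempty[OF assms(2)] unfolding ex_on_def by blast
  moreover have "card S \<le> Max {card S | S. S \<subseteq> {..<n} \<and>
     subtopology (pow_top n) (coord_subspace n S) interior_of (coord_proj n S ` A) \<noteq> {}}"
    using assms interior_coord_proj_iff[OF A assms(1)] by (intro Max_ge dim_candidates) blast
  ultimately show ?thesis by (simp add: dim_set_def)
qed

lemma dim_set_witness:
  assumes "A \<noteq> {}"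
  obtains S where "S \<subseteq> {..<n}" "\<forall>e. box_on S (ex_on ({..<n} - S) (member_pred n A)) e"
    "dim_set n A = Fin (card S)"
proof -
  let ?D = "{card S | S. S \<subseteq> {..<n} \<and>
     subtopology (pow_top n) (coord_subspace n S) interior_of (coord_proj n S ` A) \<noteq> {}}"
  have "box_on {} (ex_on ({..<n} - {}) (member_pred n A)) e" for e
    unfolding box_on_member_iff[OF A empty_subsetI] using assms by auto
  hence "0 \<in> ?D" using interior_coord_proj_iff[OF A empty_subsetI] by force
  hence "Max ?D \<in> ?D" by (intro Max_in dim_candidates) auto
  then obtain S where S: "Max ?D = card S" "S \<subseteq> {..<n}"
    "subtopology (pow_top n) (coord_subspace n S) interior_of (coord_proj n S ` A) \<noteq> {}" by blast
  show thesis
    by (rule that[OF S(2)]) (use S interior_coord_proj_iff[OF A S(2)] assms in \<open>auto simp: dim_set_def\<close>)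
qed

end

lemma dim_set_empty: "dim_set n {} = Minf"
  by (simp add: dim_set_def)

lemma dim_set_mono:
  fixes A B :: "(nat \<Rightarrow> 'a::{linordered_field, linorder_topology}) set"
  assumes "A \<subseteq> B" "B \<subseteq> pow_space n"
  shows "dim_set n A \<le> dim_set n B"
proof (cases "A = {}")
  case False
  obtain S where S: "S \<subseteq> {..<n}" "\<forall>e. box_on S (ex_on ({..<n} - S) (member_pred n A)) e"
    "dim_set n A = Fin (card S)" using dim_set_witness[of A n] assms False by blast
  have "box_on S (ex_on ({..<n} - S) (member_pred n B)) undefined"
    by (rule box_on_mono[OF S(2)[rule_format]]) (use assms(1) in \<open>auto simp: ex_on_def\<close>)
  thus ?thesis using dim_set_ge[OF assms(2) S(1)] S(3) by simp
qed (simp add: dim_set_empty)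

section \<open>The four claims\<close>

context restrained_expansion
begin

lemma D_Sigma_subset: "D_Sigma K n A \<Longrightarrow> A \<subseteq> pow_space n"
  unfolding D_Sigma_def definable_def by blast

text \<open>The extra coordinate of the closed set \<open>Y\<close> is variable \<open>n\<close>,
  and the class \<open>ds\<close> admits its existential quantification.\<close>

lemma ds_member_pred:
  assumes "D_Sigma K n A"
  shows "ds (member_pred n A)"
proof -
  obtain Y where Y: "definable K (n + 1) Y" "closedin (pow_top (n + 1)) Y" "A = proj_first n ` Y"
    using assms unfolding D_Sigma_def by blast
  have Ysub: "Y \<subseteq> pow_space (n + 1)" using closedin_subset[OF Y(2)] by simp
  have "member_pred n A = ex_at n (member_pred (n + 1) Y)"
  proof
    fix e
    show "member_pred n A e = ex_at n (member_pred (n + 1) Y) e"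
    proof
      assume "member_pred n A e"
      then obtain y where y: "y \<in> Y" "restrict e {..<n} = restrict y {..<n}"
        unfolding Y(3) proj_first_def by blast
      have "restrict (e(n := y n)) {..<n + 1} = y"
      proof (rule extensionalityI[of _ "{..<n + 1}"])
        show "y \<in> extensional {..<n + 1}" using y(1) Ysub by (auto simp: PiE_def)
        fix i assume "i \<in> {..<n + 1}"
        thus "restrict (e(n := y n)) {..<n + 1} i = y i"
          using fun_cong[OF y(2), of i] by (auto split: if_splits)
      qed simp
      thus "ex_at n (member_pred (n + 1) Y) e" using y(1) unfolding ex_at_def by metis
    next
      assume "ex_at n (member_pred (n + 1) Y) e"
      then obtain a where a: "restrict (e(n := a)) {..<n + 1} \<in> Y" unfolding ex_at_def by blast
      have "restrict e {..<n} = proj_first n (restrict (e(n := a)) {..<n + 1})"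
        by (auto simp: proj_first_def fun_eq_iff)
      thus "member_pred n A e" unfolding Y(3) using a by blast
    qed
  qed
  moreover have "ds (member_pred (n + 1) Y)"
    by (intro ds_closed dpred_of_definable closed_pred_closedin Y)
  ultimately show ?thesis using ds_ex_at by simp
qed

lemma ds_ex_member: "D_Sigma K n A \<Longrightarrow> ds (ex_on ({..<n} - S) (member_pred n A))"
  by (intro ds_ex_on ds_member_pred) auto

text \<open>If the projection of the closure contains a box, the projection of \<open>A\<close> is
  dense in that box, and density already gives interior for this class.\<close>

lemma dim_closure_of:
  assumes A: "D_Sigma K n A"
  shows "dim_set n (pow_top n closure_of A) = dim_set n A"
proof (cases "A = {}")
  case False
  let ?C = "pow_top n closure_of A"
  have C: "?C \<subseteq> pow_space n" using closure_of_subset_topspace[of "pow_top n" A] by simp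
  have AC: "A \<subseteq> ?C" using D_Sigma_subset[OF A] by (intro closure_of_subset) simp
  show ?thesis
  proof (rule antisym)
    show "dim_set n A \<le> dim_set n ?C" by (rule dim_set_mono[OF AC C])
    have "?C \<noteq> {}" using AC False by blast
    obtain S where S: "S \<subseteq> {..<n}" "\<forall>e. box_on S (ex_on ({..<n} - S) (member_pred n ?C)) e"
      "dim_set n ?C = Fin (card S)"
      by (rule dim_set_witness[OF C \<open>?C \<noteq> {}\<close>])
    have finS: "finite S" using S(1) finite_subset by blast
    obtain a b where ab: "\<forall>i\<in>S. a i < b i"
      "\<And>z. \<forall>i\<in>S. a i < z i \<and> z i < b i \<Longrightarrow> \<exists>x\<in>?C. \<forall>i\<in>S. x i = z i"
      using S(2)[rule_format, unfolded box_on_member_iff[OF C S(1)]] by blast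
    have "dense_box S (ex_on ({..<n} - S) (member_pred n A)) undefined a b"
      unfolding dense_box_def
    proof (intro allI impI)
      fix a' b' assume a'b': "\<forall>i\<in>S. a i \<le> a' i \<and> a' i < b' i \<and> b' i \<le> b i"
      define z where "z = (\<lambda>i. (a' i + b' i) / 2)"
      have z: "a' i < z i" "z i < b' i" if "i \<in> S" for i using a'b' that by (auto simp: z_def)
      hence "\<forall>i\<in>S. a i < z i \<and> z i < b i" using a'b' by (meson le_less_trans less_le_trans)
      then obtain x where x: "x \<in> ?C" "\<forall>i\<in>S. x i = z i" using ab(2) by blast
      let ?W = "Pi\<^sub>E {..<n} (\<lambda>i. if i \<in> S then {a' i<..<b' i} else UNIV)"
      have "openin (pow_top n) ?W" by (subst openin_PiE) auto
      moreover have "x \<in> ?W" using x C z by (auto simp: PiE_iff)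
      ultimately obtain y where y: "y \<in> A" "y \<in> ?W" using x(1) unfolding in_closure_of by blast
      have ab_y: "\<forall>i\<in>S. a' i < y i \<and> y i < b' i"
      proof
        fix i assume i: "i \<in> S"
        hence "i \<in> {..<n}" using S(1) by blast
        from PiE_mem[OF y(2) this] show "a' i < y i \<and> y i < b' i" using i by simp
      qed
      have "restrict (override_on (override_on undefined y S) y ({..<n} - S)) {..<n} = y"
        using y(1) D_Sigma_subset[OF A]
        by (intro extensionalityI[of _ "{..<n}"]) (auto simp: override_on_def PiE_def)
      hence "ex_on ({..<n} - S) (member_pred n A) (override_on undefined y S)"
        using y(1) unfolding ex_on_def by metis
      thus "\<exists>z. (\<forall>i\<in>S. a' i < z i \<and> z i < b' i) \<and>
          ex_on ({..<n} - S) (member_pred n A) (override_on undefined z S)" using ab_y by blast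
    qed
    from dense_box_imp_box_on[OF ds_ex_member[OF A] finS ab(1) this]
    show "dim_set n ?C \<le> dim_set n A" unfolding S(3) by (rule dim_set_ge[OF D_Sigma_subset[OF A] S(1)])
  qed
qed simp

text \<open>Projections commute with unions, and a union of two such sets has interior only if one
  of them does.\<close>

lemma dim_union:
  assumes A: "D_Sigma K n A" "D_Sigma K n A'"
  shows "dim_set n (A \<union> A') = max (dim_set n A) (dim_set n A')"
proof (rule antisym)
  have sub: "A \<union> A' \<subseteq> pow_space n" using D_Sigma_subset A by blast
  show "max (dim_set n A) (dim_set n A') \<le> dim_set n (A \<union> A')"
    by (intro max.boundedI dim_set_mono sub) auto
  show "dim_set n (A \<union> A') \<le> max (dim_set n A) (dim_set n A')"
  proof (cases "A \<union> A' = {}")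
    case False
    obtain S where S: "S \<subseteq> {..<n}" "\<forall>e. box_on S (ex_on ({..<n} - S) (member_pred n (A \<union> A'))) e"
      "dim_set n (A \<union> A') = Fin (card S)"
      by (rule dim_set_witness[OF sub False])
    have "finite S" using S(1) finite_subset by blast
    have "box_on S (\<lambda>e. ex_on ({..<n} - S) (member_pred n A) e \<or> ex_on ({..<n} - S) (member_pred n A') e) undefined"
      by (rule box_on_mono[OF S(2)[rule_format]]) (auto simp: ex_on_def)
    from box_on_disj[OF \<open>finite S\<close> ds_ex_member[OF A(1)] ds_ex_member[OF A(2)] this]
    show ?thesis
      using dim_set_ge[OF D_Sigma_subset[OF A(1)] S(1)] dim_set_ge[OF D_Sigma_subset[OF A(2)] S(1)]
      unfolding S(3) by (auto simp: le_max_iff_disj)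
  qed (simp add: dim_set_empty)
qed

text \<open>The graph need not be closed, since \<open>A\<close> need not be. Over a closed member
  \<open>Q t\<close> of an exhaustion of \<open>A\<close> it is closed by continuity, which exhausts
  the graph by closed sets.\<close>

lemma ds_graph:
  assumes A: "D_Sigma K n A" and f: "definable_map K n m A f"
    and cont: "continuous_map (subtopology (pow_top n) A) (pow_top m) f"
  shows "ds (member_pred (n + m) ((\<lambda>x. concat_point n m x (f x)) ` A))"
proof -
  let ?G = "(\<lambda>x. concat_point n m x (f x)) ` A"
  have Asub: "A \<subseteq> pow_space n" and fA: "f ` A \<subseteq> pow_space m" and defG: "definable K (n + m) ?G"
    using f unfolding definable_map_def by auto
  have G_iff: "member_pred (n + m) ?G e \<longleftrightarrow>
      restrict e {..<n} \<in> A \<and> (\<forall>i<m. e (n + i) = f (restrict e {..<n}) i)" for e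
  proof
    assume "member_pred (n + m) ?G e"
    then obtain x where x: "x \<in> A" "restrict e {..<n + m} = concat_point n m x (f x)" by blast
    have "restrict e {..<n} = x"
    proof (rule extensionalityI[of _ "{..<n}"])
      show "x \<in> extensional {..<n}" using x(1) Asub by (auto simp: PiE_def)
      fix i assume "i \<in> {..<n}"
      thus "restrict e {..<n} i = x i" using fun_cong[OF x(2), of i] by (simp add: concat_point_def)
    qed simp
    moreover have "e (n + i) = f x i" if "i < m" for i
      using fun_cong[OF x(2), of "n + i"] that by (simp add: concat_point_def)
    ultimately show "restrict e {..<n} \<in> A \<and> (\<forall>i<m. e (n + i) = f (restrict e {..<n}) i)"
      using x(1) by simp
  next
    assume *: "restrict e {..<n} \<in> A \<and> (\<forall>i<m. e (n + i) = f (restrict e {..<n}) i)"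
    have "restrict e {..<n + m} = concat_point n m (restrict e {..<n}) (f (restrict e {..<n}))"
    proof (rule extensionalityI[of _ "{..<n + m}"])
      fix i assume i: "i \<in> {..<n + m}"
      show "restrict e {..<n + m} i = concat_point n m (restrict e {..<n}) (f (restrict e {..<n})) i"
      proof (cases "i < n")
        case False
        hence "e (n + (i - n)) = f (restrict e {..<n}) (i - n)" using i by (intro conjunct2[OF *, rule_format]) auto
        thus ?thesis using i False by (simp add: concat_point_def)
      qed (use i in \<open>simp add: concat_point_def\<close>)
    qed (simp_all add: concat_point_def)
    thus "member_pred (n + m) ?G e" using * by blast
  qed
  obtain Q where Q: "ds_family Q" "\<And>e. member_pred n A e \<longleftrightarrow> (\<exists>t. Q t e)"
    using ds_member_pred[OF A] unfolding ds_def by blast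
  note QD = ds_familyD[OF Q(1)]
  have "closed_pred (\<lambda>e. Q t e \<and> member_pred (n + m) ?G e)" for t
    unfolding closed_pred_def
  proof (intro allI impI)
    fix e assume e: "\<not> (Q t e \<and> member_pred (n + m) ?G e)"
    show "\<exists>\<delta>>0. \<forall>e'. (\<forall>i. \<bar>e' i - e i\<bar> < \<delta>) \<longrightarrow> \<not> (Q t e' \<and> member_pred (n + m) ?G e')"
    proof (cases "Q t e")
      case False
      thus ?thesis using QD(1) unfolding closed_pred_def by meson
    next
      case True
      let ?x = "restrict e {..<n}"
      have x: "?x \<in> A" using True Q(2) by blast
      then obtain i where i: "i < m" "e (n + i) \<noteq> f ?x i" using e True unfolding G_iff by blast
      \<comment> \<open>Half the gap between the point and the graph: an error below \<eta> in the
        point and one below \<eta> in the value of \<open>f\<close> cannot close it.\<close>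
      define \<eta> where "\<eta> = \<bar>e (n + i) - f ?x i\<bar> / 2"
      have \<eta>: "\<eta> > 0" using i(2) by (simp add: \<eta>_def)
      let ?V = "Pi\<^sub>E {..<m} (\<lambda>j. if j = i then {f ?x i - \<eta><..<f ?x i + \<eta>} else UNIV)"
      have V: "openin (pow_top m) ?V" by (subst openin_PiE) auto
      have "openin (subtopology (pow_top n) A) {x \<in> topspace (subtopology (pow_top n) A). f x \<in> ?V}"
        using cont V unfolding continuous_map_def by blast
      then obtain W where W: "openin (pow_top n) W"
        "{x \<in> topspace (subtopology (pow_top n) A). f x \<in> ?V} = W \<inter> A"
        unfolding openin_subtopology by blast
      have "f ?x \<in> ?V" using x fA \<eta> by (auto simp: PiE_iff)
      hence xW: "?x \<in> W" using x Asub W(2) by auto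
      have Wsub: "W \<subseteq> pow_space n" using openin_subset[OF W(1)] by simp
      have "\<exists>\<delta>>0. \<forall>y\<in>pow_space n. (\<forall>i<n. \<bar>y i - ?x i\<bar> < \<delta>) \<longrightarrow> y \<in> W"
        by (rule bspec[OF openin_pow_top_iff[OF Wsub, THEN iffD1, OF W(1)] xW])
      then obtain \<delta> where \<delta>: "\<delta> > 0" "\<And>y. y \<in> pow_space n \<Longrightarrow> \<forall>i<n. \<bar>y i - ?x i\<bar> < \<delta> \<Longrightarrow> y \<in> W"
        by blast
      show ?thesis
      proof (intro exI[of _ "min \<delta> \<eta>"] conjI allI impI notI; (elim conjE)?)
        fix e' assume e': "\<forall>i. \<bar>e' i - e i\<bar> < min \<delta> \<eta>" "member_pred (n + m) ?G e'"
        let ?x' = "restrict e' {..<n}"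
        have x': "?x' \<in> A" "e' (n + i) = f ?x' i" using e'(2) i(1) unfolding G_iff by auto
        have "?x' \<in> W" by (rule \<delta>(2)) (use e'(1) in auto)
        hence fV: "f ?x' \<in> ?V" using x' W(2) by blast
        have "f ?x' i \<in> {f ?x i - \<eta><..<f ?x i + \<eta>}" using i(1) PiE_mem[OF fV, of i] by simp
        hence "\<bar>e' (n + i) - f ?x i\<bar> < \<eta>" unfolding x'(2) by (auto simp: abs_less_iff algebra_simps)
        moreover have "\<bar>e' (n + i) - e (n + i)\<bar> < \<eta>" using e'(1) by auto
        moreover have "\<bar>e (n + i) - f ?x i\<bar> \<le> \<bar>e' (n + i) - e (n + i)\<bar> + \<bar>e' (n + i) - f ?x i\<bar>"
          using abs_triangle_ineq[of "e (n + i) - e' (n + i)" "e' (n + i) - f ?x i"]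
          by (simp add: abs_minus_commute)
        ultimately have "\<bar>e (n + i) - f ?x i\<bar> < \<eta> + \<eta>" by (meson add_strict_mono le_less_trans)
        thus False by (simp add: \<eta>_def)
      qed (use \<delta>(1) \<eta> in simp)
    qed
  qed
  hence "ds_family (\<lambda>t e. Q t e \<and> member_pred (n + m) ?G e)"
    unfolding ds_family_def using QD(2,3)
    by (auto intro!: dpred_conj dpred_family[OF Q(1)] dpred_subst[OF dpred_of_definable[OF defG]] dterm_var)
  moreover have "member_pred (n + m) ?G e \<longleftrightarrow> (\<exists>t. Q t e \<and> member_pred (n + m) ?G e)" for e
    using Q(2)[of e] G_iff[of e] by blast
  ultimately show ?thesis unfolding ds_def by blast
qed

text \<open>Fibers live in the last \<open>m\<close> coordinates, so their indices are shifted by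
  \<open>n\<close>. The base point becomes the part of \<open>e\<close> below \<open>n\<close>, and
  a statement about a fiber becomes a predicate in the same variables as \<open>B\<close>.\<close>

lemma fiber_dim_set_iff:
  fixes B :: "(nat \<Rightarrow> 'a) set"
  assumes B: "B \<subseteq> pow_space (n + m)" and T: "T \<subseteq> {..<m}"
  shows "box_on T (ex_on ({..<m} - T) (member_pred m (fiber n m B (restrict e {..<n})))) e' \<longleftrightarrow>
    box_on ((+) n ` T) (ex_on ({n..<n + m} - (+) n ` T) (member_pred (n + m) B)) e"
proof -
  let ?T = "(+) n ` T" and ?P = "member_pred (n + m) B"
  let ?R = "{n..<n + m} - ?T" and ?F = "fiber n m B (restrict e {..<n})"
  have F: "?F \<subseteq> pow_space m" unfolding fiber_def by blast
  have ex: "ex_on ?R ?P (override_on e z ?T) \<longleftrightarrow>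
      (\<exists>x\<in>?F. \<forall>i\<in>T. x i = z (n + i))" for z
  proof
    assume "ex_on ?R ?P (override_on e z ?T)"
    then obtain w where w: "restrict (override_on (override_on e z ?T) w ?R) {..<n + m} \<in> B"
      (is "restrict ?e _ \<in> B") unfolding ex_on_def by blast
    let ?x = "\<lambda>i\<in>{..<m}. ?e (n + i)"
    have "concat_point n m (restrict e {..<n}) ?x = restrict ?e {..<n + m}"
    proof (rule extensionalityI[of _ "{..<n + m}"])
      fix i assume i: "i \<in> {..<n + m}"
      show "concat_point n m (restrict e {..<n}) ?x i = restrict ?e {..<n + m} i"
        using i by (cases "i < n") (auto simp: concat_point_def override_on_def)
    qed (simp_all add: concat_point_def)
    hence "?x \<in> ?F" using w unfolding fiber_def by simp
    moreover have "?x i = z (n + i)" if "i \<in> T" for i using that T by (auto simp: override_on_def)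
    ultimately show "\<exists>x\<in>?F. \<forall>i\<in>T. x i = z (n + i)" by blast
  next
    assume "\<exists>x\<in>?F. \<forall>i\<in>T. x i = z (n + i)"
    then obtain x where x: "x \<in> pow_space m" "concat_point n m (restrict e {..<n}) x \<in> B"
      "\<forall>i\<in>T. x i = z (n + i)" unfolding fiber_def by blast
    let ?w = "concat_point n m (restrict e {..<n}) x"
    have "restrict (override_on (override_on e z ?T) ?w ?R) {..<n + m} = ?w"
    proof (rule extensionalityI[of _ "{..<n + m}"])
      fix i assume i: "i \<in> {..<n + m}"
      show "restrict (override_on (override_on e z ?T) ?w ?R) {..<n + m} i = ?w i"
      proof (cases "i \<in> ?T")
        case True
        then obtain k where "k \<in> T" "i = n + k" by blast
        thus ?thesis using i x(3) by (auto simp: override_on_def concat_point_def)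
      next
        case False
        thus ?thesis using i by (cases "i < n") (auto simp: override_on_def concat_point_def)
      qed
    qed (simp_all add: concat_point_def)
    thus "ex_on ?R ?P (override_on e z ?T)"
      using x(2) unfolding ex_on_def by metis
  qed
  show ?thesis
    unfolding box_on_member_iff[OF F T] unfolding box_on_def ex
  proof
    assume "\<exists>a b. (\<forall>i\<in>T. a i < b i) \<and> (\<forall>z. (\<forall>i\<in>T. a i < z i \<and> z i < b i) \<longrightarrow> (\<exists>x\<in>?F. \<forall>i\<in>T. x i = z i))"
    then obtain a b where ab: "\<forall>i\<in>T. a i < b i"
      "\<And>z. \<forall>i\<in>T. a i < z i \<and> z i < b i \<Longrightarrow> \<exists>x\<in>?F. \<forall>i\<in>T. x i = z i" by blast
    have "\<exists>x\<in>?F. \<forall>i\<in>T. x i = z (n + i)" if "\<forall>i\<in>?T. a (i - n) < z i \<and> z i < b (i - n)" for z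
      using ab(2)[of "\<lambda>i. z (n + i)"] that by auto
    thus "\<exists>a b. (\<forall>i\<in>?T. a i < b i) \<and> (\<forall>z. (\<forall>i\<in>?T. a i < z i \<and> z i < b i) \<longrightarrow>
        (\<exists>x\<in>?F. \<forall>i\<in>T. x i = z (n + i)))"
      using ab(1) by - (rule exI[of _ "\<lambda>i. a (i - n)"], rule exI[of _ "\<lambda>i. b (i - n)"], auto)
  next
    assume "\<exists>a b. (\<forall>i\<in>?T. a i < b i) \<and> (\<forall>z. (\<forall>i\<in>?T. a i < z i \<and> z i < b i) \<longrightarrow>
        (\<exists>x\<in>?F. \<forall>i\<in>T. x i = z (n + i)))"
    then obtain a b where ab: "\<forall>i\<in>?T. a i < b i"
      "\<And>z. \<forall>i\<in>?T. a i < z i \<and> z i < b i \<Longrightarrow> \<exists>x\<in>?F. \<forall>i\<in>T. x i = z (n + i)" by blast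
    have "\<exists>x\<in>?F. \<forall>i\<in>T. x i = z i" if "\<forall>i\<in>T. a (n + i) < z i \<and> z i < b (n + i)" for z
      using ab(2)[of "\<lambda>i. z (i - n)"] that by auto
    thus "\<exists>a b. (\<forall>i\<in>T. a i < b i) \<and> (\<forall>z. (\<forall>i\<in>T. a i < z i \<and> z i < b i) \<longrightarrow> (\<exists>x\<in>?F. \<forall>i\<in>T. x i = z i))"
      using ab(1) by - (rule exI[of _ "\<lambda>i. a (n + i)"], rule exI[of _ "\<lambda>i. b (n + i)"], auto)
  qed
qed

lemma proj_first_member:
  assumes "B \<subseteq> pow_space (n + m)"
  shows "member_pred n (proj_first n ` B) = ex_on {n..<n + m} (member_pred (n + m) B)"
proof
  fix e
  show "member_pred n (proj_first n ` B) e = ex_on {n..<n + m} (member_pred (n + m) B) e"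
  proof
    assume "member_pred n (proj_first n ` B) e"
    then obtain y where y: "y \<in> B" "restrict e {..<n} = restrict y {..<n}"
      unfolding proj_first_def by blast
    have "restrict (override_on e y {n..<n + m}) {..<n + m} = y"
    proof (rule extensionalityI[of _ "{..<n + m}"])
      show "y \<in> extensional {..<n + m}" using y(1) assms by (auto simp: PiE_def)
      fix i assume "i \<in> {..<n + m}"
      thus "restrict (override_on e y {n..<n + m}) {..<n + m} i = y i"
        using fun_cong[OF y(2), of i] by (cases "i < n") (auto simp: override_on_def)
    qed simp
    thus "ex_on {n..<n + m} (member_pred (n + m) B) e" using y(1) unfolding ex_on_def by metis
  next
    assume "ex_on {n..<n + m} (member_pred (n + m) B) e"
    then obtain w where w: "restrict (override_on e w {n..<n + m}) {..<n + m} \<in> B" unfolding ex_on_def by blast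
    have "restrict e {..<n} = proj_first n (restrict (override_on e w {n..<n + m}) {..<n + m})"
      by (auto simp: proj_first_def fun_eq_iff override_on_def)
    thus "member_pred n (proj_first n ` B) e" using w by blast
  qed
qed

lemma box_on_ex_on_imp_ex:
  fixes P :: "(nat \<Rightarrow> 'a) \<Rightarrow> bool"
  assumes "box_on T (ex_on (M - T) P) e" "T \<subseteq> M"
  shows "ex_on M P e"
proof -
  obtain z where "ex_on (M - T) P (override_on e z T)" using box_on_nonempty[OF assms(1)] by blast
  hence "ex_on T (ex_on (M - T) P) e" unfolding ex_on_def by blast
  thus ?thesis using ex_on_union[of T "M - T" P] assms(2) by (simp add: Un_absorb1)
qed

text \<open>The splitting of boxes with \<open>N\<close> the base and \<open>M\<close> the fiber
  coordinates. It is stated for \<open>ds\<close> so that it applies both to a set with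
  \<open>D_Sigma\<close> and to the graph of a continuous map.\<close>

lemma dim_fiber_upper:
  fixes B :: "(nat \<Rightarrow> 'a) set"
  assumes ds: "ds (member_pred (n + m) B)" and B: "B \<subseteq> pow_space (n + m)"
    and S: "S \<subseteq> {..<n + m}" "box_on S (ex_on ({..<n + m} - S) (member_pred (n + m) B)) e"
  obtains S' T' e' where "S' \<subseteq> {..<n}" "T' \<subseteq> {n..<n + m}" "card S' + card T' = card S"
    "box_on S' (ex_on ({..<n} - S') (member_pred n (proj_first n ` B))) e"
    "box_on T' (ex_on ({n..<n + m} - T') (member_pred (n + m) B)) e'"
    "restrict e' {..<n} \<in> proj_first n ` B"
proof -
  let ?N = "{..<n}" and ?M = "{n..<n + m}" and ?P = "member_pred (n + m) B"
  have U: "?N \<union> ?M = {..<n + m}" "(S \<inter> ?N) \<union> (S \<inter> ?M) = S" "?N \<inter> ?M = {}" using S(1) by auto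
  have fin: "finite S" using S(1) finite_subset by blast
  have "box_on ((S \<inter> ?N) \<union> (S \<inter> ?M)) (ex_on ((?N \<union> ?M) - ((S \<inter> ?N) \<union> (S \<inter> ?M))) ?P) e"
    unfolding U by (rule S(2))
  then obtain S' T' where S': "S' \<subseteq> ?N" "T' \<subseteq> ?M" "card S' + card T' = card (S \<inter> ?N) + card (S \<inter> ?M)"
    "box_on S' (ex_on (?N - S') (box_on T' (ex_on (?M - T') ?P))) e"
    using box_on_fiber_split[of ?M ?N "S \<inter> ?N" "S \<inter> ?M" ?P e] ds U(3) by auto
  have "(S \<inter> ?N) \<inter> (S \<inter> ?M) = {}" using U(3) by blast
  from card_Un_disjoint[OF _ _ this] have card: "card S' + card T' = card S"
    unfolding U(2) S'(3) using fin by simp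
  have C: "box_on T' (ex_on (?M - T') ?P) e \<Longrightarrow> member_pred n (proj_first n ` B) e" for e
    unfolding fun_cong[OF proj_first_member[OF B]] by (rule box_on_ex_on_imp_ex[OF _ S'(2)])
  have 1: "box_on S' (ex_on (?N - S') (member_pred n (proj_first n ` B))) e"
    by (rule box_on_mono[OF S'(4)], erule ex_on_mono) (rule C)
  obtain e' where e': "box_on T' (ex_on (?M - T') ?P) e'"
    using box_on_nonempty[OF S'(4)] unfolding ex_on_def[of "?N - S'"] by blast
  show thesis by (rule that[OF S'(1,2) card 1 e' C[OF e']])
qed

text \<open>The image is the projection of the graph to its last coordinates, so a box in the image
  is one for the graph. After splitting, the fiber part must be trivial because fibers of a graph
  are points, and the base part has the same cardinality.\<close>

lemma dim_image_le:
  assumes A: "D_Sigma K n A" and f: "definable_map K n m A f"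
    and cont: "continuous_map (subtopology (pow_top n) A) (pow_top m) f"
  shows "dim_set m (f ` A) \<le> dim_set n A"
proof (cases "A = {}")
  case False
  let ?G = "(\<lambda>x. concat_point n m x (f x)) ` A"
  have Asub: "A \<subseteq> pow_space n" and fA: "f ` A \<subseteq> pow_space m" using f unfolding definable_map_def by auto
  have Gsub: "?G \<subseteq> pow_space (n + m)" by (simp add: concat_point_def image_subset_iff)
  have projG: "proj_first n ` ?G = A"
  proof -
    have "proj_first n (concat_point n m x (f x)) = x" if "x \<in> A" for x
      using that Asub by (intro extensionalityI[of _ "{..<n}"]) (auto simp: proj_first_def concat_point_def PiE_def)
    thus ?thesis by (force simp: image_image)
  qed
  have "f ` A \<noteq> {}" using False by simp
  obtain T where T: "T \<subseteq> {..<m}" "\<forall>e. box_on T (ex_on ({..<m} - T) (member_pred m (f ` A))) e"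
    "dim_set m (f ` A) = Fin (card T)"
    by (rule dim_set_witness[OF fA \<open>f ` A \<noteq> {}\<close>])
  let ?S = "(+) n ` T"
  have Ssub: "?S \<subseteq> {..<n + m}" using T(1) by auto
  have boxS: "box_on ?S (ex_on ({..<n + m} - ?S) (member_pred (n + m) ?G)) undefined"
    unfolding box_on_member_iff[OF Gsub Ssub]
  proof -
    obtain a b where ab: "\<forall>i\<in>T. a i < b i"
      "\<And>z. \<forall>i\<in>T. a i < z i \<and> z i < b i \<Longrightarrow> \<exists>x\<in>f ` A. \<forall>i\<in>T. x i = z i"
      using T(2)[rule_format, unfolded box_on_member_iff[OF fA T(1)]] by blast
    have "\<exists>x\<in>?G. \<forall>i\<in>?S. x i = z i" if z: "\<forall>i\<in>?S. a (i - n) < z i \<and> z i < b (i - n)" for z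
    proof -
      obtain x where x: "x \<in> A" "\<forall>i\<in>T. f x i = z (n + i)" using ab(2)[of "\<lambda>i. z (n + i)"] z by auto
      have "\<forall>i\<in>?S. concat_point n m x (f x) i = z i" using x(2) T(1) by (auto simp: concat_point_def)
      thus ?thesis using x(1) by blast
    qed
    thus "\<exists>a b. (\<forall>i\<in>?S. a i < b i) \<and> (\<forall>z. (\<forall>i\<in>?S. a i < z i \<and> z i < b i) \<longrightarrow> (\<exists>x\<in>?G. \<forall>i\<in>?S. x i = z i))"
      using ab(1) by - (rule exI[of _ "\<lambda>i. a (i - n)"], rule exI[of _ "\<lambda>i. b (i - n)"], auto)
  qed
  obtain S' T' e' where S': "S' \<subseteq> {..<n}" "T' \<subseteq> {n..<n + m}" "card S' + card T' = card ?S"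
    "box_on S' (ex_on ({..<n} - S') (member_pred n A)) undefined"
    "box_on T' (ex_on ({n..<n + m} - T') (member_pred (n + m) ?G)) e'"
    by (rule dim_fiber_upper[OF ds_graph[OF A f cont] Gsub Ssub boxS, unfolded projG])
  \<comment> \<open>A coordinate \<open>k\<close> in \<open>T'\<close> would range over an interval,
    although the point of \<open>A\<close> below determines it.\<close>
  have "T' = {}"
  proof (rule ccontr)
    assume "T' \<noteq> {}"
    then obtain k where k: "k \<in> T'" by blast
    obtain a b where ab: "\<forall>i\<in>T'. a i < b i"
      "\<And>z. \<forall>i\<in>T'. a i < z i \<and> z i < b i \<Longrightarrow>
        ex_on ({n..<n + m} - T') (member_pred (n + m) ?G) (override_on e' z T')"
      using S'(5) unfolding box_on_def by blast
    have val: "z k = f (restrict e' {..<n}) (k - n)" if z: "\<forall>i\<in>T'. a i < z i \<and> z i < b i" for z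
    proof -
      obtain w where w: "restrict (override_on (override_on e' z T') w ({n..<n + m} - T')) {..<n + m} \<in> ?G"
        using ab(2)[OF z] unfolding ex_on_def by blast
      then obtain x where x: "x \<in> A"
        "restrict (override_on (override_on e' z T') w ({n..<n + m} - T')) {..<n + m} = concat_point n m x (f x)"
        by blast
      have "restrict e' {..<n} = x"
      proof (rule extensionalityI[of _ "{..<n}"])
        show "x \<in> extensional {..<n}" using x(1) Asub by (auto simp: PiE_def)
        fix i assume i: "i \<in> {..<n}"
        hence "i \<notin> T'" using S'(2) by auto
        thus "restrict e' {..<n} i = x i"
          using fun_cong[OF x(2), of i] i by (simp add: concat_point_def override_on_def)
      qed simp
      moreover have "n \<le> k" "k < n + m" using k S'(2) by auto
      ultimately show ?thesis
        using fun_cong[OF x(2), of k] k by (simp add: concat_point_def override_on_def)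
    qed
    \<comment> \<open>Two distinct points of the box, at one third and at one half of each edge,
      give two values for the same coordinate.\<close>
    have "(2 * a k + b k) / 3 = f (restrict e' {..<n}) (k - n)"
      by (rule val[of "\<lambda>i. (2 * a i + b i) / 3"]) (use ab(1) in \<open>auto simp: field_simps\<close>)
    moreover have "(a k + b k) / 2 = f (restrict e' {..<n}) (k - n)"
      by (rule val[of "\<lambda>i. (a i + b i) / 2"]) (use ab(1) in \<open>auto simp: field_simps\<close>)
    ultimately have "(2 * a k + b k) / 3 = (a k + b k) / 2" by simp
    thus False using ab(1) k by (auto simp: field_simps)
  qed
  hence "card T = card S'" using S'(3) by (simp add: card_image)
  thus ?thesis using dim_set_ge[OF Asub S'(1,4)] T(3) by simp
qed (simp add: dim_set_empty)

text \<open>The upper bound splits a maximal box of \<open>B\<close> into base and fiber parts. For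
  the lower bound a single set of fiber coordinates is found that works over a box in the base; the
  interval and existential quantifiers are then merged.\<close>

lemma dim_fibers:
  assumes B: "D_Sigma K (n + m) B" and q: "\<forall>a\<in>proj_first n ` B. dim_set m (fiber n m B a) = q" "q \<noteq> Pinf"
  shows "dim_set (n + m) B = dim_set n (proj_first n ` B) + q"
proof (cases "B = {}")
  case True
  \<comment> \<open>With no fibers, \<open>q\<close> is unconstrained; since it is not
    \<open>Pinf\<close>, adding it to \<open>Minf\<close> gives \<open>Minf\<close>.\<close>
  thus ?thesis using q(2) by (cases q) (simp_all add: dim_set_empty)
next
  case False
  let ?N = "{..<n}" and ?M = "{n..<n + m}" and ?P = "member_pred (n + m) B" and ?C = "proj_first n ` B"
  note dsP = ds_member_pred[OF B]
  have Bsub: "B \<subseteq> pow_space (n + m)" by (rule D_Sigma_subset[OF B])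
  have Csub: "?C \<subseteq> pow_space n" by (simp add: proj_first_def image_subset_iff)
  have "?C \<noteq> {}" using False by simp
  have Fsub: "fiber n m B a \<subseteq> pow_space m" for a unfolding fiber_def by blast
  have shift: "(\<lambda>i. i - n) ` T \<subseteq> {..<m}" "(+) n ` (\<lambda>i. i - n) ` T = T" "card ((\<lambda>i. i - n) ` T) = card T"
    if "T \<subseteq> ?M" for T
  proof -
    show "(\<lambda>i. i - n) ` T \<subseteq> {..<m}"
    proof (rule image_subsetI)
      fix i assume "i \<in> T"
      hence "i \<in> ?M" using that by blast
      thus "i - n \<in> {..<m}" by (simp add: less_diff_conv2 add.commute)
    qed
    have "(+) n ` (\<lambda>i. i - n) ` T = (\<lambda>i. i) ` T"
      unfolding image_image by (rule image_cong) (use that in auto)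
    thus "(+) n ` (\<lambda>i. i - n) ` T = T" by simp
    have "inj_on (\<lambda>i. i - n) T"
    proof (rule inj_onI)
      fix x y assume "x \<in> T" "y \<in> T" "x - n = y - n"
      moreover from this have "n \<le> x" "n \<le> y" using that by auto
      ultimately show "x = y" by simp
    qed
    thus "card ((\<lambda>i. i - n) ` T) = card T" by (rule card_image)
  qed
  have fiber_nonempty: "fiber n m B a \<noteq> {}" if a: "a \<in> ?C" for a
  proof -
    have a_ext: "restrict a ?N = a"
      using a Csub by (intro extensionalityI[of _ ?N]) (auto simp: PiE_def)
    have "ex_on ?M ?P a" using a a_ext fun_cong[OF proj_first_member[OF Bsub], of a] by simp
    hence "box_on ((+) n ` {}) (ex_on (?M - (+) n ` {}) ?P) a" by (simp add: box_on_empty)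
    hence "box_on {} (ex_on ({..<m} - {}) (member_pred m (fiber n m B (restrict a ?N)))) a"
      using fiber_dim_set_iff[OF Bsub, of "{}" a a] by simp
    thus ?thesis unfolding box_on_empty ex_on_def a_ext by blast
  qed
  obtain S where S: "S \<subseteq> ?N" "\<forall>e. box_on S (ex_on (?N - S) (member_pred n ?C)) e"
    "dim_set n ?C = Fin (card S)" by (rule dim_set_witness[OF Csub \<open>?C \<noteq> {}\<close>])
  obtain a0 where a0: "a0 \<in> ?C" using \<open>?C \<noteq> {}\<close> by blast
  obtain T0 where "T0 \<subseteq> {..<m}"
    "\<forall>e. box_on T0 (ex_on ({..<m} - T0) (member_pred m (fiber n m B a0))) e"
    and T0: "dim_set m (fiber n m B a0) = Fin (card T0)"
    by (rule dim_set_witness[OF Fsub fiber_nonempty[OF a0]])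
  define q' where "q' = card T0"
  have q': "q = Fin q'" using T0 q(1) a0 unfolding q'_def by auto
  have finS: "finite S" using S(1) finite_subset by blast
  show ?thesis
  proof (rule antisym)
    obtain W where W: "W \<subseteq> {..<n + m}" "\<forall>e. box_on W (ex_on ({..<n + m} - W) ?P) e"
      "dim_set (n + m) B = Fin (card W)" by (rule dim_set_witness[OF Bsub False])
    obtain S' T' e' where S': "S' \<subseteq> ?N" "T' \<subseteq> ?M" "card S' + card T' = card W"
      "box_on S' (ex_on (?N - S') (member_pred n ?C)) undefined"
      "box_on T' (ex_on (?M - T') ?P) e'" "restrict e' ?N \<in> ?C"
      by (rule dim_fiber_upper[OF dsP Bsub W(1) W(2)[rule_format]])
    have "card S' \<le> card S" using dim_set_ge[OF Csub S'(1,4)] S(3) by simp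
    moreover have "card T' \<le> q'"
    proof -
      let ?T = "(\<lambda>i. i - n) ` T'"
      have "box_on ?T (ex_on ({..<m} - ?T) (member_pred m (fiber n m B (restrict e' ?N)))) e'"
        unfolding fiber_dim_set_iff[OF Bsub shift(1)[OF S'(2)]] shift(2)[OF S'(2)] by (rule S'(5))
      from dim_set_ge[OF Fsub shift(1)[OF S'(2)] this] show ?thesis
        using q(1) S'(6) q' shift(3)[OF S'(2)] by simp
    qed
    ultimately show "dim_set (n + m) B \<le> dim_set n ?C + q" using S'(3) W(3) S(3) q' by simp
  next
    \<comment> \<open>Different base points may have their fiber boxes in different coordinates, but
      there are finitely many candidates, so one of them serves over a whole box.\<close>
    define TT where "TT = {T. T \<subseteq> ?M \<and> card T = q'}"
    have finTT: "finite TT" unfolding TT_def by (rule finite_subset[of _ "Pow ?M"]) auto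
    have finT: "finite T" if "T \<in> TT" for T using that finite_subset unfolding TT_def by blast
    have "\<exists>T\<in>TT. box_on T (ex_on (?M - T) ?P) e" if e: "member_pred n ?C e" for e
    proof -
      obtain T where T: "T \<subseteq> {..<m}"
        "\<forall>e'. box_on T (ex_on ({..<m} - T) (member_pred m (fiber n m B (restrict e ?N)))) e'"
        "dim_set m (fiber n m B (restrict e ?N)) = Fin (card T)"
        by (rule dim_set_witness[OF Fsub fiber_nonempty[OF e]])
      have "box_on ((+) n ` T) (ex_on (?M - (+) n ` T) ?P) e"
        using T(2)[rule_format, unfolded fiber_dim_set_iff[OF Bsub T(1)]] .
      moreover have "(+) n ` T \<in> TT"
        using T(1,3) q(1) q' e unfolding TT_def by (auto simp: card_image)
      ultimately show ?thesis by blast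
    qed
    hence "box_on S (\<lambda>e. \<exists>T\<in>TT. ex_on (?N - S) (box_on T (ex_on (?M - T) ?P)) e) undefined"
      by (intro box_on_mono[OF S(2)[rule_format]]) (fastforce simp: ex_on_def[of "?N - S"])
    hence "\<exists>T\<in>TT. box_on S (ex_on (?N - S) (box_on T (ex_on (?M - T) ?P))) undefined"
      by (intro box_on_bex[OF finTT _ finS] ds_ex_on ds_box_on dsP) (auto intro: finT)
    then obtain T where T: "T \<in> TT" "box_on S (ex_on (?N - S) (box_on T (ex_on (?M - T) ?P))) undefined"
      by blast
    have TM: "T \<subseteq> ?M" "card T = q'" using T(1) unfolding TT_def by auto
    have NM: "?N \<inter> ?M = {}" "?N \<union> ?M = {..<n + m}" by auto
    have disj: "(?N - S) \<inter> T = {}" "S \<inter> T = {}" using TM(1) S(1) NM(1) by blast+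
    \<comment> \<open>The remaining base coordinates move inside the fiber box by the elementary
      exchange, because they are disjoint from \<open>T\<close>.\<close>
    have "box_on S (box_on T (ex_on (?N - S) (ex_on (?M - T) ?P))) undefined"
      by (rule box_on_mono[OF T(2)]) (rule ex_on_box[OF _ disj(1)])
    moreover have "(?N - S) \<union> (?M - T) = {..<n + m} - (S \<union> T)" using S(1) TM(1) NM by blast
    ultimately have "box_on S (box_on T (ex_on ({..<n + m} - (S \<union> T)) ?P)) undefined"
      by (simp add: ex_on_union[symmetric])
    hence "box_on (S \<union> T) (ex_on ({..<n + m} - (S \<union> T)) ?P) undefined"
      using box_on_union[OF ds_ex_on[OF _ dsP] finT[OF T(1)] finS disj(2)] by simp
    moreover have "S \<union> T \<subseteq> {..<n + m}" using S(1) TM(1) NM(2) by blast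
    ultimately have "Fin (card (S \<union> T)) \<le> dim_set (n + m) B" by (intro dim_set_ge[OF Bsub])
    moreover have "card (S \<union> T) = card S + q'" using card_Un_disjoint[OF finS finT[OF T(1)] disj(2)] TM by simp
    ultimately show "dim_set n ?C + q \<le> dim_set (n + m) B" using S(3) q' by simp
  qed
qed

end

theorem theorem1p13:
  fixes K :: "('f, 'r, 'a::{linordered_field, linorder_topology}) expansion"
    and n :: nat
    and A A' :: "(nat \<Rightarrow> 'a) set"
  assumes "restrained K"
    and "D_Sigma K n A"
    and "D_Sigma K n A'"
  shows "dim_set n (pow_top n closure_of A) = dim_set n A \<and>
    (\<forall>f. definable_map K n n A f \<and> continuous_map (subtopology (pow_top n) A) (pow_top n) f
       \<longrightarrow> dim_set n (f ` A) \<le> dim_set n A) \<and>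
    dim_set n (A \<union> A') = max (dim_set n A) (dim_set n A') \<and>
    (\<forall>m B C p q. D_Sigma K (n + m) B \<and> C = proj_first n ` B \<and>
       dim_set n C = p \<and> (\<forall>a\<in>C. dim_set m (fiber n m B a) = q) \<and> q \<noteq> Pinf
       \<longrightarrow> dim_set (n + m) B = p + q)"
proof -
  interpret restrained_expansion K by unfold_locales fact
  show ?thesis
  proof (intro conjI allI impI; (elim conjE)?)
    show "dim_set n (pow_top n closure_of A) = dim_set n A" by (rule dim_closure_of[OF assms(2)])
    show "dim_set n (A \<union> A') = max (dim_set n A) (dim_set n A')" by (rule dim_union[OF assms(2,3)])
    show "dim_set n (f ` A) \<le> dim_set n A"
      if "definable_map K n n A f" "continuous_map (subtopology (pow_top n) A) (pow_top n) f" for f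
      by (rule dim_image_le[OF assms(2) that])
    show "dim_set (n + m) B = p + q"
      if "D_Sigma K (n + m) B" "C = proj_first n ` B" "dim_set n C = p"
        "\<forall>a\<in>C. dim_set m (fiber n m B a) = q" "q \<noteq> Pinf" for m B C p q
      using dim_fibers[OF that(1) that(4)[unfolded that(2)] that(5)] unfolding that(2)[symmetric] that(3) .
  qed
qed

end
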